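(* Let $\Omega\subset\mathbb{R}^2$ be a bounded polygonal Lipschitz domain with a conforming triangulation $\mathcal{K}_{\mathcal{T}}$, with vertex set $\mathcal{N}$ and set of edges not contained in $\Gamma=\partial\Omega$ denoted by $\mathcal{E}_\Omega$. Consider the Galerkin discretization of the Helmholtz problem with Robin boundary conditions by continuous piecewise linear finite elements on $\mathcal{K}_{\mathcal{T}}$, with system matrix $\mathbf{A}_k$. (a) If the algorithm MOTZ$(\mathcal{N}\cap\Gamma,\mathcal{N},\mathcal{E}_\Omega)$ returns the value MOTZ_result = certified, then the system matrix $\mathbf{A}_k$ is regular for any $k\in\mathbb{R}\setminus\{0\}$. (b) If MOTZ$(\mathcal{N}\cap\Gamma,\mathcal{N},\mathcal{E}_\Omega)$ returns the values MOTZ_trans = true and MOTZ_angle = false, then, after running the bisection algorithm correct_angle_condition, the system matrix $\mathbf{A}_k$ for the new mesh is regular for any $k\in\mathbb{R}\setminus\{0\}$.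
   Context: Setting. $S$ is the space of continuous complex-valued functions on $\Omega$ that are affine on each triangle of the mesh (conforming, i.e. without hanging nodes); $(b_z)_{z\in\mathcal{N}}$ is its nodal hat function basis. With $(u,v)=\int_\Omega u\overline v$ and $\langle u,v\rangle_\Gamma=\int_\Gamma u\overline v$, set $a_k(u,v)=(\nabla u,\nabla v)-k^2(u,v)-\mathrm{i}k\langle u,v\rangle_\Gamma$. The Galerkin discretization is: find $u_S\in S$ with $a_k(u_S,v)=F(v)$ for all $v\in S$; its system matrix is $\mathbf{A}_k=(a_k(b_z,b_y))_{y,z\in\mathcal{N}}$. Regular means invertible. Angle condition. For an edge $E\in\mathcal{E}_\Omega$ shared by the triangles $\tau_-,\tau_+$, let $\alpha_E=\alpha_-+\alpha_+$ be the sum of the angles in $\tau_-$ and $\tau_+$ opposite to $E$. $E$ satisfies the weakly acute angle condition if $\alpha_E\le\pi$. Transmission degree. For $\mathcal{N}_1\subset\mathcal{N}$ and $z'\in\mathcal{N}_1$, $\deg(z',\mathcal{N}_1)$ is the number of $z\in\mathcal{N}\setminus\mathcal{N}_1$ with $[z,z']\in\mathcal{E}_\Omega$. Algorithm MOTZ$(\mathcal{N}_{\rm test},\mathcal{N},\mathcal{E}_\Omega)$. Initialize MOTZ_trans = true, MOTZ_angle = true, $\mathcal{N}_{\rm dof}=\mathcal{N}\setminus\mathcal{N}_{\rm test}$. While $\mathcal{N}_{\rm dof}\ne\emptyset$: if there is a pair $(z,z')\in\mathcal{N}_{\rm dof}\times\mathcal{N}_{\rm test}$ with $E=[z,z']\in\mathcal{E}_\Omega$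 and $\deg(z',\mathcal{N}_{\rm test})=1$, choose such a pair, mark $E$ as a transmission edge (trans$(E)$ = true), set MOTZ_angle = false in case $\alpha_E>\pi$, and move $z$ from $\mathcal{N}_{\rm dof}$ to $\mathcal{N}_{\rm test}$; if there is no such pair, set MOTZ_trans = false and leave the loop. Finally, MOTZ_result = critical if MOTZ_trans = false or MOTZ_angle = false, and MOTZ_result = certified otherwise. Algorithm correct_angle_condition. For every transmission edge $E$ (as marked by MOTZ) with $\alpha_E>\pi$: bisect $E$ repeatedly until the weakly acute angle condition is satisfied. Here bisecting an edge means adding its midpoint as a new mesh point and bisecting the two adjacent triangles by joining the midpoint to their vertices opposite to the edge; sub-edges of $E$ that still violate the weakly acute angle condition are bisected again, until all sub-edges of $E$ satisfy it. The new mesh is the resulting conforming triangulation. *)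

theory Defs
  imports "HOL-Analysis.Analysis" "Jordan_Normal_Form.Matrix"
begin

type_synonym point = "real^2"

section \<open>Polygonal Lipschitz domains and conforming triangulations\<close>

text \<open>Locally, and after a rotation given by an orthonormal basis (e, f), the set lies strictly on
  one side of the graph of a Lipschitz function.\<close>

definition lipschitz_boundary :: "point set \<Rightarrow> bool" where
  "lipschitz_boundary \<Omega> \<longleftrightarrow>
     (\<forall>x\<in>frontier \<Omega>. \<exists>U e f \<phi> L. open U \<and> x \<in> U \<and>
        norm e = 1 \<and> norm f = 1 \<and> e \<bullet> f = 0 \<and> L-lipschitz_on UNIV (\<phi> :: real \<Rightarrow> real) \<and>
        (\<forall>y\<in>U. y \<in> \<Omega> \<longleftrightarrow> y \<bullet> f > \<phi> (y \<bullet> e)) \<and>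
        (\<forall>y\<in>U. y \<in> frontier \<Omega> \<longleftrightarrow> y \<bullet> f = \<phi> (y \<bullet> e)))"

definition polygonal_boundary :: "point set \<Rightarrow> bool" where
  "polygonal_boundary \<Omega> \<longleftrightarrow>
     (\<exists>P. finite P \<and> frontier \<Omega> = (\<Union>(a, b)\<in>P. closed_segment a b))"

definition polygonal_lipschitz_domain :: "point set \<Rightarrow> bool" where
  "polygonal_lipschitz_domain \<Omega> \<longleftrightarrow>
     open \<Omega> \<and> connected \<Omega> \<and> \<Omega> \<noteq> {} \<and> bounded \<Omega> \<and> polygonal_boundary \<Omega> \<and> lipschitz_boundary \<Omega>"

text \<open>The library's \<open>triangulation\<close> contains the conformity condition: two triangles meet in a
  common face (nothing, a vertex, an edge, or everything), which excludes hanging nodes.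
  Triangles are closed and non-degenerate.\<close>

definition conforming_triangulation :: "point set \<Rightarrow> point set set \<Rightarrow> bool" where
  "conforming_triangulation \<Omega> K \<longleftrightarrow>
     triangulation K \<and> (\<forall>\<tau>\<in>K. 2 simplex \<tau>) \<and> \<Union>K = closure \<Omega>"

definition nodes :: "point set set \<Rightarrow> point set" where
  "nodes K = {z. \<exists>\<tau>\<in>K. z extreme_point_of \<tau>}"

text \<open>An edge is represented by the closed segment it occupies.\<close>

definition edges :: "point set set \<Rightarrow> point set set" where
  "edges K = {E. \<exists>\<tau>\<in>K. E edge_of \<tau>}"

definition inner_edges :: "point set \<Rightarrow> point set set \<Rightarrow> point set set" where
  "inner_edges \<Omega> K = {E \<in> edges K. \<not> E \<subseteq> frontier \<Omega>}"

definition boundary_edges :: "point set \<Rightarrow> point set set \<Rightarrow> point set set" where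
  "boundary_edges \<Omega> K = {E \<in> edges K. E \<subseteq> frontier \<Omega>}"

section \<open>Galerkin discretization of the Helmholtz problem\<close>

text \<open>Functions on the closure of \<open>\<Omega>\<close> are represented by their extension by zero to the
  plane, so that equality of functions is equality on the closure of \<open>\<Omega>\<close>.\<close>

definition fe_space :: "point set \<Rightarrow> point set set \<Rightarrow> (point \<Rightarrow> complex) set" where
  "fe_space \<Omega> K = {u. continuous_on (closure \<Omega>) u \<and>
     (\<forall>\<tau>\<in>K. \<exists>l c. linear l \<and> (\<forall>x\<in>\<tau>. u x = l x + c)) \<and>
     (\<forall>x. x \<notin> closure \<Omega> \<longrightarrow> u x = 0)}"

definition hat :: "point set \<Rightarrow> point set set \<Rightarrow> point \<Rightarrow> point \<Rightarrow> complex" where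
  "hat \<Omega> K z = (THE b. b \<in> fe_space \<Omega> K \<and> (\<forall>y\<in>nodes K. b y = (if y = z then 1 else 0)))"

text \<open>For finite element functions this is the gradient at every point in the interior of a
  triangle, i.e. the weak gradient almost everywhere.\<close>

definition partial :: "2 \<Rightarrow> (point \<Rightarrow> complex) \<Rightarrow> point \<Rightarrow> complex" where
  "partial i u x = frechet_derivative u (at x) (axis i 1)"

definition l2_prod :: "point set \<Rightarrow> (point \<Rightarrow> complex) \<Rightarrow> (point \<Rightarrow> complex) \<Rightarrow> complex" where
  "l2_prod \<Omega> u v = (LINT x:\<Omega>|lebesgue. u x * cnj (v x))"

definition grad_prod :: "point set \<Rightarrow> (point \<Rightarrow> complex) \<Rightarrow> (point \<Rightarrow> complex) \<Rightarrow> complex" where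
  "grad_prod \<Omega> u v =
     (LINT x:\<Omega>|lebesgue. (\<Sum>i\<in>UNIV. partial i u x * cnj (partial i v x)))"

definition segment_integral :: "point \<Rightarrow> point \<Rightarrow> (point \<Rightarrow> complex) \<Rightarrow> complex" where
  "segment_integral a b g =
     of_real (dist a b) * (LINT t:{0..1}|lebesgue. g (a + t *\<^sub>R (b - a)))"

text \<open>Arc length integral over the polygonal boundary, edge by edge. The sum runs over all ordered
  pairs of end points, so each edge occurs in both orientations, whence the factor 1/2.\<close>

definition boundary_integral ::
    "point set \<Rightarrow> point set set \<Rightarrow> (point \<Rightarrow> complex) \<Rightarrow> complex" where
  "boundary_integral \<Omega> K g = (1 / 2) *
     (\<Sum>(a, b)\<in>{(a, b). a \<in> nodes K \<and> b \<in> nodes K \<and> closed_segment a b \<in> boundary_edges \<Omega> K}.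
        segment_integral a b g)"

definition helmholtz_form ::
    "point set \<Rightarrow> point set set \<Rightarrow> real \<Rightarrow> (point \<Rightarrow> complex) \<Rightarrow> (point \<Rightarrow> complex) \<Rightarrow> complex" where
  "helmholtz_form \<Omega> K k u v =
     grad_prod \<Omega> u v - (of_real k)\<^sup>2 * l2_prod \<Omega> u v
       - \<i> * of_real k * boundary_integral \<Omega> K (\<lambda>x. u x * cnj (v x))"

text \<open>The list \<open>zs\<close> is an enumeration of the nodes; row i belongs to the test function,
  column j to the trial function.\<close>

definition system_matrix ::
    "point set \<Rightarrow> point set set \<Rightarrow> real \<Rightarrow> point list \<Rightarrow> complex mat" where
  "system_matrix \<Omega> K k zs = mat (length zs) (length zs)
     (\<lambda>(i, j). helmholtz_form \<Omega> K k (hat \<Omega> K (zs ! j)) (hat \<Omega> K (zs ! i)))"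

definition regular_system_matrix :: "point set \<Rightarrow> point set set \<Rightarrow> real \<Rightarrow> bool" where
  "regular_system_matrix \<Omega> K k \<longleftrightarrow>
     (\<forall>zs. distinct zs \<and> set zs = nodes K \<longrightarrow> invertible_mat (system_matrix \<Omega> K k zs))"

section \<open>Angle condition\<close>

definition angle_at :: "point \<Rightarrow> point \<Rightarrow> point \<Rightarrow> real" where
  "angle_at p a b = arccos (((a - p) \<bullet> (b - p)) / (norm (a - p) * norm (b - p)))"

text \<open>The points p occurring in the sum are exactly the vertices opposite to the edge [a, b] in the
  triangles of K that have this edge; there are two of them if the edge is not on the boundary.\<close>

definition angle_sum :: "point set set \<Rightarrow> point \<Rightarrow> point \<Rightarrow> real" where
  "angle_sum K a b = (\<Sum>p\<in>{p. convex hull {a, b, p} \<in> K}. angle_at p a b)"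

section \<open>Algorithm MOTZ\<close>

record motz_state =
  motz_dof :: "point set"
  motz_test :: "point set"
  motz_trans :: bool
  motz_angle :: bool
  trans_edges :: "point set set"

definition trans_degree :: "point set \<Rightarrow> point set set \<Rightarrow> point \<Rightarrow> point set \<Rightarrow> nat" where
  "trans_degree N EI z' N1 = card {z \<in> N - N1. closed_segment z z' \<in> EI}"

definition motz_pair :: "point set \<Rightarrow> point set set \<Rightarrow> motz_state \<Rightarrow> point \<Rightarrow> point \<Rightarrow> bool" where
  "motz_pair N EI s z z' \<longleftrightarrow>
     z \<in> motz_dof s \<and> z' \<in> motz_test s \<and> closed_segment z z' \<in> EI \<and>
     trans_degree N EI z' (motz_test s) = 1"

definition motz_move :: "point set set \<Rightarrow> point \<Rightarrow> point \<Rightarrow> motz_state \<Rightarrow> motz_state" where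
  "motz_move K z z' s = s\<lparr>
     motz_dof := motz_dof s - {z},
     motz_test := insert z (motz_test s),
     motz_angle := (if angle_sum K z z' > pi then False else motz_angle s),
     trans_edges := insert (closed_segment z z') (trans_edges s)\<rparr>"

text \<open>Possible final states of the while loop; the choice of the pair is nondeterministic.
  The mesh K only serves to evaluate angles.\<close>

inductive motz_loop ::
    "point set set \<Rightarrow> point set \<Rightarrow> point set set \<Rightarrow> motz_state \<Rightarrow> motz_state \<Rightarrow> bool"
  for K N EI where
    finished: "motz_dof s = {} \<Longrightarrow> motz_loop K N EI s s"
  | stuck: "motz_dof s \<noteq> {} \<Longrightarrow> \<nexists>z z'. motz_pair N EI s z z' \<Longrightarrow>
      motz_loop K N EI s (s\<lparr>motz_trans := False\<rparr>)"
  | move: "motz_dof s \<noteq> {} \<Longrightarrow> motz_pair N EI s z z' \<Longrightarrow>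
      motz_loop K N EI (motz_move K z z' s) s' \<Longrightarrow> motz_loop K N EI s s'"

definition motz ::
    "point set set \<Rightarrow> point set \<Rightarrow> point set \<Rightarrow> point set set \<Rightarrow> motz_state \<Rightarrow> bool" where
  "motz K N_test N EI s \<longleftrightarrow>
     motz_loop K N EI
       \<lparr>motz_dof = N - N_test, motz_test = N_test, motz_trans = True, motz_angle = True,
        trans_edges = {}\<rparr> s"

datatype motz_outcome = Critical | Certified

definition motz_result :: "motz_state \<Rightarrow> motz_outcome" where
  "motz_result s = (if \<not> motz_trans s \<or> \<not> motz_angle s then Critical else Certified)"

section \<open>Correction of the angle condition by bisection\<close>

definition bisect :: "point set set \<Rightarrow> point \<Rightarrow> point \<Rightarrow> point set set" where
  "bisect K a b =
     {\<tau> \<in> K. \<not> closed_segment a b edge_of \<tau>} \<union>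
     (\<Union>p\<in>{p. convex hull {a, b, p} \<in> K}.
        {convex hull {a, midpoint a b, p}, convex hull {midpoint a b, b, p}})"

text \<open>Repeated bisection of one edge: W is the current set of its sub-edges.\<close>

inductive bisect_until_ok ::
    "point set set \<Rightarrow> point set set \<Rightarrow> point set set \<Rightarrow> bool" where
    ok: "(\<And>a b. closed_segment a b \<in> W \<Longrightarrow> angle_sum K a b \<le> pi) \<Longrightarrow> bisect_until_ok W K K"
  | bisect: "closed_segment a b \<in> W \<Longrightarrow> angle_sum K a b > pi \<Longrightarrow>
      bisect_until_ok
        (W - {closed_segment a b} \<union> {closed_segment a (midpoint a b), closed_segment (midpoint a b) b})
        (bisect K a b) K' \<Longrightarrow>
      bisect_until_ok W K K'"

text \<open>\<open>correct_angle_condition T K K'\<close>: processing the edges in T one after another, in some order,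
  turns the mesh K into K'. Edges already satisfying the angle condition are left unchanged by
  \<open>bisect_until_ok\<close>.\<close>

inductive correct_angle_condition ::
    "point set set \<Rightarrow> point set set \<Rightarrow> point set set \<Rightarrow> bool" where
    finished: "correct_angle_condition {} K K"
  | edge: "E \<in> T \<Longrightarrow> bisect_until_ok {E} K K1 \<Longrightarrow> correct_angle_condition (T - {E}) K1 K' \<Longrightarrow>
      correct_angle_condition T K K'"

end

theory Submission
  imports Defs "Jordan_Normal_Form.Determinant"
begin

text \<open>A function \<open>u\<close> in the kernel of the discrete problem satisfies \<open>a\<^sub>k(u, v) = 0\<close> for every finite
element function \<open>v\<close>. Testing with \<open>v = u\<close> and taking imaginary parts gives
\<open>k * (integral of |u|\<^sup>2 over the boundary) = 0\<close>, so \<open>u\<close> vanishes on all boundary edges, hence at all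
boundary nodes, because every node on the boundary is an end point of a boundary edge
(\<open>frontier_node_has_frontier_edge\<close>).

From there the zeros spread along transmission edges. If \<open>u\<close> is known to vanish at a node \<open>y\<close> and at
all neighbours of \<open>y\<close> except one neighbour \<open>z\<close>, then testing with the hat function of \<open>y\<close> leaves the
single term \<open>u(z) * a\<^sub>k(b\<^sub>z, b\<^sub>y)\<close>. The boundary part of this entry vanishes since \<open>z\<close> is an inner node,
the mass part contributes \<open>- k\<^sup>2 (b\<^sub>z, b\<^sub>y) < 0\<close>, and the gradient part is
\<open>- (cot \<alpha> + cot \<beta>) / 2\<close> for the two angles opposite to the edge, which is nonpositive
exactly if \<open>\<alpha> + \<beta> \<le> pi\<close>. Hence the entry is nonzero (\<open>transmission_entry_nonzero\<close>) and \<open>u(z) = 0\<close>.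

What a successful run of MOTZ provides is therefore recorded as a \<open>transmission_order\<close>: every inner
node \<open>z\<close> has a parent \<open>par z\<close> joined to it by an edge, and a rank that exceeds the rank of the
parent and of all other neighbours of the parent. Induction on the rank gives regularity whenever all parent
edges satisfy the angle condition (\<open>regular_if_transmission_order\<close>); this is part (a).

For part (b), bisecting a parent edge \<open>[z, par z]\<close> at its midpoint \<open>m\<close> yields a conforming mesh
which again has a transmission order: \<open>m\<close> becomes a child of \<open>par z\<close> and the parent of \<open>z\<close>, with a rank just
below that of \<open>z\<close> (\<open>transmission_order_bisect\<close>). In a triangle with the parent edge \<open>[z, par z]\<close> the node \<open>z\<close>
has the largest rank, so no triangle has two parent edges (\<open>parent_edges_separated\<close>); bisecting one parent edge
therefore leaves the triangles, and the opposite angles, of all the others untouched. So the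
correction never spoils an edge already treated (\<open>correct_angle_condition_certified\<close>). It terminates
because short pieces of the edge are seen from the two fixed opposite vertices under non-obtuse
angles (\<open>bisect_until_ok_terminates\<close>).\<close>

no_notation vec_index (infixl "$" 100)
no_notation scalar_prod (infix "\<bullet>" 70)

section \<open>Triangles in barycentric coordinates\<close>

text \<open>Twice the signed area of the triangle.\<close>
definition orient :: "point \<Rightarrow> point \<Rightarrow> point \<Rightarrow> real" where
  "orient a b c = (b$1 - a$1) * (c$2 - a$2) - (b$2 - a$2) * (c$1 - a$1)"

text \<open>As a function of \<open>x\<close> this is the barycentric coordinate belonging to \<open>c\<close>, i.e. the affine function that
vanishes on the line through \<open>a\<close>, \<open>b\<close> and equals 1 at \<open>c\<close>. The quotient of areas makes it explicit, which
later gives gradients and areas without solving a linear system.\<close>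
definition bary :: "point \<Rightarrow> point \<Rightarrow> point \<Rightarrow> point \<Rightarrow> real" where
  "bary a b c x = orient a b x / orient a b c"

lemma orient_rotate: "orient b c a = orient a b c"
  by (simp add: orient_def algebra_simps)

lemma orient_swap: "orient b a c = - orient a b c"
  by (simp add: orient_def algebra_simps)

lemma orient_same [simp]: "orient a a b = 0" "orient a b a = 0" "orient a b b = 0"
  by (simp_all add: orient_def algebra_simps)

lemma orient_perm_nonzero:
  assumes "orient a b c \<noteq> 0"
  shows "orient b c a \<noteq> 0" "orient c a b \<noteq> 0" "orient b a c \<noteq> 0" "orient a c b \<noteq> 0" "orient c b a \<noteq> 0"
  using assms by (auto simp: orient_def algebra_simps)

lemma orient_distinct:
  assumes "orient a b c \<noteq> 0"
  shows "a \<noteq> b" "b \<noteq> c" "a \<noteq> c"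
  using assms by auto

lemma bary_swap: "bary b a c x = bary a b c x"
  by (simp add: bary_def orient_swap[of b a])

lemma bary_vertex [simp]: "bary a b c a = 0" "bary a b c b = 0"
  by (simp_all add: bary_def)

lemma bary_apex: "orient a b c \<noteq> 0 \<Longrightarrow> bary a b c c = 1"
  by (simp add: bary_def)

lemma orient_affine:
  assumes "u + v = 1"
  shows "orient a b (u *\<^sub>R x + v *\<^sub>R y) = u * orient a b x + v * orient a b y"
proof -
  from assms have v: "v = 1 - u" by simp
  show ?thesis unfolding v by (simp add: orient_def algebra_simps)
qed

lemma bary_affine:
  "u + v = 1 \<Longrightarrow> bary a b c (u *\<^sub>R x + v *\<^sub>R y) = u * bary a b c x + v * bary a b c y"
  by (simp add: bary_def orient_affine add_divide_distrib)

lemma orient_affine3: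
  assumes "u + v + w = 1"
  shows "orient a b (u *\<^sub>R x + v *\<^sub>R y + w *\<^sub>R z) = u * orient a b x + v * orient a b y + w * orient a b z"
proof -
  from assms have w: "w = 1 - u - v" by simp
  show ?thesis unfolding w by (simp add: orient_def algebra_simps)
qed

lemma bary_affine3:
  "u + v + w = 1 \<Longrightarrow>
    bary a b c (u *\<^sub>R x + v *\<^sub>R y + w *\<^sub>R z) = u * bary a b c x + v * bary a b c y + w * bary a b c z"
  by (simp add: bary_def orient_affine3 add_divide_distrib)

lemma bary_sum:
  assumes "orient a b c \<noteq> 0"
  shows "bary b c a x + bary c a b x + bary a b c x = 1"
proof -
  have "orient b c x + orient c a x + orient a b x = orient a b c"
    by (simp add: orient_def algebra_simps)
  then show ?thesis
    using assms by (simp add: bary_def orient_rotate[of a b c] orient_rotate[of b c a] add_divide_distrib[symmetric])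
qed

lemma bary_decomp:
  assumes "orient a b c \<noteq> 0"
  shows "bary b c a x *\<^sub>R a + bary c a b x *\<^sub>R b + bary a b c x *\<^sub>R c = x"
proof -
  have "orient a b c *\<^sub>R x = orient b c x *\<^sub>R a + orient c a x *\<^sub>R b + orient a b x *\<^sub>R c"
    unfolding Finite_Cartesian_Product.vec_eq_iff forall_2 by (simp add: orient_def algebra_simps)
  then have "(1 / orient a b c) *\<^sub>R (orient a b c *\<^sub>R x) = (1 / orient a b c) *\<^sub>R (orient b c x *\<^sub>R a + orient c a x *\<^sub>R b + orient a b x *\<^sub>R c)"
    by simp
  then show ?thesis
    using assms by (simp add: bary_def orient_rotate[of a b c] orient_rotate[of b c a] scaleR_add_right divide_inverse mult.commute)
qed

lemma convex_hull_bary: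
  assumes "orient a b c \<noteq> 0"
  shows "convex hull {a, b, c} = {x. 0 \<le> bary b c a x \<and> 0 \<le> bary c a b x \<and> 0 \<le> bary a b c x}"
proof (intro subset_antisym subsetI)
  fix x assume "x \<in> convex hull {a, b, c}"
  then obtain u v w where *: "0 \<le> u" "0 \<le> v" "0 \<le> w" "u + v + w = 1" "x = u *\<^sub>R a + v *\<^sub>R b + w *\<^sub>R c"
    by (auto simp: convex_hull_3)
  then show "x \<in> {x. 0 \<le> bary b c a x \<and> 0 \<le> bary c a b x \<and> 0 \<le> bary a b c x}"
    using assms by (auto simp: bary_affine3 bary_apex orient_perm_nonzero[OF assms])
next
  fix x assume "x \<in> {x. 0 \<le> bary b c a x \<and> 0 \<le> bary c a b x \<and> 0 \<le> bary a b c x}"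
  then show "x \<in> convex hull {a, b, c}"
    unfolding convex_hull_3 using bary_sum[OF assms, of x]
    by (intro CollectI exI conjI) (rule bary_decomp[OF assms, symmetric], auto)
qed

lemma bary_of_combination:
  assumes "orient a b c \<noteq> 0" "u + v + w = 1" "x = u *\<^sub>R a + v *\<^sub>R b + w *\<^sub>R c"
  shows "bary b c a x = u" "bary c a b x = v" "bary a b c x = w"
  using assms by (auto simp: bary_affine3 bary_apex orient_perm_nonzero[OF assms(1)])

lemma closed_segment_bary:
  assumes "orient a b c \<noteq> 0"
  shows "closed_segment a b = {x. 0 \<le> bary b c a x \<and> 0 \<le> bary c a b x \<and> bary a b c x = 0}"
proof (intro subset_antisym subsetI)
  fix x assume "x \<in> closed_segment a b"
  then obtain u where u: "0 \<le> u" "u \<le> 1" "x = (1 - u) *\<^sub>R a + u *\<^sub>R b"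
    by (auto simp: in_segment)
  then show "x \<in> {x. 0 \<le> bary b c a x \<and> 0 \<le> bary c a b x \<and> bary a b c x = 0}"
    using bary_of_combination[OF assms, of "1 - u" u 0 x] by auto
next
  fix x assume "x \<in> {x. 0 \<le> bary b c a x \<and> 0 \<le> bary c a b x \<and> bary a b c x = 0}"
  moreover from this have "bary b c a x = 1 - bary c a b x" using bary_sum[OF assms, of x] by auto
  ultimately show "x \<in> closed_segment a b"
    unfolding in_segment using bary_decomp[OF assms, of x] by (intro exI[of _ "bary c a b x"] conjI) simp_all
qed

lemma open_segment_bary:
  assumes "orient a b c \<noteq> 0"
  shows "open_segment a b = {x. 0 < bary b c a x \<and> 0 < bary c a b x \<and> bary a b c x = 0}"
proof -
  have "x \<noteq> a \<and> x \<noteq> b \<longleftrightarrow> 0 < bary b c a x \<and> 0 < bary c a b x"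
    if x: "0 \<le> bary b c a x" "0 \<le> bary c a b x" "bary a b c x = 0" for x
  proof -
    have "x = a" if "bary c a b x = 0"
      using that x bary_decomp[OF assms, of x] bary_sum[OF assms, of x] by simp
    moreover have "x = b" if "bary b c a x = 0"
      using that x bary_decomp[OF assms, of x] bary_sum[OF assms, of x] by simp
    ultimately show ?thesis using x by (auto simp: order_less_le)
  qed
  then show ?thesis
    unfolding open_segment_def closed_segment_bary[OF assms] by auto
qed

lemma orient_eq_0_imp_collinear:
  assumes "orient a b c = 0"
  shows "collinear {a, b, c}"
proof (cases "b = a")
  case True then show ?thesis by simp
next
  case False
  define d where "d = b - a"
  define e where "e = c - a"
  have ne: "d$1 \<noteq> 0 \<or> d$2 \<noteq> 0" using False by (auto simp: d_def Finite_Cartesian_Product.vec_eq_iff forall_2)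
  have cr: "d$1 * e$2 = d$2 * e$1" using assms by (simp add: orient_def d_def e_def)
  have "\<exists>t. e = t *\<^sub>R d"
  proof (cases "d$1 = 0")
    case True
    then show ?thesis using ne cr by (intro exI[of _ "e$2 / d$2"]) (auto simp: Finite_Cartesian_Product.vec_eq_iff forall_2)
  next
    case False
    then show ?thesis using cr by (intro exI[of _ "e$1 / d$1"]) (auto simp: Finite_Cartesian_Product.vec_eq_iff forall_2 field_simps)
  qed
  then obtain t where "c - a = t *\<^sub>R (b - a)" by (auto simp: d_def e_def)
  then have "collinear {0, b - a, c - a}" by (auto simp: collinear_lemma)
  then have "collinear {b, a, c}"
    using collinear_3[of b a c] by (simp add: NO_MATCH_def)
  then show ?thesis by (simp add: insert_commute)
qed

lemma collinear_imp_orient_eq_0: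
  assumes "collinear {a, b, c}"
  shows "orient a b c = 0"
proof -
  have "collinear {b, a, c}" using assms by (simp add: insert_commute)
  then have "collinear {0, b - a, c - a}" using collinear_3[of b a c] by (simp add: NO_MATCH_def)
  then have "b - a = 0 \<or> c - a = 0 \<or> (\<exists>t. c - a = t *\<^sub>R (b - a))"
    by (auto simp: collinear_lemma)
  then show ?thesis
  proof (elim disjE exE)
    fix t assume "c - a = t *\<^sub>R (b - a)"
    then have "c = a + t *\<^sub>R (b - a)" by (simp add: algebra_simps)
    then show ?thesis by (simp add: orient_def)
  qed auto
qed

lemma orient_nonzero_iff: "orient a b c \<noteq> 0 \<longleftrightarrow> \<not> collinear {a, b, c}"
  using orient_eq_0_imp_collinear collinear_imp_orient_eq_0 by blast

lemma orient_nonzero_independent: "orient a b c \<noteq> 0 \<Longrightarrow> \<not> affine_dependent {a, b, c}"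
  using affine_dependent_imp_collinear_3 orient_nonzero_iff by blast

lemma interior_triangle_bary:
  assumes "orient a b c \<noteq> 0"
  shows "interior (convex hull {a, b, c}) = {x. 0 < bary b c a x \<and> 0 < bary c a b x \<and> 0 < bary a b c x}"
proof -
  have "interior (convex hull {a, b, c}) =
         {v. \<exists>x y z. 0 < x \<and> 0 < y \<and> 0 < z \<and> x + y + z = 1 \<and> x *\<^sub>R a + y *\<^sub>R b + z *\<^sub>R c = v}"
    using interior_convex_hull_3_minimal[of a b c] assms orient_nonzero_iff by simp
  also have "\<dots> = {x. 0 < bary b c a x \<and> 0 < bary c a b x \<and> 0 < bary a b c x}"
  proof (intro subset_antisym subsetI)
    fix x assume "x \<in> {v. \<exists>x y z. 0 < x \<and> 0 < y \<and> 0 < z \<and> x + y + z = 1 \<and> x *\<^sub>R a + y *\<^sub>R b + z *\<^sub>R c = v}"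
    then show "x \<in> {x. 0 < bary b c a x \<and> 0 < bary c a b x \<and> 0 < bary a b c x}"
      using bary_of_combination[OF assms] by auto
  next
    fix x assume "x \<in> {x. 0 < bary b c a x \<and> 0 < bary c a b x \<and> 0 < bary a b c x}"
    then show "x \<in> {v. \<exists>x y z. 0 < x \<and> 0 < y \<and> 0 < z \<and> x + y + z = 1 \<and> x *\<^sub>R a + y *\<^sub>R b + z *\<^sub>R c = v}"
      using bary_sum[OF assms, of x] by (intro CollectI exI conjI) (auto intro: bary_decomp[OF assms])
  qed
  finally show ?thesis .
qed

lemma simplex_2_iff: "2 simplex \<tau> \<longleftrightarrow> (\<exists>a b c. orient a b c \<noteq> 0 \<and> \<tau> = convex hull {a, b, c})"
proof
  assume "2 simplex \<tau>"
  then obtain C where C: "\<not> affine_dependent C" "int (card C) = 2 + 1" "\<tau> = convex hull C"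
    by (auto simp: simplex_def)
  then have "card C = 3" by simp
  then obtain a b c where "C = {a, b, c}" "a \<noteq> b" "b \<noteq> c" "a \<noteq> c"
    by (auto simp: card_3_iff)
  then show "\<exists>a b c. orient a b c \<noteq> 0 \<and> \<tau> = convex hull {a, b, c}"
    using C by (auto simp: orient_nonzero_iff collinear_3_eq_affine_dependent)
next
  assume "\<exists>a b c. orient a b c \<noteq> 0 \<and> \<tau> = convex hull {a, b, c}"
  then obtain a b c where *: "orient a b c \<noteq> 0" "\<tau> = convex hull {a, b, c}" by blast
  then have "card {a, b, c} = 3" using orient_distinct[OF *(1)] by simp
  then show "2 simplex \<tau>"
    unfolding simplex_def using * orient_nonzero_independent by (intro exI[of _ "{a, b, c}"]) auto
qed

definition verts :: "point set \<Rightarrow> point set" where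
  "verts \<tau> = {v. v extreme_point_of \<tau>}"

lemma verts_triangle: "orient a b c \<noteq> 0 \<Longrightarrow> verts (convex hull {a, b, c}) = {a, b, c}"
  using extreme_point_of_convex_hull_affine_independent[OF orient_nonzero_independent]
  by (auto simp: verts_def)

lemma verts_subset: "verts \<tau> \<subseteq> \<tau>"
  by (auto simp: verts_def extreme_point_of_def)

lemma triangle_vertsE:
  assumes "2 simplex \<tau>" "a \<in> verts \<tau>"
  obtains b c where "orient a b c \<noteq> 0" "\<tau> = convex hull {a, b, c}"
proof -
  obtain x y z where xyz: "orient x y z \<noteq> 0" "\<tau> = convex hull {x, y, z}"
    using assms(1) by (auto simp: simplex_2_iff)
  then have "a \<in> {x, y, z}" using assms(2) verts_triangle by blast
  then consider "a = x" | "a = y" | "a = z" by blast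
  then show ?thesis
  proof cases
    case 1 then show ?thesis using that xyz by blast
  next
    case 2 then show ?thesis using that[of z x] xyz orient_perm_nonzero[OF xyz(1)] by (simp add: insert_commute)
  next
    case 3 then show ?thesis using that[of x y] xyz orient_perm_nonzero[OF xyz(1)] by (simp add: insert_commute)
  qed
qed

lemma triangle_verts2E:
  assumes "2 simplex \<tau>" "a \<in> verts \<tau>" "b \<in> verts \<tau>" "a \<noteq> b"
  obtains c where "orient a b c \<noteq> 0" "\<tau> = convex hull {a, b, c}"
proof -
  obtain x y where xy: "orient a x y \<noteq> 0" "\<tau> = convex hull {a, x, y}"
    using triangle_vertsE[OF assms(1,2)] .
  then have "b \<in> {a, x, y}" using assms(3) verts_triangle by blast
  then consider "b = x" | "b = y" using assms by blast
  then show ?thesis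
  proof cases
    case 1 then show ?thesis using that xy by blast
  next
    case 2 then show ?thesis using that[of x] xy orient_perm_nonzero[OF xy(1)] by (simp add: insert_commute)
  qed
qed

lemma triangle_hull_imp_orient:
  assumes "2 simplex (convex hull {a, b, c})"
  shows "orient a b c \<noteq> 0"
proof -
  have "aff_dim (convex hull {a, b, c}) = 2" using aff_dim_simplex[OF assms] by simp
  then have "aff_dim {a, b, c} = 2" by (simp add: aff_dim_convex_hull)
  then have "\<not> collinear {a, b, c}" by (simp add: collinear_aff_dim)
  then show ?thesis by (simp add: orient_nonzero_iff)
qed

lemma face_triangle_iff:
  assumes "2 simplex \<tau>"
  shows "F face_of \<tau> \<longleftrightarrow> (\<exists>c. c \<subseteq> verts \<tau> \<and> F = convex hull c)"
proof -
  obtain x y z where xyz: "orient x y z \<noteq> 0" "\<tau> = convex hull {x, y, z}"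
    using assms(1) by (auto simp: simplex_2_iff)
  then show ?thesis
    using face_of_convex_hull_affine_independent[OF orient_nonzero_independent] verts_triangle by simp
qed

lemma edge_triangle_iff:
  assumes "2 simplex \<tau>"
  shows "closed_segment a b edge_of \<tau> \<longleftrightarrow> a \<noteq> b \<and> a \<in> verts \<tau> \<and> b \<in> verts \<tau>"
proof
  assume e: "closed_segment a b edge_of \<tau>"
  then have f: "closed_segment a b face_of \<tau>" and d: "aff_dim (closed_segment a b) = 1"
    by (auto simp: edge_of_def)
  have "a \<noteq> b" using d by auto
  moreover have "a extreme_point_of closed_segment a b" "b extreme_point_of closed_segment a b"
    by (auto simp: extreme_point_of_segment)
  then have "a extreme_point_of \<tau>" "b extreme_point_of \<tau>"
    using f extreme_point_of_face by blast+
  ultimately show "a \<noteq> b \<and> a \<in> verts \<tau> \<and> b \<in> verts \<tau>" by (auto simp: verts_def)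
next
  assume *: "a \<noteq> b \<and> a \<in> verts \<tau> \<and> b \<in> verts \<tau>"
  then have "closed_segment a b face_of \<tau>"
    using face_triangle_iff[OF assms] by (auto simp: segment_convex_hull intro!: exI[of _ "{a, b}"])
  moreover have "aff_dim (closed_segment a b) = 1"
    using * by (simp add: segment_convex_hull aff_dim_convex_hull aff_dim_2)
  ultimately show "closed_segment a b edge_of \<tau>" by (simp add: edge_of_def)
qed

lemma simplex_hull_verts: "2 simplex \<tau> \<Longrightarrow> \<tau> = convex hull verts \<tau>"
  by (auto simp: simplex_2_iff verts_triangle)

lemma continuous_on_bary: "continuous_on S (bary a b c)"
  unfolding bary_def orient_def divide_inverse by (intro continuous_intros)

section \<open>Conforming meshes and their boundary\<close>

text \<open>The faces of a triangle are the hulls of sets of its vertices, so two triangles meet in a common face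
iff they meet in the hull of their common vertices. Stated as an inclusion, conformity can be
checked pointwise, which is how it is verified after a bisection.\<close>
definition mesh :: "point set set \<Rightarrow> bool" where
  "mesh K \<longleftrightarrow> finite K \<and> (\<forall>\<tau>\<in>K. 2 simplex \<tau>) \<and>
     (\<forall>\<sigma>\<in>K. \<forall>\<tau>\<in>K. \<sigma> \<inter> \<tau> \<subseteq> convex hull (verts \<sigma> \<inter> verts \<tau>))"

definition apexes :: "point set set \<Rightarrow> point \<Rightarrow> point \<Rightarrow> point set" where
  "apexes K a b = {p. convex hull {a, b, p} \<in> K}"

lemma nodes_eq: "nodes K = (\<Union>\<tau>\<in>K. verts \<tau>)"
  by (auto simp: nodes_def verts_def)

lemma extreme_point_subset:
  "x extreme_point_of S \<Longrightarrow> T \<subseteq> S \<Longrightarrow> x \<in> T \<Longrightarrow> x extreme_point_of T"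
  by (auto simp: extreme_point_of_def)

lemma triangulation_imp_mesh:
  assumes "triangulation K" "\<forall>\<tau>\<in>K. 2 simplex \<tau>"
  shows "mesh K"
  unfolding mesh_def
proof (intro conjI ballI)
  show "finite K" using assms by (auto simp: triangulation_def)
  show "2 simplex \<tau>" if "\<tau> \<in> K" for \<tau> using assms that by auto
  fix \<sigma> \<tau> assume K: "\<sigma> \<in> K" "\<tau> \<in> K"
  have f: "\<sigma> \<inter> \<tau> face_of \<sigma>" "\<sigma> \<inter> \<tau> face_of \<tau>"
    using assms(1) K unfolding triangulation_def by (blast, metis Int_commute)
  obtain c where c: "c \<subseteq> verts \<sigma>" "\<sigma> \<inter> \<tau> = convex hull c"
    using f(1) face_triangle_iff assms(2) K by blast
  have "c \<subseteq> verts \<tau>"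
  proof
    fix v assume v: "v \<in> c"
    then have "v \<in> \<sigma> \<inter> \<tau>" unfolding c(2) by (rule hull_inc)
    then have "v extreme_point_of \<sigma> \<inter> \<tau>"
      using v c(1) by (auto simp: verts_def intro: extreme_point_subset[of v \<sigma> "\<sigma> \<inter> \<tau>"])
    then show "v \<in> verts \<tau>" using f(2) extreme_point_of_face by (auto simp: verts_def)
  qed
  then show "\<sigma> \<inter> \<tau> \<subseteq> convex hull (verts \<sigma> \<inter> verts \<tau>)"
    unfolding c(2) using c(1) by (intro hull_mono) blast
qed

lemma mesh_simplex: "mesh K \<Longrightarrow> \<tau> \<in> K \<Longrightarrow> 2 simplex \<tau>"
  by (auto simp: mesh_def)

lemma mesh_Int: "mesh K \<Longrightarrow> \<sigma> \<in> K \<Longrightarrow> \<tau> \<in> K \<Longrightarrow> x \<in> \<sigma> \<Longrightarrow> x \<in> \<tau> \<Longrightarrow> x \<in> convex hull (verts \<sigma> \<inter> verts \<tau>)"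
  by (auto simp: mesh_def)

lemma mesh_finite: "mesh K \<Longrightarrow> finite K"
  by (auto simp: mesh_def)

lemma triangle_compact: "2 simplex \<tau> \<Longrightarrow> compact \<tau>" for \<tau> :: "point set"
  by (auto simp: simplex_2_iff intro!: finite_imp_compact_convex_hull)

lemma triangle_convex: "2 simplex \<tau> \<Longrightarrow> convex \<tau>" for \<tau> :: "point set"
  by (auto simp: simplex_2_iff)

lemma finite_verts: "2 simplex \<tau> \<Longrightarrow> finite (verts \<tau>)"
  by (auto simp: simplex_2_iff verts_triangle)

lemma finite_nodes: "mesh K \<Longrightarrow> finite (nodes K)"
  by (auto simp: nodes_eq mesh_def finite_verts)

lemma mesh_compact: "mesh K \<Longrightarrow> compact (\<Union>K)"
  by (intro compact_Union) (auto simp: mesh_def triangle_compact)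

lemma extreme_in_hull_subset:
  assumes "x \<in> verts \<tau>" "2 simplex \<tau>" "V \<subseteq> verts \<tau>" "x \<in> convex hull V"
  shows "x \<in> V"
proof -
  have "convex hull V \<subseteq> \<tau>"
    using hull_mono[OF assms(3)] simplex_hull_verts[OF assms(2)] by metis
  then have "x extreme_point_of (convex hull V)"
    using assms extreme_point_subset by (auto simp: verts_def)
  then show ?thesis by (rule extreme_point_of_convex_hull)
qed

lemma node_in_verts:
  assumes "mesh K" "z \<in> nodes K" "\<sigma> \<in> K" "z \<in> \<sigma>"
  shows "z \<in> verts \<sigma>"
proof -
  obtain \<tau> where \<tau>: "\<tau> \<in> K" "z \<in> verts \<tau>" using assms by (auto simp: nodes_eq)
  then have "z \<in> convex hull (verts \<sigma> \<inter> verts \<tau>)"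
    using mesh_Int[OF assms(1,3) \<tau>(1)] assms(4) verts_subset by blast
  then show ?thesis
    using extreme_in_hull_subset[OF \<tau>(2) mesh_simplex[OF assms(1) \<tau>(1)]] by blast
qed

lemma apexes_swap: "apexes K b a = apexes K a b"
  by (simp add: apexes_def insert_commute)

lemma apex_orient:
  assumes "mesh K" "p \<in> apexes K a b"
  shows "orient a b p \<noteq> 0"
  using assms triangle_hull_imp_orient mesh_simplex by (auto simp: apexes_def)

lemma apex_verts:
  assumes "mesh K" "p \<in> apexes K a b"
  shows "verts (convex hull {a, b, p}) = {a, b, p}"
  using apex_orient[OF assms] verts_triangle by blast

lemma apex_nodes:
  assumes "mesh K" "p \<in> apexes K a b"
  shows "a \<in> nodes K" "b \<in> nodes K" "p \<in> nodes K"
  using apex_verts[OF assms] assms(2) by (auto simp: nodes_eq apexes_def)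

lemma triangle_apex:
  assumes "mesh K" "\<tau> \<in> K" "a \<in> verts \<tau>" "b \<in> verts \<tau>" "a \<noteq> b"
  obtains p where "p \<in> apexes K a b" "\<tau> = convex hull {a, b, p}"
  using triangle_verts2E[OF mesh_simplex[OF assms(1,2)] assms(3-5)] assms(2)
  by (auto simp: apexes_def)

lemma edge_iff_verts:
  assumes "mesh K"
  shows "closed_segment a b \<in> edges K \<longleftrightarrow> a \<noteq> b \<and> (\<exists>\<tau>\<in>K. a \<in> verts \<tau> \<and> b \<in> verts \<tau>)"
  using edge_triangle_iff mesh_simplex[OF assms] by (auto simp: edges_def)

lemma edge_iff_apexes:
  assumes "mesh K"
  shows "closed_segment a b \<in> edges K \<longleftrightarrow> apexes K a b \<noteq> {}"
proof
  assume "closed_segment a b \<in> edges K"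
  then show "apexes K a b \<noteq> {}"
    using edge_iff_verts[OF assms] triangle_apex[OF assms] by (metis empty_iff)
next
  assume "apexes K a b \<noteq> {}"
  then obtain p where p: "p \<in> apexes K a b" by blast
  show "closed_segment a b \<in> edges K"
    unfolding edge_iff_verts[OF assms]
    using apex_verts[OF assms p] apex_orient[OF assms p] p by (auto simp: apexes_def)
qed

lemma bary_eq_0_on_hull2: "x \<in> convex hull {a, b} \<Longrightarrow> bary a b c x = 0"
proof -
  assume "x \<in> convex hull {a, b}"
  then obtain u where "x = (1 - u) *\<^sub>R a + u *\<^sub>R b"
    by (auto simp: segment_convex_hull[symmetric] in_segment)
  then show ?thesis by (simp add: bary_affine)
qed

text \<open>Away from its end points, the two other barycentric coordinates are positive near an edge, so
locally the triangle is the half plane on its side of the edge.\<close>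
lemma near_edge:
  assumes "orient a b p \<noteq> 0" "e \<in> open_segment a b"
  obtains r where "r > 0" "\<And>x. x \<in> ball e r \<Longrightarrow> 0 \<le> bary a b p x \<Longrightarrow> x \<in> convex hull {a, b, p}"
proof -
  define S where "S = {x. 0 < bary b p a x} \<inter> {x. 0 < bary p a b x}"
  have "open S" unfolding S_def
    by (intro open_Int open_Collect_less continuous_on_const continuous_on_bary)
  moreover have "e \<in> S" using assms open_segment_bary[OF assms(1)] by (auto simp: S_def)
  ultimately obtain r where r: "r > 0" "ball e r \<subseteq> S" by (auto simp: open_contains_ball)
  have "x \<in> convex hull {a, b, p}" if "x \<in> ball e r" "0 \<le> bary a b p x" for x
    unfolding convex_hull_bary[OF assms(1)] using that r(2) by (auto simp: S_def less_imp_le)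
  then show ?thesis using that r(1) by blast
qed

lemma bary_apex_sign: "bary a b q p = orient a b p / orient a b q"
  by (simp add: bary_def)

text \<open>Two triangles on the same side of a common edge share points off the edge, namely points close to the midpoint of
the edge in direction of one of the apexes; by conformity they coincide.\<close>
lemma apex_same_side_unique:
  assumes "mesh K" "p \<in> apexes K a b" "q \<in> apexes K a b" "orient a b p * orient a b q > 0"
  shows "p = q"
proof (rule ccontr)
  assume "p \<noteq> q"
  have p: "orient a b p \<noteq> 0" and q: "orient a b q \<noteq> 0" using apex_orient assms by blast+
  then have "a \<noteq> b" by auto
  define e where "e = midpoint a b"
  have e: "e \<in> open_segment a b" using \<open>a \<noteq> b\<close> by (simp add: e_def)
  obtain r where r: "r > 0" "\<And>x. x \<in> ball e r \<Longrightarrow> 0 \<le> bary a b q x \<Longrightarrow> x \<in> convex hull {a, b, q}"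
    using near_edge[OF q e] by metis
  \<comment> \<open>Moving from the midpoint towards p by the factor t stays in the ball and in the triangle of p.\<close>
  define t where "t = min 1 (r / (2 * (norm (p - e) + 1)))"
  have t: "0 < t" "t \<le> 1" using r(1) by (auto simp: t_def intro!: divide_pos_pos add_nonneg_pos)
  define x where "x = (1 - t) *\<^sub>R e + t *\<^sub>R p"
  have "dist e x = t * norm (p - e)"
    using t by (simp add: x_def dist_norm algebra_simps norm_minus_commute flip: scaleR_diff_right)
  also have "\<dots> \<le> r / (2 * (norm (p - e) + 1)) * norm (p - e)"
    by (intro mult_right_mono) (auto simp: t_def)
  also have "\<dots> < r"
    using r(1) by (simp add: field_simps add_pos_nonneg)
  finally have ball: "x \<in> ball e r" by simp
  have be: "bary a b q e = 0" using e open_segment_bary[OF q] by auto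
  have bx: "bary a b q x = t * (orient a b p / orient a b q)"
    unfolding x_def by (subst bary_affine) (auto simp: be bary_apex_sign[of a b q p])
  have pos: "orient a b p / orient a b q > 0"
    using assms(4) by (metis zero_less_divide_iff zero_less_mult_iff)
  then have bx0: "bary a b q x > 0" unfolding bx using t by (intro mult_pos_pos)
  then have xq: "x \<in> convex hull {a, b, q}" using r(2)[OF ball] by simp
  have "e \<in> convex hull {a, b}" using e by (auto simp: open_segment_def segment_convex_hull)
  then have "e \<in> convex hull {a, b, p}" using hull_mono[of "{a, b}" "{a, b, p}"] by blast
  moreover have "p \<in> convex hull {a, b, p}" by (simp add: hull_inc)
  ultimately have xp: "x \<in> convex hull {a, b, p}"
    unfolding x_def using t by (intro convexD) auto
  have "x \<in> convex hull ({a, b, p} \<inter> {a, b, q})"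
    using mesh_Int[OF assms(1) _ _ xp xq] assms(2,3) apex_verts[OF assms(1,2)] apex_verts[OF assms(1,3)]
    by (simp add: apexes_def)
  moreover have "{a, b, p} \<inter> {a, b, q} \<subseteq> {a, b}" using \<open>p \<noteq> q\<close> by auto
  ultimately have "x \<in> convex hull {a, b}" using hull_mono by blast
  then show False using bx0 bary_eq_0_on_hull2 by fastforce
qed

lemma mesh_closed: "mesh K \<Longrightarrow> closed (\<Union>K)"
  using mesh_compact compact_imp_closed by blast

lemma hull_missing_vertex:
  assumes "V \<subseteq> {a, b, p}" "a \<notin> V" "x \<in> convex hull V"
  shows "bary b p a x = 0"
proof -
  have "V \<subseteq> {b, p}" using assms by blast
  then show ?thesis using assms(3) hull_mono[of V "{b, p}"] bary_eq_0_on_hull2 by blast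
qed

lemma triangle_at_edge_point:
  assumes "mesh K" "p \<in> apexes K a b" "e \<in> open_segment a b" "\<sigma> \<in> K" "e \<in> \<sigma>"
  shows "\<exists>q\<in>apexes K a b. \<sigma> = convex hull {a, b, q}"
proof -
  let ?\<tau> = "convex hull {a, b, p}"
  have o: "orient a b p \<noteq> 0" using apex_orient assms by blast
  have "e \<in> ?\<tau>" using assms(3) hull_mono[of "{a, b}" "{a, b, p}"]
    by (auto simp: open_segment_def segment_convex_hull)
  then have h: "e \<in> convex hull (verts \<sigma> \<inter> {a, b, p})"
    using mesh_Int[OF assms(1,4) _ assms(5)] assms(2) apex_verts[OF assms(1,2)] by (fastforce simp: apexes_def)
  have "bary b p a e > 0" "bary p a b e > 0" using assms(3) open_segment_bary[OF o] by auto
  then have "a \<in> verts \<sigma> \<inter> {a, b, p}" "b \<in> verts \<sigma> \<inter> {a, b, p}"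
    using hull_missing_vertex[of "verts \<sigma> \<inter> {a, b, p}" a b p e]
      hull_missing_vertex[of "verts \<sigma> \<inter> {a, b, p}" b p a e] h by fastforce+
  then show ?thesis using triangle_apex[OF assms(1,4)] orient_distinct[OF o] by (metis IntD1)
qed

text \<open>If all triangles at the edge lie on one side, then points just across the edge are in no triangle: a
triangle reaching arbitrarily close to an interior point \<open>e\<close> of the edge contains \<open>e\<close>, and by conformity it then
has the whole edge.\<close>
lemma one_sided_edge_frontier:
  assumes "mesh K" "p \<in> apexes K a b"
    and side: "\<And>q. q \<in> apexes K a b \<Longrightarrow> orient a b p * orient a b q > 0"
  shows "closed_segment a b \<subseteq> frontier (\<Union>K)"
proof -
  have o: "orient a b p \<noteq> 0" using apex_orient assms by blast
  have *: "e \<in> frontier (\<Union>K)" if e: "e \<in> open_segment a b" for e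
  proof -
    have "e \<in> convex hull {a, b, p}" using e hull_mono[of "{a, b}" "{a, b, p}"]
      by (auto simp: open_segment_def segment_convex_hull)
    then have "e \<in> \<Union>K" using assms(2) by (auto simp: apexes_def)
    moreover have "e \<notin> interior (\<Union>K)"
    proof
      assume "e \<in> interior (\<Union>K)"
      define C where "C = \<Union>{\<sigma> \<in> K. e \<notin> \<sigma>}"
      have "closed C" unfolding C_def
        using assms(1) by (intro closed_Union) (auto simp: mesh_def triangle_compact compact_imp_closed)
      then have "open (interior (\<Union>K) - C)" by (simp add: open_Diff)
      moreover have "e \<in> interior (\<Union>K) - C" using \<open>e \<in> interior (\<Union>K)\<close> by (auto simp: C_def)
      ultimately obtain r where r: "r > 0" "ball e r \<subseteq> interior (\<Union>K) - C"
        by (meson open_contains_ball)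
      \<comment> \<open>The point x is obtained by moving from e away from p, across the edge.\<close>
      define t where "t = r / (2 * (norm (p - e) + 1))"
      have t: "0 < t" using r(1) by (auto simp: t_def intro!: divide_pos_pos add_nonneg_pos)
      define x where "x = (1 + t) *\<^sub>R e + (- t) *\<^sub>R p"
      have "dist e x = t * norm (p - e)"
        using t by (simp add: x_def dist_norm algebra_simps norm_minus_commute flip: scaleR_diff_right)
      also have "\<dots> < r"
        using r(1) by (simp add: t_def field_simps add_pos_nonneg)
      finally have "x \<in> interior (\<Union>K) - C" using r(2) by auto
      then obtain \<sigma> where \<sigma>: "\<sigma> \<in> K" "x \<in> \<sigma>" "e \<in> \<sigma>"
        using interior_subset[of "\<Union>K"] by (auto simp: C_def)
      obtain q where q: "q \<in> apexes K a b" "\<sigma> = convex hull {a, b, q}"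
        using triangle_at_edge_point[OF assms(1,2) e \<sigma>(1,3)] by blast
      have oq: "orient a b q \<noteq> 0" using apex_orient assms(1) q by blast
      have be: "bary a b q e = 0" using e open_segment_bary[OF oq] by auto
      have "bary a b q x = - t * (orient a b p / orient a b q)"
        unfolding x_def by (subst bary_affine) (auto simp: be bary_apex_sign[of a b q p])
      moreover have "orient a b p / orient a b q > 0"
        using side[OF q(1)] by (metis zero_less_divide_iff zero_less_mult_iff)
      ultimately have "bary a b q x < 0" using t mult_pos_pos[of t "orient a b p / orient a b q"] by linarith
      then show False using \<sigma>(2) q(2) convex_hull_bary[OF oq] by auto
    qed
    ultimately show ?thesis using closure_subset[of "\<Union>K"] unfolding frontier_def by blast
  qed
  have "closed_segment a b = closure (open_segment a b)"
    using orient_distinct[OF o] by (simp add: closure_open_segment)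
  also have "\<dots> \<subseteq> frontier (\<Union>K)"
    using * by (intro closure_minimal) auto
  finally show ?thesis .
qed

lemma two_sided_edge_interior:
  assumes "mesh K" "p \<in> apexes K a b" "q \<in> apexes K a b" "orient a b p > 0" "orient a b q < 0"
  shows "open_segment a b \<subseteq> interior (\<Union>K)"
proof
  fix e assume e: "e \<in> open_segment a b"
  have p: "orient a b p \<noteq> 0" and q: "orient a b q \<noteq> 0" using assms by auto
  obtain r where r: "r > 0" "\<And>x. x \<in> ball e r \<Longrightarrow> 0 \<le> bary a b p x \<Longrightarrow> x \<in> convex hull {a, b, p}"
    using near_edge[OF p e] by metis
  obtain r' where r': "r' > 0" "\<And>x. x \<in> ball e r' \<Longrightarrow> 0 \<le> bary a b q x \<Longrightarrow> x \<in> convex hull {a, b, q}"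
    using near_edge[OF q e] by metis
  have "ball e (min r r') \<subseteq> \<Union>K"
  proof
    fix x assume x: "x \<in> ball e (min r r')"
    have "0 \<le> bary a b p x \<or> 0 \<le> bary a b q x"
      using assms(4,5) by (auto simp: bary_def field_simps)
    then have "x \<in> convex hull {a, b, p} \<or> x \<in> convex hull {a, b, q}"
      using x r(2) r'(2) by auto
    then show "x \<in> \<Union>K" using assms(2,3) by (auto simp: apexes_def)
  qed
  then show "e \<in> interior (\<Union>K)"
    using r(1) r'(1) by (meson centre_in_ball interior_maximal min_less_iff_conj open_ball subsetD)
qed

lemma edge_dichotomy:
  assumes "mesh K" "closed_segment a b \<in> edges K"
  obtains "closed_segment a b \<subseteq> frontier (\<Union>K)"
  | p q where "apexes K a b = {p, q}" "orient a b p > 0" "orient a b q < 0"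
      "open_segment a b \<subseteq> interior (\<Union>K)"
proof -
  obtain p where p: "p \<in> apexes K a b" using assms edge_iff_apexes by blast
  show ?thesis
  proof (cases "\<forall>q\<in>apexes K a b. orient a b p * orient a b q > 0")
    case True
    then show ?thesis using that(1) one_sided_edge_frontier[OF assms(1) p] by blast
  next
    case False
    then obtain q where q: "q \<in> apexes K a b" "\<not> orient a b p * orient a b q > 0" by blast
    have nz: "\<And>s. s \<in> apexes K a b \<Longrightarrow> orient a b s \<noteq> 0" using apex_orient assms by blast
    then have "orient a b p > 0 \<and> orient a b q < 0 \<or> orient a b p < 0 \<and> orient a b q > 0"
      using q p by (meson linorder_neqE_linordered_idom mult_neg_neg mult_pos_pos)
    then obtain s t where st: "s \<in> apexes K a b" "t \<in> apexes K a b" "orient a b s > 0" "orient a b t < 0"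
      using p q by blast
    have "x \<in> {s, t}" if "x \<in> apexes K a b" for x
    proof (cases "orient a b x > 0")
      case True then show ?thesis using apex_same_side_unique[OF assms(1) that st(1)] st by simp
    next
      case False
      then have "orient a b x < 0" using nz[OF that] by simp
      then show ?thesis using apex_same_side_unique[OF assms(1) that st(2)] st by (simp add: mult_neg_neg)
    qed
    then have "apexes K a b = {s, t}" using st by blast
    then show ?thesis using that(2) st two_sided_edge_interior[OF assms(1) st] by blast
  qed
qed

lemma triangle_point_cases:
  assumes "orient z b c \<noteq> 0" "x \<in> convex hull {z, b, c}" "x \<notin> convex hull {b, c}" "x \<noteq> z"
  shows "x \<in> interior (convex hull {z, b, c}) \<or> x \<in> open_segment z b \<or> x \<in> open_segment z c"
proof -
  have nn: "0 \<le> bary b c z x" "0 \<le> bary c z b x" "0 \<le> bary z b c x"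
    using assms(2) convex_hull_bary[OF assms(1)] by auto
  have o2: "orient b c z \<noteq> 0" "orient z c b \<noteq> 0" using orient_perm_nonzero[OF assms(1)] by auto
  have "bary b c z x \<noteq> 0"
    using assms(3) closed_segment_bary[OF o2(1)] nn by (auto simp: segment_convex_hull)
  then have z: "bary b c z x > 0" using nn by simp
  have "x = z" if "bary c z b x = 0" "bary z b c x = 0"
    using that bary_decomp[OF assms(1), of x] bary_sum[OF assms(1), of x] by simp
  then consider "bary c z b x > 0" "bary z b c x > 0" | "bary c z b x > 0" "bary z b c x = 0"
    | "bary c z b x = 0" "bary z b c x > 0"
    using nn assms(4) by fastforce
  then show ?thesis
  proof cases
    case 1 then show ?thesis using z interior_triangle_bary[OF assms(1)] by auto
  next
    case 2 then show ?thesis using z open_segment_bary[OF assms(1)] by auto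
  next
    case 3 then show ?thesis using z open_segment_bary[OF o2(2)]
      by (auto simp: bary_swap[of c b] bary_swap[of b z] bary_swap[of z c])
  qed
qed

text \<open>Otherwise all edges at \<open>z\<close> have triangles on both sides, and then the mesh covers a neighbourhood of
every one of its points in a small punctured disc around \<open>z\<close>. The covered part of the punctured disc is
thus open and closed in it, and by connectedness the whole disc is covered, so \<open>z\<close> is an interior point.\<close>
lemma frontier_node_has_frontier_edge:
  assumes "mesh K" "z \<in> nodes K" "z \<in> frontier (\<Union>K)"
  shows "\<exists>b. closed_segment z b \<in> edges K \<and> closed_segment z b \<subseteq> frontier (\<Union>K)"
proof (rule ccontr)
  assume none: "\<not> ?thesis"
  then have inner: "open_segment z b \<subseteq> interior (\<Union>K)" if "closed_segment z b \<in> edges K" for b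
    using edge_dichotomy[OF assms(1) that] that by metis
  \<comment> \<open>A disc around z that avoids F meets only triangles with vertex z, and none of their edges opposite to z.\<close>
  define F where "F = (\<Union>{\<sigma> \<in> K. z \<notin> \<sigma>}) \<union> (\<Union>\<sigma>\<in>K. convex hull (verts \<sigma> - {z}))"
  have "closed F" unfolding F_def
    using assms(1) by (intro closed_Un closed_Union closed_UN)
      (auto simp: mesh_def triangle_compact compact_imp_closed finite_verts intro!: compact_imp_closed finite_imp_compact_convex_hull)
  moreover have "z \<notin> F"
  proof
    assume "z \<in> F"
    then obtain \<sigma> where \<sigma>: "\<sigma> \<in> K" "z \<in> convex hull (verts \<sigma> - {z})" by (auto simp: F_def)
    have s: "2 simplex \<sigma>" using \<sigma> assms mesh_simplex by blast
    have "z \<in> \<sigma>" using \<sigma>(2) hull_mono[of "verts \<sigma> - {z}" "verts \<sigma>"] simplex_hull_verts[OF s] by blast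
    then have "z \<in> verts \<sigma>" using node_in_verts assms \<sigma> by blast
    then show False using extreme_in_hull_subset[OF _ s _ \<sigma>(2)] by blast
  qed
  ultimately obtain r where r: "r > 0" "ball z r \<subseteq> - F"
    by (meson ComplI open_Compl open_contains_ball)
  define A where "A = ball z r - {z}"
  have conn: "connected A" unfolding A_def by (intro connected_punctured_ball) simp
  have AI: "A \<inter> \<Union>K \<subseteq> interior (\<Union>K)"
  proof
    fix x assume x: "x \<in> A \<inter> \<Union>K"
    then obtain \<sigma> where \<sigma>: "\<sigma> \<in> K" "x \<in> \<sigma>" by blast
    have xF: "x \<notin> F" using x r by (auto simp: A_def)
    then have "z \<in> \<sigma>" using \<sigma> by (auto simp: F_def)
    then have "z \<in> verts \<sigma>" using node_in_verts assms \<sigma> by blast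
    then obtain b c where bc: "orient z b c \<noteq> 0" "\<sigma> = convex hull {z, b, c}"
      using triangle_vertsE mesh_simplex assms(1) \<sigma>(1) by metis
    have v: "verts \<sigma> = {z, b, c}" using verts_triangle bc by blast
    have "verts \<sigma> - {z} = {b, c}" using v orient_distinct[OF bc(1)] by auto
    then have "x \<notin> convex hull {b, c}" using xF \<sigma> by (auto simp: F_def)
    then have "x \<in> interior \<sigma> \<or> x \<in> open_segment z b \<or> x \<in> open_segment z c"
      using triangle_point_cases[OF bc(1)] \<sigma>(2) bc(2) x by (auto simp: A_def)
    moreover have "closed_segment z b \<in> edges K" "closed_segment z c \<in> edges K"
      unfolding edge_iff_verts[OF assms(1)] using v \<sigma>(1) orient_distinct[OF bc(1)] by auto
    moreover have "interior \<sigma> \<subseteq> interior (\<Union>K)" using \<sigma>(1) by (intro interior_mono) blast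
    ultimately show "x \<in> interior (\<Union>K)" using inner by blast
  qed
  have "A \<subseteq> \<Union>K"
  proof -
    have "A \<inter> \<Union>K = A \<inter> interior (\<Union>K)" using AI interior_subset by blast
    then have "openin (top_of_set A) (A \<inter> \<Union>K)" by (metis open_interior openin_open_Int)
    moreover have "closedin (top_of_set A) (A \<inter> \<Union>K)"
      using mesh_closed[OF assms(1)] by (simp add: closedin_closed_Int)
    ultimately have "A \<inter> \<Union>K = {} \<or> A \<inter> \<Union>K = A" using conn connected_clopen by blast
    moreover have "A \<inter> \<Union>K \<noteq> {}"
    proof -
      obtain \<tau> where \<tau>: "\<tau> \<in> K" "z \<in> verts \<tau>" using assms by (auto simp: nodes_eq)
      then obtain b c where bc: "orient z b c \<noteq> 0" "\<tau> = convex hull {z, b, c}"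
        using triangle_vertsE mesh_simplex assms(1) by metis
      have "z \<noteq> b" using orient_distinct[OF bc(1)] by simp
      define t where "t = r / (norm (b - z) + r)"
      have t: "0 < t" "t \<le> 1" using r(1) by (auto simp: t_def divide_simps add_nonneg_pos)
      define x where "x = (1 - t) *\<^sub>R z + t *\<^sub>R b"
      have xz: "x - z = t *\<^sub>R (b - z)" by (simp add: x_def algebra_simps)
      have "norm (x - z) = r * (norm (b - z) / (norm (b - z) + r))"
        using t r(1) by (simp add: xz t_def)
      also have "\<dots> < r * 1"
        using r(1) by (intro mult_strict_left_mono) (auto simp: divide_simps add_nonneg_pos)
      finally have "dist x z < r" by (simp add: dist_norm)
      moreover have "x \<noteq> z" using xz t \<open>z \<noteq> b\<close> by auto
      moreover have "x \<in> closed_segment z b" 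
        unfolding in_segment x_def using t by (intro exI[of _ t]) auto
      moreover have "closed_segment z b \<subseteq> \<tau>"
        unfolding bc(2) segment_convex_hull by (intro hull_mono) auto
      ultimately have "x \<in> A \<inter> \<Union>K" using \<tau> by (auto simp: A_def dist_commute)
      then show ?thesis by blast
    qed
    ultimately show ?thesis by blast
  qed
  moreover have "z \<in> \<Union>K" using assms(2) verts_subset by (auto simp: nodes_eq)
  ultimately have "ball z r \<subseteq> \<Union>K" by (auto simp: A_def)
  then have "z \<in> interior (\<Union>K)" using r(1) by (meson centre_in_ball interior_maximal open_ball subsetD)
  then show False using assms(3) by (simp add: frontier_def)
qed

text \<open>Locally the domain is the part above a graph, so just below the graph there are points outside the
closure. In particular the domain has no slits.\<close>
lemma lipschitz_frontier_closure:
  assumes "lipschitz_boundary \<Omega>"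
  shows "frontier (closure \<Omega>) = frontier \<Omega>"
proof (rule subset_antisym)
  show "frontier (closure \<Omega>) \<subseteq> frontier \<Omega>"
    using interior_mono[OF closure_subset] by (auto simp: frontier_def)
  show "frontier \<Omega> \<subseteq> frontier (closure \<Omega>)"
  proof
    fix x assume x: "x \<in> frontier \<Omega>"
    obtain U e f \<phi> L where *: "open U \<and> x \<in> U \<and>
        norm e = 1 \<and> norm f = 1 \<and> e \<bullet> f = 0 \<and> L-lipschitz_on UNIV (\<phi> :: real \<Rightarrow> real) \<and>
        (\<forall>y\<in>U. y \<in> \<Omega> \<longleftrightarrow> y \<bullet> f > \<phi> (y \<bullet> e)) \<and>
        (\<forall>y\<in>U. y \<in> frontier \<Omega> \<longleftrightarrow> y \<bullet> f = \<phi> (y \<bullet> e))"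
      using bspec[OF assms[unfolded lipschitz_boundary_def] x] by (elim exE) (rule that)
    then have U: "open U" "x \<in> U" "norm e = 1" "norm f = 1" "e \<bullet> f = 0"
      "\<forall>y\<in>U. y \<in> \<Omega> \<longleftrightarrow> y \<bullet> f > \<phi> (y \<bullet> e)" "\<forall>y\<in>U. y \<in> frontier \<Omega> \<longleftrightarrow> y \<bullet> f = \<phi> (y \<bullet> e)"
      by blast+
    have "x \<notin> interior (closure \<Omega>)"
    proof
      assume "x \<in> interior (closure \<Omega>)"
      then obtain r where r: "r > 0" "ball x r \<subseteq> U \<inter> interior (closure \<Omega>)"
        using U(1,2) by (meson IntI open_Int open_contains_ball open_interior)
      define y where "y = x - (r / 2) *\<^sub>R f"
      have "y \<in> ball x r" using r(1) U(4) by (simp add: y_def dist_norm)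
      then have y: "y \<in> U" "y \<in> closure \<Omega>" using r(2) interior_subset by blast+
      have "f \<bullet> f = 1" using U(4) by (simp add: norm_eq_1)
      then have "y \<bullet> f = x \<bullet> f - r / 2" by (simp add: y_def inner_diff_left)
      moreover have "y \<bullet> e = x \<bullet> e" using U(5) by (simp add: y_def inner_diff_left inner_commute[of f e])
      moreover have "x \<bullet> f = \<phi> (x \<bullet> e)" using U x by blast
      ultimately have "y \<bullet> f < \<phi> (y \<bullet> e)" using r(1) by simp
      then have "y \<notin> \<Omega>" "y \<notin> frontier \<Omega>" using U(6,7) y(1) by fastforce+
      moreover have "closure \<Omega> = \<Omega> \<union> frontier \<Omega>" by (rule closure_Un_frontier)
      ultimately show False using y(2) by blast
    qed
    then show "x \<in> frontier (closure \<Omega>)" using x by (auto simp: frontier_def)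
  qed
qed

section \<open>Bisection of an edge\<close>

lemma orient_midpoint:
  "orient a (midpoint a b) p = orient a b p / 2"
  "orient (midpoint a b) b p = orient a b p / 2"
  by (simp_all add: orient_def midpoint_def field_simps)

lemma orient_half:
  assumes "orient a b p \<noteq> 0" "c \<in> {a, b}"
  shows "orient c (midpoint a b) p \<noteq> 0"
  using assms orient_midpoint[of a b p] orient_swap[of "midpoint a b" b p] by auto

text \<open>The median through \<open>p\<close> is where the barycentric coordinates of \<open>a\<close> and \<open>b\<close> agree, and the two halves are
distinguished by which of the two is larger.\<close>
lemma half_triangle:
  assumes "orient a b p \<noteq> 0"
  shows "convex hull {a, midpoint a b, p} = {x \<in> convex hull {a, b, p}. bary p a b x \<le> bary b p a x}"
proof -
  let ?m = "midpoint a b"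
  have o: "orient a ?m p \<noteq> 0" using assms by (simp add: orient_midpoint)
  have p: "bary a ?m p x = bary a b p x" for x by (simp add: bary_def orient_midpoint)
  have "orient p a ?m = orient p a b / 2"
    by (simp add: orient_def midpoint_def field_simps)
  then have m: "bary p a ?m x = 2 * bary p a b x" for x
    unfolding bary_def by (simp only: divide_divide_eq_right times_divide_eq_right mult.commute)
  have "bary ?m p a x = bary b p a x - bary p a b x" for x
    using bary_sum[OF o, of x] bary_sum[OF assms, of x] by (simp add: p m)
  then show ?thesis
    unfolding convex_hull_bary[OF o] convex_hull_bary[OF assms] by (auto simp: p m)
qed

lemma half_triangle':
  assumes "orient a b p \<noteq> 0"
  shows "convex hull {b, midpoint a b, p} = {x \<in> convex hull {a, b, p}. bary b p a x \<le> bary p a b x}"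
  using half_triangle[of b a p] orient_perm_nonzero[OF assms]
  by (simp add: midpoint_sym[of b a] bary_swap[of p b] bary_swap[of a p] insert_commute)

lemma half_triangle_subset:
  assumes "orient a b p \<noteq> 0" "c \<in> {a, b}"
  shows "convex hull {c, midpoint a b, p} \<subseteq> convex hull {a, b, p}"
  using assms half_triangle half_triangle' by blast

lemma bisect_commute: "bisect K b a = bisect K a b"
  unfolding bisect_def by (simp add: midpoint_sym[of b a] closed_segment_commute[of b a] insert_commute Un_commute)

lemma bisect_eq:
  assumes "mesh K" "a \<noteq> b"
  shows "bisect K a b = {\<tau> \<in> K. \<not> (a \<in> verts \<tau> \<and> b \<in> verts \<tau>)} \<union>
     {convex hull {c, midpoint a b, p} | c p. c \<in> {a, b} \<and> p \<in> apexes K a b}"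
proof -
  have "{\<tau> \<in> K. \<not> closed_segment a b edge_of \<tau>} = {\<tau> \<in> K. \<not> (a \<in> verts \<tau> \<and> b \<in> verts \<tau>)}"
    using edge_triangle_iff mesh_simplex[OF assms(1)] assms(2) by auto
  moreover have "(\<Union>p\<in>{p. convex hull {a, b, p} \<in> K}.
        {convex hull {a, midpoint a b, p}, convex hull {midpoint a b, b, p}}) =
      {convex hull {c, midpoint a b, p} | c p. c \<in> {a, b} \<and> p \<in> apexes K a b}"
    unfolding apexes_def insert_commute[of "midpoint a b" b] by blast
  ultimately show ?thesis by (simp add: bisect_def)
qed

text \<open>An unbisected triangle \<open>\<sigma>\<close> does not have both \<open>a\<close> and \<open>b\<close> as vertices. If it misses \<open>b\<close>, the intersection
of \<open>\<sigma>\<close> with the old triangle is spanned by \<open>a\<close> and \<open>p\<close> at most, which survive as vertices of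
the half. If it misses \<open>a\<close>, the half triangle meets the intersection at most in \<open>p\<close>.\<close>
lemma half_Int_old:
  assumes "mesh K" "p \<in> apexes K a b" "\<sigma> \<in> K" "\<not> (a \<in> verts \<sigma> \<and> b \<in> verts \<sigma>)"
    "x \<in> convex hull {a, midpoint a b, p}" "x \<in> \<sigma>"
  shows "x \<in> convex hull ({a, midpoint a b, p} \<inter> verts \<sigma>)"
proof -
  have o: "orient a b p \<noteq> 0" using apex_orient assms by blast
  let ?V = "{a, b, p} \<inter> verts \<sigma>"
  have x: "x \<in> convex hull {a, b, p}" "bary p a b x \<le> bary b p a x"
    using assms(5) half_triangle[OF o] by auto
  have V: "x \<in> convex hull ?V"
    using mesh_Int[OF assms(1) _ assms(3) x(1) assms(6)] assms(2) apex_verts[OF assms(1,2)]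
    by (simp add: apexes_def)
  show ?thesis
  proof (cases "b \<in> ?V")
    case False
    then have "?V \<subseteq> {a, midpoint a b, p} \<inter> verts \<sigma>" by blast
    then show ?thesis using V hull_mono by blast
  next
    case True
    then have "a \<notin> ?V" using assms(4) by blast
    then have "bary b p a x = 0" using hull_missing_vertex[of ?V a b p x] V by blast
    moreover have "0 \<le> bary p a b x" using x(1) convex_hull_bary[OF o] by auto
    ultimately have z: "bary b p a x = 0" "bary p a b x = 0" using x(2) by auto
    then have w: "bary a b p x = 1" using bary_sum[OF o, of x] by simp
    then have "x = p" using bary_decomp[OF o, of x] z by simp
    moreover have "p \<in> ?V"
      using hull_missing_vertex[of ?V p a b x] V w by fastforce
    ultimately show ?thesis by (intro hull_inc) auto
  qed
qed

lemma half_Int_edge: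
  assumes "orient a b p \<noteq> 0" "x \<in> convex hull {a, midpoint a b, p}" "x \<in> convex hull {a, b}"
  shows "x \<in> closed_segment a (midpoint a b)"
proof -
  have o: "orient a (midpoint a b) p \<noteq> 0" using assms(1) by (simp add: orient_midpoint)
  have "bary a b p x = 0" using assms(3) bary_eq_0_on_hull2 by blast
  then have "bary a (midpoint a b) p x = 0" by (simp add: bary_def orient_midpoint)
  then show ?thesis using assms(2) closed_segment_bary[OF o] convex_hull_bary[OF o] by auto
qed

lemma half_Int_half_same_apex:
  assumes "orient a b p \<noteq> 0" "x \<in> convex hull {a, midpoint a b, p}" "x \<in> convex hull {b, midpoint a b, p}"
  shows "x \<in> convex hull {midpoint a b, p}"
proof -
  let ?s = "bary b p a x"
  have e: "bary p a b x = ?s" and x: "x \<in> convex hull {a, b, p}"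
    using assms half_triangle half_triangle' by auto
  have sum: "bary a b p x = 1 - 2 * ?s" using bary_sum[OF assms(1), of x] e by simp
  have "x = ?s *\<^sub>R a + ?s *\<^sub>R b + (1 - 2 * ?s) *\<^sub>R p"
    using bary_decomp[OF assms(1), of x] e sum by simp
  also have "\<dots> = (1 - (1 - 2 * ?s)) *\<^sub>R midpoint a b + (1 - 2 * ?s) *\<^sub>R p"
    by (simp add: midpoint_def algebra_simps)
  finally have "x = (1 - (1 - 2 * ?s)) *\<^sub>R midpoint a b + (1 - 2 * ?s) *\<^sub>R p" .
  moreover have "0 \<le> ?s" "0 \<le> 1 - 2 * ?s"
    using x convex_hull_bary[OF assms(1)] sum by auto
  ultimately have "x \<in> closed_segment (midpoint a b) p"
    unfolding in_segment by (intro exI[of _ "1 - 2 * ?s"]) auto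
  then show ?thesis by (simp add: segment_convex_hull)
qed

lemma half_Int_half:
  assumes "mesh K" "p \<in> apexes K a b" "q \<in> apexes K a b" "d \<in> {a, b}"
    "x \<in> convex hull {a, midpoint a b, p}" "x \<in> convex hull {d, midpoint a b, q}"
  shows "x \<in> convex hull ({a, midpoint a b, p} \<inter> {d, midpoint a b, q})"
proof -
  let ?m = "midpoint a b"
  have p: "orient a b p \<noteq> 0" and q: "orient a b q \<noteq> 0" using apex_orient assms by blast+
  show ?thesis
  proof (cases "p = q")
    case True
    show ?thesis
    proof (cases "d = a")
      case True then show ?thesis using \<open>p = q\<close> assms(5) by simp
    next
      case False
      then have "x \<in> convex hull {?m, p}"
        using half_Int_half_same_apex[OF p assms(5)] assms(4,6) True by blast
      moreover have "{?m, p} \<subseteq> {a, ?m, p} \<inter> {d, ?m, q}" using True by blast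
      ultimately show ?thesis using hull_mono by blast
    qed
  next
    case False
    have xp: "x \<in> convex hull {a, b, p}" and xq: "x \<in> convex hull {a, b, q}"
      using half_triangle_subset[OF p] half_triangle_subset[OF q] assms(4-6) by blast+
    have "x \<in> convex hull ({a, b, p} \<inter> {a, b, q})"
      using mesh_Int[OF assms(1) _ _ xp xq] assms(2,3) apex_verts[OF assms(1,2)] apex_verts[OF assms(1,3)]
      by (simp add: apexes_def)
    moreover have "{a, b, p} \<inter> {a, b, q} \<subseteq> {a, b}" using False by blast
    ultimately have ab: "x \<in> convex hull {a, b}" using hull_mono by blast
    have xa: "x \<in> closed_segment a ?m" using half_Int_edge[OF p assms(5) ab] .
    show ?thesis
    proof (cases "d = a")
      case True
      have "{a, ?m} \<subseteq> {a, ?m, p} \<inter> {d, ?m, q}" using True by blast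
      then show ?thesis using xa hull_mono[of "{a, ?m}"] unfolding segment_convex_hull by blast
    next
      case False
      then have "d = b" using assms(4) by blast
      then have "x \<in> closed_segment b (midpoint b a)"
        using half_Int_edge[of b a q x] assms(6) ab orient_perm_nonzero[OF q]
        by (simp add: midpoint_sym[of b a] insert_commute)
      then have "x \<in> closed_segment ?m b" by (simp add: midpoint_sym[of b a] closed_segment_commute)
      then have "x = ?m" using xa Int_closed_segment[of ?m a b] by auto
      then show ?thesis by (intro hull_inc) auto
    qed
  qed
qed

lemma bisect_triangle_cases:
  assumes "mesh K" "a \<noteq> b" "\<tau> \<in> bisect K a b"
  obtains "\<tau> \<in> K" "\<not> (a \<in> verts \<tau> \<and> b \<in> verts \<tau>)"
  | c p where "c \<in> {a, b}" "p \<in> apexes K a b" "\<tau> = convex hull {c, midpoint a b, p}"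
      "orient a b p \<noteq> 0" "verts \<tau> = {c, midpoint a b, p}" "2 simplex \<tau>"
proof -
  consider "\<tau> \<in> K" "\<not> (a \<in> verts \<tau> \<and> b \<in> verts \<tau>)"
    | c p where "c \<in> {a, b}" "p \<in> apexes K a b" "\<tau> = convex hull {c, midpoint a b, p}"
    using assms(3) unfolding bisect_eq[OF assms(1,2)] by blast
  then show ?thesis
  proof cases
    case 1 then show ?thesis using that(1) by blast
  next
    case (2 c p)
    have o: "orient a b p \<noteq> 0" using apex_orient assms 2 by blast
    have oc: "orient c (midpoint a b) p \<noteq> 0" using orient_half[OF o 2(1)] .
    then have "verts \<tau> = {c, midpoint a b, p}" "2 simplex \<tau>"
      using 2 verts_triangle simplex_2_iff by blast+
    then show ?thesis using that(2) 2 o by blast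
  qed
qed

lemma mesh_bisect:
  assumes "mesh K" "a \<noteq> b"
  shows "mesh (bisect K a b)"
  unfolding mesh_def
proof (intro conjI ballI)
  have "finite (apexes K a b)"
    using finite_subset[OF _ finite_nodes[OF assms(1)]] apex_nodes(3)[OF assms(1)] by blast
  then have "finite ((\<lambda>(c, p). convex hull {c, midpoint a b, p}) ` ({a, b} \<times> apexes K a b))" by blast
  moreover have "{convex hull {c, midpoint a b, p} | c p. c \<in> {a, b} \<and> p \<in> apexes K a b}
      \<subseteq> (\<lambda>(c, p). convex hull {c, midpoint a b, p}) ` ({a, b} \<times> apexes K a b)" by blast
  ultimately show "finite (bisect K a b)"
    unfolding bisect_eq[OF assms] using mesh_finite[OF assms(1)] finite_subset by fastforce
  show "2 simplex \<tau>" if "\<tau> \<in> bisect K a b" for \<tau>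
    using bisect_triangle_cases[OF assms that] mesh_simplex[OF assms(1)] by metis
  have half_old: "convex hull {c, midpoint a b, p} \<inter> \<sigma> \<subseteq> convex hull ({c, midpoint a b, p} \<inter> verts \<sigma>)"
    if "c \<in> {a, b}" "p \<in> apexes K a b" "\<sigma> \<in> K" "\<not> (a \<in> verts \<sigma> \<and> b \<in> verts \<sigma>)" for c p \<sigma>
  proof (cases "c = a")
    case True
    then show ?thesis using half_Int_old[OF assms(1) that(2-4)] by blast
  next
    case False
    then have "c = b" using that by blast
    then show ?thesis
      using half_Int_old[OF assms(1), of p b a \<sigma>] that by (auto simp: midpoint_sym[of b a] apexes_swap)
  qed
  have half_half: "convex hull {c, midpoint a b, p} \<inter> convex hull {d, midpoint a b, q}
      \<subseteq> convex hull ({c, midpoint a b, p} \<inter> {d, midpoint a b, q})"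
    if "c \<in> {a, b}" "d \<in> {a, b}" "p \<in> apexes K a b" "q \<in> apexes K a b" for c d p q
  proof (cases "c = a")
    case True
    then show ?thesis using half_Int_half[OF assms(1) that(3,4,2)] by blast
  next
    case False
    then have "c = b" using that by blast
    then show ?thesis
      using half_Int_half[OF assms(1), of p b a q d] that by (auto simp: midpoint_sym[of b a] apexes_swap)
  qed
  fix \<sigma> \<tau> assume \<sigma>: "\<sigma> \<in> bisect K a b" and \<tau>: "\<tau> \<in> bisect K a b"
  show "\<sigma> \<inter> \<tau> \<subseteq> convex hull (verts \<sigma> \<inter> verts \<tau>)"
    using bisect_triangle_cases[OF assms \<sigma>]
  proof cases
    case 1
    note s = this
    show ?thesis using bisect_triangle_cases[OF assms \<tau>]
    proof cases
      case 1
      then show ?thesis using s assms(1) by (simp add: mesh_def)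
    next
      case (2 d q)
      then show ?thesis using half_old[OF 2(1,2) s] by (simp add: Int_commute)
    qed
  next
    case (2 c p)
    note s = this
    show ?thesis using bisect_triangle_cases[OF assms \<tau>]
    proof cases
      case 1
      then show ?thesis using half_old[OF s(1,2) 1] s by simp
    next
      case (2 d q)
      then show ?thesis using half_half[OF s(1) 2(1) s(2) 2(2)] s by simp
    qed
  qed
qed

lemma Union_bisect:
  assumes "mesh K" "a \<noteq> b"
  shows "\<Union>(bisect K a b) = \<Union>K"
proof (intro subset_antisym subsetI)
  fix x assume "x \<in> \<Union>(bisect K a b)"
  then obtain \<tau> where \<tau>: "\<tau> \<in> bisect K a b" "x \<in> \<tau>" by blast
  show "x \<in> \<Union>K" using bisect_triangle_cases[OF assms \<tau>(1)]
  proof cases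
    case 1 then show ?thesis using \<tau> by blast
  next
    case (2 c p)
    then show ?thesis using half_triangle_subset[OF 2(4,1)] \<tau>(2) by (auto simp: apexes_def)
  qed
next
  fix x assume "x \<in> \<Union>K"
  then obtain \<tau> where \<tau>: "\<tau> \<in> K" "x \<in> \<tau>" by blast
  show "x \<in> \<Union>(bisect K a b)"
  proof (cases "a \<in> verts \<tau> \<and> b \<in> verts \<tau>")
    case False
    then show ?thesis using \<tau> unfolding bisect_eq[OF assms] by blast
  next
    case True
    then obtain p where p: "p \<in> apexes K a b" "\<tau> = convex hull {a, b, p}"
      using triangle_apex[OF assms(1) \<tau>(1)] assms(2) by blast
    have o: "orient a b p \<noteq> 0" using apex_orient assms p by blast
    have "x \<in> convex hull {a, midpoint a b, p} \<or> x \<in> convex hull {b, midpoint a b, p}"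
      using \<tau>(2) unfolding p(2) half_triangle[OF o] half_triangle'[OF o] by auto
    then show ?thesis using p(1) unfolding bisect_eq[OF assms] by blast
  qed
qed

lemma half_triangle_in_bisect:
  assumes "mesh K" "a \<noteq> b" "c \<in> {a, b}" "p \<in> apexes K a b"
  shows "convex hull {c, midpoint a b, p} \<in> bisect K a b" "verts (convex hull {c, midpoint a b, p}) = {c, midpoint a b, p}"
  using assms bisect_eq[OF assms(1,2)] verts_triangle[OF orient_half[OF apex_orient[OF assms(1,4)] assms(3)]]
  by blast+

lemma midpoint_not_node:
  assumes "mesh K" "p \<in> apexes K a b"
  shows "midpoint a b \<notin> nodes K"
proof
  assume n: "midpoint a b \<in> nodes K"
  have o: "orient a b p \<noteq> 0" using apex_orient assms by blast
  have "midpoint a b \<in> convex hull {a, b}"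
    using midpoint_in_closed_segment[of a b] by (simp add: segment_convex_hull)
  then have "midpoint a b \<in> convex hull {a, b, p}" using hull_mono[of "{a, b}" "{a, b, p}"] by blast
  then have "midpoint a b \<in> {a, b, p}"
    using node_in_verts[OF assms(1) n, of "convex hull {a, b, p}"] apex_verts[OF assms] assms(2)
    by (auto simp: apexes_def)
  moreover have "midpoint a b \<noteq> a" "midpoint a b \<noteq> b" using orient_distinct[OF o] by auto
  moreover have "midpoint a b \<noteq> p" using o by (auto simp: orient_def midpoint_def field_simps)
  ultimately show False by blast
qed

lemma nodes_bisect:
  assumes "mesh K" "a \<noteq> b" "apexes K a b \<noteq> {}"
  shows "nodes (bisect K a b) = insert (midpoint a b) (nodes K)"
proof (intro subset_antisym subsetI)
  fix z assume "z \<in> nodes (bisect K a b)"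
  then obtain \<tau> where \<tau>: "\<tau> \<in> bisect K a b" "z \<in> verts \<tau>" by (auto simp: nodes_eq)
  show "z \<in> insert (midpoint a b) (nodes K)" using bisect_triangle_cases[OF assms(1,2) \<tau>(1)]
  proof cases
    case 1 then show ?thesis using \<tau> by (auto simp: nodes_eq)
  next
    case (2 c p)
    then show ?thesis using \<tau>(2) apex_nodes[OF assms(1) 2(2)] by auto
  qed
next
  fix z assume "z \<in> insert (midpoint a b) (nodes K)"
  then consider "z = midpoint a b" | \<tau> where "\<tau> \<in> K" "z \<in> verts \<tau>" by (auto simp: nodes_eq)
  then show "z \<in> nodes (bisect K a b)"
  proof cases
    case 1
    obtain p where "p \<in> apexes K a b" using assms(3) by blast
    then show ?thesis using half_triangle_in_bisect[OF assms(1,2), of a p] 1 by (auto simp: nodes_eq)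
  next
    case (2 \<tau>)
    show ?thesis
    proof (cases "a \<in> verts \<tau> \<and> b \<in> verts \<tau>")
      case False
      then have "\<tau> \<in> bisect K a b" using 2 bisect_eq[OF assms(1,2)] by blast
      then show ?thesis using 2 by (auto simp: nodes_eq)
    next
      case True
      then obtain p where p: "p \<in> apexes K a b" "\<tau> = convex hull {a, b, p}"
        using triangle_apex[OF assms(1) 2(1)] assms(2) by blast
      then have "z \<in> {a, b, p}" using 2 apex_verts[OF assms(1) p(1)] by blast
      then obtain c where "c \<in> {a, b}" "z \<in> {c, midpoint a b, p}" by blast
      then show ?thesis
        using half_triangle_in_bisect[OF assms(1,2), of c p] p(1) by (auto simp: nodes_eq)
    qed
  qed
qed

lemma apex_neq:
  assumes "mesh K" "p \<in> apexes K a b"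
  shows "p \<noteq> a" "p \<noteq> b" "a \<noteq> b" "p \<noteq> midpoint a b"
  using apex_orient[OF assms] orient_distinct midpoint_not_node[OF assms] apex_nodes[OF assms] by metis+

lemma edges_bisect_old:
  assumes "mesh K" "a \<noteq> b" "apexes K a b \<noteq> {}" "x \<in> nodes K" "y \<in> nodes K"
  shows "closed_segment x y \<in> edges (bisect K a b) \<longleftrightarrow> closed_segment x y \<in> edges K \<and> {x, y} \<noteq> {a, b}"
proof -
  let ?m = "midpoint a b"
  have m: "x \<noteq> ?m" "y \<noteq> ?m" using midpoint_not_node[OF assms(1)] assms by blast+
  note e = edge_iff_verts[OF mesh_bisect[OF assms(1,2)]] edge_iff_verts[OF assms(1)]
  show ?thesis
  proof
    assume "closed_segment x y \<in> edges (bisect K a b)"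
    then obtain \<tau> where \<tau>: "\<tau> \<in> bisect K a b" "x \<in> verts \<tau>" "y \<in> verts \<tau>" "x \<noteq> y"
      using e(1) by blast
    show "closed_segment x y \<in> edges K \<and> {x, y} \<noteq> {a, b}"
      using bisect_triangle_cases[OF assms(1,2) \<tau>(1)]
    proof cases
      case 1 then show ?thesis unfolding e(2) using \<tau> by (auto simp: doubleton_eq_iff)
    next
      case (2 c p)
      have "x \<in> {c, p}" "y \<in> {c, p}" using 2 \<tau> m by auto
      moreover have "{c, p} \<subseteq> verts (convex hull {a, b, p})"
        using apex_verts[OF assms(1) 2(2)] 2 by auto
      moreover have "convex hull {a, b, p} \<in> K" using 2 by (simp add: apexes_def)
      ultimately show ?thesis unfolding e(2) using \<tau>(4) apex_neq[OF assms(1) 2(2)]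
        by (auto simp: doubleton_eq_iff)
    qed
  next
    assume *: "closed_segment x y \<in> edges K \<and> {x, y} \<noteq> {a, b}"
    then obtain \<tau> where \<tau>: "\<tau> \<in> K" "x \<in> verts \<tau>" "y \<in> verts \<tau>" "x \<noteq> y"
      using e(2) by blast
    show "closed_segment x y \<in> edges (bisect K a b)"
    proof (cases "a \<in> verts \<tau> \<and> b \<in> verts \<tau>")
      case False
      then have "\<tau> \<in> bisect K a b" using \<tau> bisect_eq[OF assms(1,2)] by blast
      then show ?thesis unfolding e(1) using \<tau> by blast
    next
      case True
      then obtain p where p: "p \<in> apexes K a b" "\<tau> = convex hull {a, b, p}"
        using triangle_apex[OF assms(1) \<tau>(1)] assms(2) by blast
      then have "x \<in> {a, b, p}" "y \<in> {a, b, p}" using \<tau> apex_verts[OF assms(1) p(1)] by blast+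
      then obtain c where "c \<in> {a, b}" "x \<in> {c, p}" "y \<in> {c, p}" using * \<tau>(4) by blast
      then show ?thesis unfolding e(1)
        using half_triangle_in_bisect[OF assms(1,2), of c p] p(1) \<tau>(4) by blast
    qed
  qed
qed

lemma edges_bisect_midpoint:
  assumes "mesh K" "a \<noteq> b" "apexes K a b \<noteq> {}"
  shows "closed_segment x (midpoint a b) \<in> edges (bisect K a b) \<longleftrightarrow> x \<in> {a, b} \<union> apexes K a b"
proof -
  let ?m = "midpoint a b"
  note e = edge_iff_verts[OF mesh_bisect[OF assms(1,2)]]
  show ?thesis
  proof
    assume "closed_segment x ?m \<in> edges (bisect K a b)"
    then obtain \<tau> where \<tau>: "\<tau> \<in> bisect K a b" "x \<in> verts \<tau>" "?m \<in> verts \<tau>" "x \<noteq> ?m"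
      using e by blast
    show "x \<in> {a, b} \<union> apexes K a b" using bisect_triangle_cases[OF assms(1,2) \<tau>(1)]
    proof cases
      case 1
      then have "?m \<in> nodes K" using \<tau> by (auto simp: nodes_eq)
      then show ?thesis using midpoint_not_node[OF assms(1)] assms(3) by blast
    next
      case (2 c p)
      then show ?thesis using \<tau> by auto
    qed
  next
    assume x: "x \<in> {a, b} \<union> apexes K a b"
    obtain p0 where p0: "p0 \<in> apexes K a b" using assms(3) by blast
    obtain c p where cp: "c \<in> {a, b}" "p \<in> apexes K a b" "x \<in> {c, p}" using x p0 by blast
    have "x \<in> nodes K" using cp apex_nodes[OF assms(1) cp(2)] by auto
    then have "x \<noteq> ?m" using midpoint_not_node[OF assms(1) p0] by auto
    then show "closed_segment x ?m \<in> edges (bisect K a b)" unfolding e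
      using half_triangle_in_bisect[OF assms(1,2) cp(1,2)] cp(3) by blast
  qed
qed

lemma apexes_bisect_half:
  assumes "mesh K" "a \<noteq> b" "c \<in> {a, b}" "apexes K a b \<noteq> {}"
  shows "apexes (bisect K a b) c (midpoint a b) = apexes K a b"
proof (intro subset_antisym subsetI)
  fix z assume "z \<in> apexes K a b"
  then show "z \<in> apexes (bisect K a b) c (midpoint a b)"
    using half_triangle_in_bisect[OF assms(1-3)] by (auto simp: apexes_def)
next
  let ?m = "midpoint a b"
  fix z assume z: "z \<in> apexes (bisect K a b) c ?m"
  let ?\<tau> = "convex hull {c, ?m, z}"
  have \<tau>: "?\<tau> \<in> bisect K a b" using z by (simp add: apexes_def)
  have v: "verts ?\<tau> = {c, ?m, z}" using apex_verts[OF mesh_bisect[OF assms(1,2)] z] .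
  show "z \<in> apexes K a b" using bisect_triangle_cases[OF assms(1,2) \<tau>]
  proof cases
    case 1
    then have "?m \<in> nodes K" using v by (auto simp: nodes_eq)
    then show ?thesis using midpoint_not_node[OF assms(1)] assms(4) by blast
  next
    case (2 d p)
    then have "{c, ?m, z} = {d, ?m, p}" using v by simp
    moreover have "z \<noteq> c" "z \<noteq> ?m" "c \<noteq> ?m"
      using apex_neq[OF mesh_bisect[OF assms(1,2)] z] by auto
    moreover have "p \<notin> {a, b}" using apex_neq[OF assms(1) 2(2)] by blast
    ultimately have "z = p" using assms(3) 2(1) by blast
    then show ?thesis using 2(2) by simp
  qed
qed

text \<open>Only triangles containing the bisected edge change, so an edge that shares no triangle with it keeps
its opposite vertices and hence its angles.\<close>
lemma apexes_bisect_other: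
  assumes "mesh K" "a \<noteq> b" "apexes K a b \<noteq> {}" "x \<in> nodes K" "y \<in> nodes K"
    and sep: "\<And>\<tau>. \<tau> \<in> K \<Longrightarrow> \<not> {x, y, a, b} \<subseteq> verts \<tau>"
  shows "apexes (bisect K a b) x y = apexes K x y"
proof (intro subset_antisym subsetI)
  fix z assume z: "z \<in> apexes K x y"
  then have "\<not> {x, y, a, b} \<subseteq> {x, y, z}"
    using sep[of "convex hull {x, y, z}"] apex_verts[OF assms(1) z] by (simp add: apexes_def)
  then have "\<not> (a \<in> verts (convex hull {x, y, z}) \<and> b \<in> verts (convex hull {x, y, z}))"
    using apex_verts[OF assms(1) z] by auto
  then show "z \<in> apexes (bisect K a b) x y"
    using z unfolding apexes_def bisect_eq[OF assms(1,2)] by blast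
next
  let ?m = "midpoint a b"
  fix z assume z: "z \<in> apexes (bisect K a b) x y"
  let ?\<tau> = "convex hull {x, y, z}"
  have \<tau>: "?\<tau> \<in> bisect K a b" using z by (simp add: apexes_def)
  have v: "verts ?\<tau> = {x, y, z}" using apex_verts[OF mesh_bisect[OF assms(1,2)] z] .
  have m: "x \<noteq> ?m" "y \<noteq> ?m" using midpoint_not_node[OF assms(1)] assms by blast+
  show "z \<in> apexes K x y" using bisect_triangle_cases[OF assms(1,2) \<tau>]
  proof cases
    case 1 then show ?thesis by (simp add: apexes_def)
  next
    case (2 c p)
    then have "{x, y, z} = {c, ?m, p}" using v by simp
    then have "{x, y, a, b} \<subseteq> {a, b, p}" using m 2(1) by blast
    then show ?thesis using sep[of "convex hull {a, b, p}"] apex_verts[OF assms(1) 2(2)] 2(2)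
      by (simp add: apexes_def)
  qed
qed

section \<open>Finite element functions and the hat basis\<close>

definition affine_fun :: "(point \<Rightarrow> complex) \<Rightarrow> bool" where
  "affine_fun f \<longleftrightarrow> (\<exists>l c. linear l \<and> (\<forall>x. f x = l x + c))"

lemma affine_fun_combine:
  assumes "affine_fun f" "affine_fun g"
  shows "affine_fun (\<lambda>x. f x + \<alpha> * g x)"
proof -
  obtain l c l' c' where *: "linear l" "\<And>x. f x = l x + c" "linear l'" "\<And>x. g x = l' x + c'"
    using assms by (auto simp: affine_fun_def)
  have "linear (\<lambda>x. l x + \<alpha> * l' x)"
    using *(1,3) by (auto simp: linear_iff algebra_simps scaleR_conv_of_real)
  moreover have "\<forall>x. f x + \<alpha> * g x = (l x + \<alpha> * l' x) + (c + \<alpha> * c')" by (simp add: * algebra_simps)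
  ultimately show ?thesis unfolding affine_fun_def by blast
qed

lemma affine_fun_diff: "affine_fun f \<Longrightarrow> affine_fun g \<Longrightarrow> affine_fun (\<lambda>x. f x - g x)"
  using affine_fun_combine[of f g "-1"] by simp

lemma affine_fun_zero: "affine_fun (\<lambda>x. 0)"
  unfolding affine_fun_def by (intro exI[of _ "\<lambda>x. 0"] exI[of _ 0]) (simp add: linear_zero)

lemma affine_fun_bary: "affine_fun (\<lambda>x. complex_of_real (bary a b c x))"
  unfolding affine_fun_def
proof (intro exI conjI allI)
  let ?l = "\<lambda>x::point. complex_of_real (((b$1 - a$1) * x$2 - (b$2 - a$2) * x$1) / orient a b c)"
  let ?k = "complex_of_real ((- (b$1 - a$1) * a$2 + (b$2 - a$2) * a$1) / orient a b c)"
  have scale: "r *\<^sub>R complex_of_real y = complex_of_real (r * y)" for r y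
    by (simp add: scaleR_conv_of_real)
  show "linear ?l"
  proof (rule linearI)
    show "?l (x + y) = ?l x + ?l y" for x y
      unfolding of_real_add[symmetric] by (simp add: algebra_simps add_divide_distrib diff_divide_distrib)
    show "?l (r *\<^sub>R x) = r *\<^sub>R ?l x" for r x
      unfolding scale by (simp add: algebra_simps)
  qed
  show "complex_of_real (bary a b c x) = ?l x + ?k" for x
    unfolding of_real_add[symmetric] bary_def orient_def[of a b x]
    by (simp add: algebra_simps add_divide_distrib[symmetric] diff_divide_distrib[symmetric])
qed

lemma affine_fun_eq_on_hull:
  assumes "affine_fun f" "affine_fun g" "\<And>v. v \<in> V \<Longrightarrow> f v = g v" "x \<in> convex hull V"
  shows "f x = g x"
proof -
  obtain l c where *: "linear l" "\<And>x. f x - g x = l x + c"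
    using affine_fun_diff[OF assms(1,2)] by (auto simp: affine_fun_def)
  have "convex {x. l x + c = 0}"
  proof (rule convexI)
    fix x y and u v :: real
    assume a: "x \<in> {x. l x + c = 0}" "y \<in> {x. l x + c = 0}" and uv: "u + v = 1"
    have "l (u *\<^sub>R x + v *\<^sub>R y) + (u + v) *\<^sub>R c = u *\<^sub>R (l x + c) + v *\<^sub>R (l y + c)"
      using *(1) by (simp add: linear_add linear_scale algebra_simps)
    then show "u *\<^sub>R x + v *\<^sub>R y \<in> {x. l x + c = 0}" using a uv by simp
  qed
  moreover have "V \<subseteq> {x. l x + c = 0}" using assms(3) *(2) by (metis (mono_tags) diff_self mem_Collect_eq subsetI)
  ultimately have "convex hull V \<subseteq> {x. l x + c = 0}" by (intro hull_minimal)
  then have "f x - g x = 0" using assms(4) *(2) by auto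
  then show ?thesis by simp
qed

lemma affine_interpolation:
  assumes "2 simplex \<tau>"
  obtains f where "affine_fun f" "\<And>v. v \<in> verts \<tau> \<Longrightarrow> f v = (g :: point \<Rightarrow> complex) v"
proof -
  obtain a b c where abc: "orient a b c \<noteq> 0" "\<tau> = convex hull {a, b, c}"
    using assms by (auto simp: simplex_2_iff)
  let ?f = "\<lambda>x. ((0 + g a * of_real (bary b c a x)) + g b * of_real (bary c a b x)) + g c * of_real (bary a b c x)"
  have "affine_fun ?f" by (intro affine_fun_combine affine_fun_bary affine_fun_zero)
  moreover have "?f v = g v" if "v \<in> verts \<tau>" for v
    using that abc orient_perm_nonzero[OF abc(1)] by (auto simp: verts_triangle bary_apex)
  ultimately show ?thesis using that by blast
qed

text \<open>The gradient of \<open>bary a b c\<close>: the edge vector rotated by a right angle, divided by twice the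
signed area.\<close>
definition bary_grad :: "point \<Rightarrow> point \<Rightarrow> point \<Rightarrow> point" where
  "bary_grad a b c = (1 / orient a b c) *\<^sub>R vector [a$2 - b$2, b$1 - a$1]"

lemma bary_increment: "bary a b c y = bary a b c x + bary_grad a b c \<bullet> (y - x)"
proof -
  have "bary_grad a b c \<bullet> (y - x) = ((a$2 - b$2) * (y$1 - x$1) + (b$1 - a$1) * (y$2 - x$2)) / orient a b c"
    by (simp add: bary_grad_def inner_vec_def sum_2 vector_2 add_divide_distrib)
  then show ?thesis
    by (simp add: bary_def orient_def[of a b x] orient_def[of a b y] add_divide_distrib[symmetric] algebra_simps)
qed

lemma has_derivative_bary:
  "((\<lambda>x. complex_of_real (bary a b c x)) has_derivative (\<lambda>h. of_real (bary_grad a b c \<bullet> h))) (at x)"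
proof -
  have "(bary a b c has_derivative (\<lambda>h. bary_grad a b c \<bullet> h)) (at x)"
  proof -
    have "bary a b c = (\<lambda>y. bary a b c x + bary_grad a b c \<bullet> (y - x))"
      using bary_increment[of a b c _ x] by blast
    moreover have "((\<lambda>y. bary a b c x + bary_grad a b c \<bullet> (y - x)) has_derivative (\<lambda>h. bary_grad a b c \<bullet> h)) (at x)"
      by (auto intro!: derivative_eq_intros)
    ultimately show ?thesis by simp
  qed
  then show ?thesis by (rule has_derivative_of_real)
qed

text \<open>The gradient of a finite element function is constant in the interior of a triangle, so
it may be read off at any point there.\<close>
definition tri_grad :: "point set \<Rightarrow> (point \<Rightarrow> complex) \<Rightarrow> 2 \<Rightarrow> complex" where
  "tri_grad \<tau> u i = partial i u (SOME x. x \<in> interior \<tau>)"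

lemma triangle_interior_nonempty: "2 simplex \<tau> \<Longrightarrow> interior \<tau> \<noteq> {}" for \<tau> :: "point set"
proof -
  assume "2 simplex \<tau>"
  then obtain a b c where abc: "orient a b c \<noteq> 0" "\<tau> = convex hull {a, b, c}"
    by (auto simp: simplex_2_iff)
  let ?x = "(1/3) *\<^sub>R a + (1/3) *\<^sub>R b + (1/3) *\<^sub>R c"
  have "?x \<in> interior \<tau>"
    unfolding abc(2) interior_triangle_bary[OF abc(1)]
    using bary_of_combination[OF abc(1), of "1/3" "1/3" "1/3" ?x] by simp
  then show ?thesis by blast
qed

text \<open>A polygonal Lipschitz domain is the interior of its closure; stated in this form, the setting passes unchanged to every refinement of the mesh.\<close>
locale meshed_domain =
  fixes \<Omega> :: "point set" and K :: "point set set"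
  assumes open_domain: "open \<Omega>"
    and frontier_closure: "frontier (closure \<Omega>) = frontier \<Omega>"
    and mesh: "mesh K"
    and Union_mesh: "\<Union>K = closure \<Omega>"
begin

lemmas simplexK = mesh_simplex[OF mesh]

lemma domain_regular: "interior (closure \<Omega>) = \<Omega>"
proof -
  have "interior (closure \<Omega>) = closure \<Omega> - frontier (closure \<Omega>)"
    using interior_subset by (auto simp: frontier_def)
  also have "\<dots> = closure \<Omega> - frontier \<Omega>" by (simp add: frontier_closure)
  also have "\<dots> = \<Omega>" using open_domain closure_subset by (auto simp: frontier_def interior_open)
  finally show ?thesis .
qed

lemma frontier_mesh: "frontier (\<Union>K) = frontier \<Omega>"
  by (simp add: Union_mesh frontier_closure)

lemma compact_closure_domain: "compact (closure \<Omega>)"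
  using mesh_compact[OF mesh] Union_mesh by simp

lemma triangle_subset: "\<tau> \<in> K \<Longrightarrow> \<tau> \<subseteq> closure \<Omega>"
  using Union_mesh by blast

abbreviation S where "S \<equiv> fe_space \<Omega> K"

lemma fe_affine:
  assumes "u \<in> S" "\<tau> \<in> K"
  obtains f where "affine_fun f" "\<And>x. x \<in> \<tau> \<Longrightarrow> u x = f x"
proof -
  obtain l c where "linear l" "\<forall>x\<in>\<tau>. u x = l x + c" using assms unfolding fe_space_def by blast
  then show ?thesis using that[of "\<lambda>x. l x + c"] by (auto simp: affine_fun_def)
qed

lemma fe_continuous: "u \<in> S \<Longrightarrow> continuous_on (closure \<Omega>) u"
  by (simp add: fe_space_def)

lemma fe_outside: "u \<in> S \<Longrightarrow> x \<notin> closure \<Omega> \<Longrightarrow> u x = 0"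
  by (simp add: fe_space_def)

lemma feI:
  assumes "continuous_on (closure \<Omega>) u" "\<And>x. x \<notin> closure \<Omega> \<Longrightarrow> u x = 0"
    "\<And>\<tau>. \<tau> \<in> K \<Longrightarrow> \<exists>f. affine_fun f \<and> (\<forall>x\<in>\<tau>. u x = f x)"
  shows "u \<in> S"
  unfolding fe_space_def using assms by (fastforce simp: affine_fun_def)

lemma fe_combine:
  assumes "u \<in> S" "v \<in> S"
  shows "(\<lambda>x. u x + \<alpha> * v x) \<in> S"
proof (rule feI)
  show "continuous_on (closure \<Omega>) (\<lambda>x. u x + \<alpha> * v x)"
    using assms by (intro continuous_intros fe_continuous)
  show "\<exists>f. affine_fun f \<and> (\<forall>x\<in>\<tau>. u x + \<alpha> * v x = f x)" if \<tau>: "\<tau> \<in> K" for \<tau>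
  proof -
    obtain f where f: "affine_fun f" "\<And>x. x \<in> \<tau> \<Longrightarrow> u x = f x" using fe_affine[OF assms(1) \<tau>] by blast
    obtain g where g: "affine_fun g" "\<And>x. x \<in> \<tau> \<Longrightarrow> v x = g x" using fe_affine[OF assms(2) \<tau>] by blast
    show ?thesis
      using affine_fun_combine[OF f(1) g(1)] f(2) g(2) by (intro exI[of _ "\<lambda>x. f x + \<alpha> * g x"]) auto
  qed
  show "u x + \<alpha> * v x = 0" if "x \<notin> closure \<Omega>" for x
    using fe_outside[OF assms(1) that] fe_outside[OF assms(2) that] by simp
qed

lemma fe_zero: "(\<lambda>x. 0) \<in> S"
  by (rule feI) (auto intro!: exI[of _ "\<lambda>x. 0"] affine_fun_zero)

lemma fe_sum:
  assumes "finite N" "\<And>z. z \<in> N \<Longrightarrow> b z \<in> S"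
  shows "(\<lambda>x. \<Sum>z\<in>N. c z * b z x) \<in> S"
  using assms
proof (induction N)
  case empty then show ?case using fe_zero by simp
next
  case (insert z N)
  have "(\<lambda>x. (\<Sum>z\<in>N. c z * b z x) + c z * b z x) \<in> S"
    using insert by (intro fe_combine) auto
  then show ?case using insert by (simp add: add.commute)
qed

lemma fe_eq_on_triangle:
  assumes "u \<in> S" "v \<in> S" "\<tau> \<in> K" "\<And>z. z \<in> verts \<tau> \<Longrightarrow> u z = v z" "x \<in> \<tau>"
  shows "u x = v x"
proof -
  obtain f where f: "affine_fun f" "\<And>x. x \<in> \<tau> \<Longrightarrow> u x = f x" using fe_affine[OF assms(1,3)] by blast
  obtain g where g: "affine_fun g" "\<And>x. x \<in> \<tau> \<Longrightarrow> v x = g x" using fe_affine[OF assms(2,3)] by blast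
  have "f z = g z" if "z \<in> verts \<tau>" for z
    using that f(2) g(2) assms(4) verts_subset by (metis subsetD)
  then have "f x = g x"
    using affine_fun_eq_on_hull[OF f(1) g(1)] assms(5) simplex_hull_verts[OF simplexK[OF assms(3)]] by blast
  then show ?thesis using f(2) g(2) assms(5) by simp
qed

lemma fe_unique:
  assumes "u \<in> S" "v \<in> S" "\<And>z. z \<in> nodes K \<Longrightarrow> u z = v z"
  shows "u = v"
proof
  fix x
  show "u x = v x"
  proof (cases "x \<in> closure \<Omega>")
    case True
    then obtain \<tau> where "\<tau> \<in> K" "x \<in> \<tau>" using Union_mesh by blast
    then show ?thesis using fe_eq_on_triangle[OF assms(1,2)] assms(3) by (auto simp: nodes_eq)
  next
    case False then show ?thesis using fe_outside[OF assms(1)] fe_outside[OF assms(2)] by metis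
  qed
qed

text \<open>The affine interpolants of the single triangles fit together: two triangles meet in the hull of
their common vertices, and affine functions agreeing at these vertices agree on the hull.\<close>
lemma fe_interpolation:
  fixes g :: "point \<Rightarrow> complex"
  obtains u where "u \<in> S" "\<And>z. z \<in> nodes K \<Longrightarrow> u z = g z"
proof -
  have "\<forall>\<tau>\<in>K. \<exists>f. affine_fun f \<and> (\<forall>v\<in>verts \<tau>. f v = g v)"
    using affine_interpolation[OF simplexK] by metis
  then obtain A where A: "\<And>\<tau>. \<tau> \<in> K \<Longrightarrow> affine_fun (A \<tau>)" "\<And>\<tau> v. \<tau> \<in> K \<Longrightarrow> v \<in> verts \<tau> \<Longrightarrow> A \<tau> v = g v"
    by metis
  define u where "u x = (if x \<in> closure \<Omega> then A (SOME \<tau>. \<tau> \<in> K \<and> x \<in> \<tau>) x else 0)" for x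
  have uA: "u x = A \<tau> x" if "\<tau> \<in> K" "x \<in> \<tau>" for x \<tau>
  proof -
    define \<sigma> where "\<sigma> = (SOME \<tau>. \<tau> \<in> K \<and> x \<in> \<tau>)"
    have \<sigma>: "\<sigma> \<in> K" "x \<in> \<sigma>" using someI[of "\<lambda>\<tau>. \<tau> \<in> K \<and> x \<in> \<tau>" \<tau>] that by (auto simp: \<sigma>_def)
    have "u x = A \<sigma> x" using that triangle_subset by (auto simp: u_def \<sigma>_def)
    also have "\<dots> = A \<tau> x"
      using affine_fun_eq_on_hull[OF A(1)[OF \<sigma>(1)] A(1)[OF that(1)], of "verts \<sigma> \<inter> verts \<tau>" x]
        A(2)[OF \<sigma>(1)] A(2)[OF that(1)] mesh_Int[OF mesh \<sigma>(1) that(1) \<sigma>(2) that(2)] by auto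
    finally show ?thesis .
  qed
  have contA: "continuous_on T (A \<tau>)" if \<tau>: "\<tau> \<in> K" for \<tau> T
  proof -
    obtain l c where l: "linear l" "\<And>x. A \<tau> x = l x + c" using A(1)[OF \<tau>] by (auto simp: affine_fun_def)
    have "continuous_on T (\<lambda>x. l x + c)"
      using l(1) by (intro continuous_intros linear_continuous_on) (simp add: linear_conv_bounded_linear)
    moreover have "A \<tau> = (\<lambda>x. l x + c)" using l(2) by blast
    ultimately show ?thesis by simp
  qed
  have "u \<in> S"
  proof (rule feI)
    have "continuous_on (\<Union>\<tau>\<in>K. \<tau>) u"
    proof (rule continuous_on_closed_Union)
      show "finite K" by (rule mesh_finite[OF mesh])
      show "closed \<tau>" if "\<tau> \<in> K" for \<tau> using triangle_compact[OF simplexK[OF that]] compact_imp_closed by blast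
      show "continuous_on \<tau> u" if "\<tau> \<in> K" for \<tau>
        using uA[OF that] by (intro continuous_on_eq[OF contA[OF that]]) simp
    qed
    then show "continuous_on (closure \<Omega>) u" using Union_mesh by simp
    show "u x = 0" if "x \<notin> closure \<Omega>" for x using that by (simp add: u_def)
    show "\<exists>f. affine_fun f \<and> (\<forall>x\<in>\<tau>. u x = f x)" if "\<tau> \<in> K" for \<tau> using A(1) uA that by blast
  qed
  moreover have "u z = g z" if z: "z \<in> nodes K" for z
  proof -
    obtain \<tau> where \<tau>: "\<tau> \<in> K" "z \<in> verts \<tau>" using z by (auto simp: nodes_eq)
    then have "z \<in> \<tau>" using verts_subset by blast
    from uA[OF \<tau>(1) this] A(2)[OF \<tau>] show ?thesis by simp
  qed
  ultimately show ?thesis using that by blast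
qed

abbreviation \<phi> where "\<phi> \<equiv> hat \<Omega> K"

lemma hat_spec: "\<phi> z \<in> S \<and> (\<forall>y\<in>nodes K. \<phi> z y = (if y = z then 1 else 0))"
  unfolding hat_def
proof (rule theI'[where P = "\<lambda>b. b \<in> S \<and> (\<forall>y\<in>nodes K. b y = (if y = z then 1 else 0))"])
  obtain u where u: "u \<in> S" "\<And>y. y \<in> nodes K \<Longrightarrow> u y = (if y = z then 1 else 0)"
    using fe_interpolation[of "\<lambda>y. if y = z then 1 else 0"] by blast
  show "\<exists>!b. b \<in> S \<and> (\<forall>y\<in>nodes K. b y = (if y = z then 1 else 0))"
    using u fe_unique by (intro ex1I[of _ u]) auto
qed

lemma hat_fe: "\<phi> z \<in> S"
  using hat_spec by blast

lemma hat_node: "y \<in> nodes K \<Longrightarrow> \<phi> z y = (if y = z then 1 else 0)"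
  using hat_spec by blast

lemma fe_expansion:
  assumes "u \<in> S"
  shows "u = (\<lambda>x. \<Sum>z\<in>nodes K. u z * \<phi> z x)"
proof -
  have 1: "(\<lambda>x. \<Sum>z\<in>nodes K. u z * \<phi> z x) \<in> S"
    by (intro fe_sum finite_nodes[OF mesh] hat_fe)
  have 2: "u y = (\<Sum>z\<in>nodes K. u z * \<phi> z y)" if "y \<in> nodes K" for y
    using that finite_nodes[OF mesh] by (simp add: hat_node if_distrib sum.delta cong: if_cong)
  show ?thesis by (rule fe_unique[OF assms 1 2])
qed

lemma fe_on_triangle:
  assumes "u \<in> S" "convex hull {a, b, c} \<in> K" "x \<in> convex hull {a, b, c}"
  shows "u x = u a * of_real (bary b c a x) + u b * of_real (bary c a b x) + u c * of_real (bary a b c x)"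
proof -
  have o: "orient a b c \<noteq> 0" using triangle_hull_imp_orient simplexK assms by blast
  let ?f = "\<lambda>x. ((0 + u a * of_real (bary b c a x)) + u b * of_real (bary c a b x)) + u c * of_real (bary a b c x)"
  have f: "affine_fun ?f" by (intro affine_fun_combine affine_fun_bary affine_fun_zero)
  obtain g where g: "affine_fun g" "\<And>x. x \<in> convex hull {a, b, c} \<Longrightarrow> u x = g x"
    using fe_affine[OF assms(1,2)] by blast
  have "g v = ?f v" if "v \<in> {a, b, c}" for v
    using that g(2)[of v] o orient_perm_nonzero[OF o] by (auto simp: bary_apex hull_inc)
  then have "g x = ?f x" using affine_fun_eq_on_hull[OF g(1) f] assms(3) by blast
  then show ?thesis using g(2) assms(3) by simp
qed

lemma fe_partial:
  assumes "u \<in> S" "convex hull {a, b, c} \<in> K" "x \<in> interior (convex hull {a, b, c})"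
  shows "partial i u x = u a * of_real (bary_grad b c a $ i) + u b * of_real (bary_grad c a b $ i) + u c * of_real (bary_grad a b c $ i)"
proof -
  have "((\<lambda>x. u a * of_real (bary b c a x) + u b * of_real (bary c a b x) + u c * of_real (bary a b c x))
      has_derivative (\<lambda>h. u a * of_real (bary_grad b c a \<bullet> h) + u b * of_real (bary_grad c a b \<bullet> h) + u c * of_real (bary_grad a b c \<bullet> h))) (at x)"
    by (intro has_derivative_add has_derivative_mult_right has_derivative_bary)
  then have "(u has_derivative (\<lambda>h. u a * of_real (bary_grad b c a \<bullet> h) + u b * of_real (bary_grad c a b \<bullet> h) + u c * of_real (bary_grad a b c \<bullet> h))) (at x)"
    by (rule has_derivative_transform_within_open[OF _ open_interior assms(3)])
      (rule fe_on_triangle[OF assms(1,2), symmetric], erule subsetD[OF interior_subset])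
  then show ?thesis
    unfolding partial_def using frechet_derivative_at[symmetric] by (fastforce simp: inner_axis)
qed

lemma tri_grad_eq:
  assumes "u \<in> S" "convex hull {a, b, c} \<in> K"
  shows "tri_grad (convex hull {a, b, c}) u i =
    u a * of_real (bary_grad b c a $ i) + u b * of_real (bary_grad c a b $ i) + u c * of_real (bary_grad a b c $ i)"
  unfolding tri_grad_def
  using fe_partial[OF assms] someI_ex[of "\<lambda>x. x \<in> interior (convex hull {a, b, c})"]
    triangle_interior_nonempty[OF simplexK[OF assms(2)]] by blast

lemma partial_eq_tri_grad:
  assumes "u \<in> S" "\<tau> \<in> K" "x \<in> interior \<tau>"
  shows "partial i u x = tri_grad \<tau> u i"
proof -
  obtain a b c where "\<tau> = convex hull {a, b, c}" using simplexK[OF assms(2)] by (auto simp: simplex_2_iff)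
  then show ?thesis using fe_partial tri_grad_eq assms by metis
qed

lemma tri_grad_sum:
  assumes "finite N" "\<And>z. z \<in> N \<Longrightarrow> b z \<in> S" "\<tau> \<in> K"
  shows "tri_grad \<tau> (\<lambda>x. \<Sum>z\<in>N. c z * b z x) i = (\<Sum>z\<in>N. c z * tri_grad \<tau> (b z) i)"
proof -
  obtain p q r where t: "\<tau> = convex hull {p, q, r}" using simplexK[OF assms(3)] by (auto simp: simplex_2_iff)
  have "tri_grad \<tau> (b z) i = b z p * of_real (bary_grad q r p $ i) + b z q * of_real (bary_grad r p q $ i) + b z r * of_real (bary_grad p q r $ i)"
    if "z \<in> N" for z
    using tri_grad_eq[OF assms(2)[OF that]] t assms(3) by simp
  moreover have "tri_grad \<tau> (\<lambda>x. \<Sum>z\<in>N. c z * b z x) i = (\<Sum>z\<in>N. c z * b z p) * of_real (bary_grad q r p $ i)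
     + (\<Sum>z\<in>N. c z * b z q) * of_real (bary_grad r p q $ i) + (\<Sum>z\<in>N. c z * b z r) * of_real (bary_grad p q r $ i)"
    using tri_grad_eq[OF fe_sum[OF assms(1,2)]] t assms(3) by simp
  ultimately show ?thesis
    by (simp add: sum_distrib_left sum_distrib_right sum.distrib algebra_simps)
qed

end

section \<open>The Helmholtz form on finite element functions\<close>

abbreviation area :: "point set \<Rightarrow> real" where "area \<equiv> measure lborel"

text \<open>Lagrange's identity in the plane; it expresses the sine of an angle by the area.\<close>
lemma orient_square: "((a - p) \<bullet> (b - p))\<^sup>2 + (orient a b p)\<^sup>2 = (norm (a - p))\<^sup>2 * (norm (b - p))\<^sup>2"
  unfolding power2_norm_eq_inner
  by (simp add: inner_vec_def sum_2 orient_def power2_eq_square algebra_simps)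

lemma angle_at_facts:
  assumes "orient a b p \<noteq> 0"
  shows "0 < angle_at p a b" "angle_at p a b < pi"
    "cos (angle_at p a b) / sin (angle_at p a b) = ((a - p) \<bullet> (b - p)) / \<bar>orient a b p\<bar>"
proof -
  let ?\<alpha> = "angle_at p a b" and ?n = "norm (a - p) * norm (b - p)" and ?i = "(a - p) \<bullet> (b - p)"
  have n: "?n > 0" using orient_distinct[OF assms] by simp
  have D: "(orient a b p)\<^sup>2 = ?n\<^sup>2 - ?i\<^sup>2" using orient_square[of a p b] by (simp add: power_mult_distrib)
  have abs: "\<bar>?i / ?n\<bar> \<le> 1" using Cauchy_Schwarz_ineq2[of "a - p" "b - p"] n by (simp add: abs_mult)
  then have i: "- 1 \<le> ?i / ?n" "?i / ?n \<le> 1" by linarith+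
  have cos: "cos ?\<alpha> = ?i / ?n" unfolding angle_at_def using cos_arccos[OF i] .
  have "sin ?\<alpha> = sqrt (1 - (?i / ?n)\<^sup>2)" unfolding angle_at_def using sin_arccos[OF i] .
  also have "1 - (?i / ?n)\<^sup>2 = (\<bar>orient a b p\<bar> / ?n)\<^sup>2"
    using n D orient_distinct[OF assms]
    by (simp only: power_divide power2_abs) (simp add: diff_divide_distrib)
  also have "sqrt \<dots> = \<bar>orient a b p\<bar> / ?n" using n by (subst real_sqrt_abs) simp
  finally have sin: "sin ?\<alpha> = \<bar>orient a b p\<bar> / ?n" .
  have bounds: "0 \<le> ?\<alpha>" "?\<alpha> \<le> pi" unfolding angle_at_def using arccos_bounded[OF i] by auto
  have "sin ?\<alpha> > 0" using sin n assms by simp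
  then have "?\<alpha> \<noteq> 0" "?\<alpha> \<noteq> pi" by auto
  then show "0 < ?\<alpha>" "?\<alpha> < pi" using bounds by auto
  show "cos ?\<alpha> / sin ?\<alpha> = ?i / \<bar>orient a b p\<bar>" using n by (simp add: cos sin)
qed

lemma content_orient: "area (convex hull {a, b, p}) = \<bar>orient a b p\<bar> / 2"
  unfolding content_triangle orient_def by (simp add: abs_minus_commute algebra_simps)

text \<open>The classical cotangent formula: the gradients of two barycentric coordinates are the rotated opposite
edges, so their product is \<open>-(a - p) \<bullet> (b - p)\<close> divided by the square of twice the area.\<close>
lemma local_stiffness_cot:
  assumes "orient a b p \<noteq> 0"
  shows "area (convex hull {a, b, p}) * (bary_grad b p a \<bullet> bary_grad p a b)
    = - (cos (angle_at p a b) / sin (angle_at p a b)) / 2"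
proof -
  let ?D = "orient a b p"
  have o: "orient b p a = ?D" "orient p a b = ?D" by (simp_all add: orient_def algebra_simps)
  have "bary_grad b p a \<bullet> bary_grad p a b = - ((a - p) \<bullet> (b - p)) / (?D * ?D)"
    by (simp add: bary_grad_def o inner_vec_def sum_2 vector_2 add_divide_distrib diff_divide_distrib algebra_simps)
  then have "area (convex hull {a, b, p}) * (bary_grad b p a \<bullet> bary_grad p a b)
      = \<bar>?D\<bar> / 2 * (- ((a - p) \<bullet> (b - p)) / (\<bar>?D\<bar> * \<bar>?D\<bar>))"
    by (simp add: content_orient)
  also have "\<dots> = - (((a - p) \<bullet> (b - p)) / \<bar>?D\<bar>) / 2"
  proof -
    have "d / 2 * (- i / (d * d)) = - (i / d) / 2" if "d \<noteq> 0" for d i :: real using that by simp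
    then show ?thesis using assms by (metis abs_eq_0)
  qed
  finally show ?thesis using angle_at_facts(3)[OF assms] by simp
qed

lemma cot_sum_nonneg:
  fixes \<alpha> \<beta> :: real
  assumes "0 < \<alpha>" "\<alpha> < pi" "0 < \<beta>" "\<beta> < pi" "\<alpha> + \<beta> \<le> pi"
  shows "cos \<alpha> / sin \<alpha> + cos \<beta> / sin \<beta> \<ge> 0"
proof -
  have s: "sin \<alpha> > 0" "sin \<beta> > 0" using assms by (auto intro: sin_gt_zero)
  have "cos \<alpha> / sin \<alpha> + cos \<beta> / sin \<beta> = sin (\<alpha> + \<beta>) / (sin \<alpha> * sin \<beta>)"
    using s by (simp add: sin_add field_simps)
  moreover have "sin (\<alpha> + \<beta>) \<ge> 0" using assms by (intro sin_ge_zero) auto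
  ultimately show ?thesis using s by simp
qed

lemma set_integral_lincomb:
  fixes f :: "'a \<Rightarrow> 'b \<Rightarrow> complex"
  assumes "\<And>z. z \<in> N \<Longrightarrow> set_integrable M A (f z)"
  shows "(LINT x:A|M. (\<Sum>z\<in>N. c z * f z x)) = (\<Sum>z\<in>N. c z * (LINT x:A|M. f z x))"
proof -
  have "(LINT x:A|M. (\<Sum>z\<in>N. c z * f z x)) = (LINT x|M. (\<Sum>z\<in>N. c z * (indicator A x *\<^sub>R f z x)))"
    unfolding set_lebesgue_integral_def by (simp add: scaleR_sum_right)
  also have "\<dots> = (\<Sum>z\<in>N. LINT x|M. c z * (indicator A x *\<^sub>R f z x))"
    using assms by (intro Bochner_Integration.integral_sum integrable_mult_right) (simp add: set_integrable_def)
  also have "\<dots> = (\<Sum>z\<in>N. c z * (LINT x|M. indicator A x *\<^sub>R f z x))"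
    by (simp only: integral_mult_right_zero)
  finally show ?thesis by (simp only: set_lebesgue_integral_def)
qed

lemma set_integral_cnj: "(LINT x:A|M. cnj (f x)) = cnj (LINT x:A|M. f x)"
  unfolding set_lebesgue_integral_def by (subst Bochner_Integration.integral_cnj[symmetric]) simp

lemma triangle_integral_constant:
  fixes f :: "point \<Rightarrow> complex"
  assumes "2 simplex \<tau>" "\<And>x. x \<in> interior \<tau> \<Longrightarrow> f x = c"
  shows "set_integrable lebesgue \<tau> f" "(LINT x:\<tau>|lebesgue. f x) = of_real (area \<tau>) * c"
proof -
  have comp: "compact \<tau>" using triangle_compact[OF assms(1)] .
  have lm: "\<tau> \<in> lmeasurable" using lmeasurable_compact[OF comp] .
  have neg: "negligible (frontier \<tau>)" using negligible_convex_frontier[OF triangle_convex[OF assms(1)]] .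
  have eq: "f x = c" if "x \<in> \<tau> - frontier \<tau>" for x
    using that assms(2) closure_subset by (auto simp: frontier_def)
  have ci: "set_integrable lebesgue \<tau> (\<lambda>x. c)" using lm by simp
  show fi: "set_integrable lebesgue \<tau> f"
    by (rule absolutely_integrable_spike[OF ci neg eq])
  have "(LINT x:\<tau>|lebesgue. f x) = integral \<tau> f" by (rule set_lebesgue_integral_eq_integral(2)[OF fi])
  also have "\<dots> = integral \<tau> (\<lambda>x. c)" by (rule integral_spike[OF neg]) (simp add: eq)
  also have "\<dots> = (LINT x:\<tau>|lebesgue. c)" by (rule set_lebesgue_integral_eq_integral(2)[OF ci, symmetric])
  also have "\<dots> = measure lebesgue \<tau> *\<^sub>R c"
    using lm unfolding set_lebesgue_integral_def
    by (subst integral_scaleR_left) (auto simp: lmeasurable_iff_integrable)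
  also have "measure lebesgue \<tau> = area \<tau>"
    using comp by (intro measure_completion) (simp add: borel_compact)
  finally show "(LINT x:\<tau>|lebesgue. f x) = of_real (area \<tau>) * c" by (simp add: scaleR_conv_of_real)
qed

lemma set_integrable_continuous_compact:
  fixes f :: "point \<Rightarrow> complex"
  assumes "compact T" "continuous_on T f"
  shows "set_integrable lebesgue T f"
proof -
  have "integrable lborel (\<lambda>x. indicator T x *\<^sub>R f x)" using borel_integrable_compact[OF assms] .
  then show ?thesis
    unfolding set_integrable_def using integrable_completion borel_measurable_integrable by blast
qed

text \<open>The intersection lies in the hull of at most two vertices of \<open>\<sigma>\<close>, on which some barycentric coordinate is
zero; hence it has no interior point.\<close>
lemma distinct_triangles_negligible_Int:
  assumes "mesh K" "\<sigma> \<in> K" "\<tau> \<in> K" "\<sigma> \<noteq> \<tau>"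
  shows "negligible (\<sigma> \<inter> \<tau>)"
proof -
  have s: "2 simplex \<sigma>" "2 simplex \<tau>" using assms mesh_simplex by blast+
  have card: "card (verts \<rho>) = 3" if "2 simplex \<rho>" for \<rho>
    using that orient_distinct by (auto simp: simplex_2_iff verts_triangle card_3_iff) metis
  have "\<not> verts \<sigma> \<subseteq> verts \<tau>"
  proof
    assume "verts \<sigma> \<subseteq> verts \<tau>"
    then have "verts \<sigma> = verts \<tau>" using card[OF s(1)] card[OF s(2)] finite_verts[OF s(2)]
      by (intro card_subset_eq) auto
    then show False using simplex_hull_verts[OF s(1)] simplex_hull_verts[OF s(2)] assms(4) by metis
  qed
  then obtain a where a: "a \<in> verts \<sigma>" "a \<notin> verts \<tau>" by blast
  obtain b c where bc: "orient a b c \<noteq> 0" "\<sigma> = convex hull {a, b, c}" using triangle_vertsE[OF s(1) a(1)] .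
  have v: "verts \<sigma> = {a, b, c}" using verts_triangle bc by blast
  have "interior (\<sigma> \<inter> \<tau>) = {}"
  proof (rule equals0I)
    fix x assume x: "x \<in> interior (\<sigma> \<inter> \<tau>)"
    then have "bary b c a x > 0"
      using interior_triangle_bary[OF bc(1)] bc(2) interior_mono[of "\<sigma> \<inter> \<tau>" \<sigma>] by blast
    moreover have "x \<in> \<sigma>" "x \<in> \<tau>" using x interior_subset by blast+
    then have "x \<in> convex hull (verts \<sigma> \<inter> verts \<tau>)" using mesh_Int[OF assms(1-3)] by blast
    then have "bary b c a x = 0" using hull_missing_vertex[of "verts \<sigma> \<inter> verts \<tau>" a b c x] v a by blast
    ultimately show False by simp
  qed
  then show ?thesis
    using negligible_convex_interior[of "\<sigma> \<inter> \<tau>"] convex_Int triangle_convex s by blast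
qed

context meshed_domain
begin

lemma interior_triangle_subset: "\<tau> \<in> K \<Longrightarrow> interior \<tau> \<subseteq> \<Omega>"
  using interior_mono[OF triangle_subset] domain_regular by blast

lemma negligible_boundary: "negligible (closure \<Omega> - \<Omega>)"
proof -
  have "negligible (\<Union>(frontier ` K))"
    using mesh_finite[OF mesh] negligible_convex_frontier triangle_convex simplexK
    by (intro negligible_Union) auto
  moreover have "closure \<Omega> - \<Omega> \<subseteq> \<Union>(frontier ` K)"
  proof
    fix x assume x: "x \<in> closure \<Omega> - \<Omega>"
    then obtain \<tau> where \<tau>: "\<tau> \<in> K" "x \<in> \<tau>" using Union_mesh by blast
    then have "x \<in> frontier \<tau>"
      using x interior_triangle_subset[OF \<tau>(1)] closure_subset[of \<tau>] by (auto simp: frontier_def)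
    then show "x \<in> \<Union>(frontier ` K)" using \<tau>(1) by blast
  qed
  ultimately show ?thesis using negligible_subset by blast
qed

lemma integral_over_mesh:
  fixes f :: "point \<Rightarrow> complex"
  assumes "\<And>\<tau>. \<tau> \<in> K \<Longrightarrow> set_integrable lebesgue \<tau> f"
  shows "(LINT x:\<Omega>|lebesgue. f x) = (\<Sum>\<tau>\<in>K. LINT x:\<tau>|lebesgue. f x)"
proof -
  have "set_integrable lebesgue (\<Union>\<tau>\<in>K. \<tau>) f"
    using assms mesh_finite[OF mesh] triangle_compact[OF simplexK]
    by (intro set_integrable_UN) (auto intro: lmeasurable_compact fmeasurableD)
  then have c: "set_integrable lebesgue (closure \<Omega>) f" using Union_mesh by simp
  have o: "set_integrable lebesgue \<Omega> f"
    by (rule set_integrable_subset[OF c _ closure_subset]) (simp add: open_domain borel_open)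
  have "(LINT x:\<Omega>|lebesgue. f x) = integral \<Omega> f" by (rule set_lebesgue_integral_eq_integral(2)[OF o])
  also have "\<dots> = integral (closure \<Omega>) f"
    by (rule integral_subset_negligible[OF closure_subset negligible_boundary])
  also have "\<dots> = (\<Sum>\<tau>\<in>K. LINT x:\<tau>|lebesgue. f x)"
  proof (rule integral_unique)
    have "(f has_integral (\<Sum>\<tau>\<in>K. LINT x:\<tau>|lebesgue. f x)) (\<Union>K)"
    proof (rule has_integral_Union)
      show "finite K" by (rule mesh_finite[OF mesh])
      show "(f has_integral (LINT x:\<tau>|lebesgue. f x)) \<tau>" if "\<tau> \<in> K" for \<tau>
        using has_integral_set_lebesgue[OF assms[OF that]] .
      show "pairwise (\<lambda>\<sigma> \<tau>. negligible (\<sigma> \<inter> \<tau>)) K"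
        using distinct_triangles_negligible_Int[OF mesh] by (auto simp: pairwise_def)
    qed
    then show "(f has_integral (\<Sum>\<tau>\<in>K. LINT x:\<tau>|lebesgue. f x)) (closure \<Omega>)" using Union_mesh by simp
  qed
  finally show ?thesis .
qed

text \<open>This turns the gradient part into a finite sum that is visibly sesquilinear; the edges of the triangles, where the
derivative need not exist, form a null set.\<close>
lemma grad_prod_eq:
  assumes "u \<in> S" "v \<in> S"
  shows "grad_prod \<Omega> u v =
    (\<Sum>\<tau>\<in>K. of_real (area \<tau>) * (\<Sum>i\<in>UNIV. tri_grad \<tau> u i * cnj (tri_grad \<tau> v i)))"
proof -
  have eq: "(\<Sum>i\<in>UNIV. partial i u x * cnj (partial i v x)) = (\<Sum>i\<in>UNIV. tri_grad \<tau> u i * cnj (tri_grad \<tau> v i))"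
    if "\<tau> \<in> K" "x \<in> interior \<tau>" for x \<tau>
    using partial_eq_tri_grad[OF _ that] assms by simp
  show ?thesis
    unfolding grad_prod_def
    using triangle_integral_constant[OF simplexK eq] by (subst integral_over_mesh) auto
qed

lemma l2_integrable:
  assumes "u \<in> S" "v \<in> S"
  shows "set_integrable lebesgue \<Omega> (\<lambda>x. u x * cnj (v x))"
proof (rule set_integrable_subset[OF _ _ closure_subset])
  show "set_integrable lebesgue (closure \<Omega>) (\<lambda>x. u x * cnj (v x))"
    using assms by (intro set_integrable_continuous_compact compact_closure_domain continuous_intros fe_continuous)
qed (simp add: open_domain borel_open)

abbreviation bd_pairs where
  "bd_pairs \<equiv> {(a, b). a \<in> nodes K \<and> b \<in> nodes K \<and> closed_segment a b \<in> boundary_edges \<Omega> K}"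

lemma finite_bd_pairs: "finite bd_pairs"
  by (rule finite_subset[of _ "nodes K \<times> nodes K"]) (auto simp: finite_nodes[OF mesh])

lemma segment_point:
  fixes a b :: point
  assumes "t \<in> {0..1}"
  shows "a + t *\<^sub>R (b - a) \<in> closed_segment a b"
  unfolding in_segment using assms by (intro exI[of _ t]) (auto simp: algebra_simps)

lemma bd_pairs_frontier: "(a, b) \<in> bd_pairs \<Longrightarrow> closed_segment a b \<subseteq> frontier \<Omega>"
  by (auto simp: boundary_edges_def)

lemma boundary_continuous:
  assumes "(a, b) \<in> bd_pairs" "u \<in> S"
  shows "continuous_on {0..1} (\<lambda>t. u (a + t *\<^sub>R (b - a)))"
proof (rule continuous_on_compose2[OF fe_continuous[OF assms(2)]])
  show "continuous_on {0..1} (\<lambda>t. a + t *\<^sub>R (b - a))" by (intro continuous_intros)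
  show "(\<lambda>t. a + t *\<^sub>R (b - a)) ` {0..1} \<subseteq> closure \<Omega>"
    using segment_point bd_pairs_frontier[OF assms(1)] by (fastforce simp: frontier_def)
qed

lemma boundary_integrable:
  assumes "(a, b) \<in> bd_pairs" "u \<in> S" "v \<in> S"
  shows "set_integrable lebesgue {0..1} (\<lambda>t. u (a + t *\<^sub>R (b - a)) * cnj (v (a + t *\<^sub>R (b - a))))"
  using boundary_continuous[OF assms(1)] assms(2,3)
  by (intro absolutely_integrable_continuous_real continuous_intros) auto

abbreviation bdry where "bdry u v \<equiv> boundary_integral \<Omega> K (\<lambda>x. u x * cnj (v x))"

lemma grad_prod_cnj:
  assumes "u \<in> S" "v \<in> S"
  shows "grad_prod \<Omega> v u = cnj (grad_prod \<Omega> u v)"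
  using assms by (simp add: grad_prod_eq mult.commute)

lemma l2_prod_cnj: "l2_prod \<Omega> v u = cnj (l2_prod \<Omega> u v)"
  unfolding l2_prod_def set_integral_cnj[symmetric] by (simp add: mult.commute)

lemma bdry_cnj: "bdry v u = cnj (bdry u v)"
proof -
  have "segment_integral a b (\<lambda>x. v x * cnj (u x)) = cnj (segment_integral a b (\<lambda>x. u x * cnj (v x)))" for a b
    unfolding segment_integral_def complex_cnj_mult set_integral_cnj[symmetric] by (simp add: mult.commute)
  then show ?thesis unfolding boundary_integral_def by (simp add: case_prod_beta)
qed

lemma grad_prod_sum:
  assumes "finite N" "\<And>z. z \<in> N \<Longrightarrow> b z \<in> S" "v \<in> S"
  shows "grad_prod \<Omega> (\<lambda>x. \<Sum>z\<in>N. c z * b z x) v = (\<Sum>z\<in>N. c z * grad_prod \<Omega> (b z) v)"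
proof -
  have "grad_prod \<Omega> (\<lambda>x. \<Sum>z\<in>N. c z * b z x) v =
     (\<Sum>\<tau>\<in>K. of_real (area \<tau>) * (\<Sum>i\<in>UNIV. (\<Sum>z\<in>N. c z * tri_grad \<tau> (b z) i) * cnj (tri_grad \<tau> v i)))"
    using assms by (simp add: grad_prod_eq fe_sum tri_grad_sum)
  also have "\<dots> = (\<Sum>\<tau>\<in>K. \<Sum>z\<in>N. c z * (of_real (area \<tau>) * (\<Sum>i\<in>UNIV. tri_grad \<tau> (b z) i * cnj (tri_grad \<tau> v i))))"
    by (simp add: sum_2 sum_distrib_left sum_distrib_right sum.distrib algebra_simps)
  also have "\<dots> = (\<Sum>z\<in>N. c z * (\<Sum>\<tau>\<in>K. of_real (area \<tau>) * (\<Sum>i\<in>UNIV. tri_grad \<tau> (b z) i * cnj (tri_grad \<tau> v i))))"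
    by (subst sum.swap) (simp add: sum_distrib_left)
  also have "\<dots> = (\<Sum>z\<in>N. c z * grad_prod \<Omega> (b z) v)"
    using assms by (intro sum.cong) (auto simp: grad_prod_eq)
  finally show ?thesis .
qed

lemma l2_prod_sum:
  assumes "\<And>z. z \<in> N \<Longrightarrow> b z \<in> S" "v \<in> S"
  shows "l2_prod \<Omega> (\<lambda>x. \<Sum>z\<in>N. c z * b z x) v = (\<Sum>z\<in>N. c z * l2_prod \<Omega> (b z) v)"
  unfolding l2_prod_def
  using set_integral_lincomb[of N lebesgue \<Omega> "\<lambda>z x. b z x * cnj (v x)" c] l2_integrable assms
  by (simp add: sum_distrib_right mult.assoc)

lemma bdry_sum:
  assumes "\<And>z. z \<in> N \<Longrightarrow> b z \<in> S" "v \<in> S"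
  shows "bdry (\<lambda>x. \<Sum>z\<in>N. c z * b z x) v = (\<Sum>z\<in>N. c z * bdry (b z) v)"
proof -
  have seg: "segment_integral p q (\<lambda>x. (\<Sum>z\<in>N. c z * b z x) * cnj (v x)) =
      (\<Sum>z\<in>N. c z * segment_integral p q (\<lambda>x. b z x * cnj (v x)))" if "(p, q) \<in> bd_pairs" for p q
    unfolding segment_integral_def
    using set_integral_lincomb[of N lebesgue "{0..1}" "\<lambda>z t. b z (p + t *\<^sub>R (q - p)) * cnj (v (p + t *\<^sub>R (q - p)))" c]
      boundary_integrable[OF that] assms
    by (simp add: sum_distrib_right sum_distrib_left mult.assoc mult.left_commute)
  have "bdry (\<lambda>x. \<Sum>z\<in>N. c z * b z x) v =
      (1/2) * (\<Sum>e\<in>bd_pairs. \<Sum>z\<in>N. c z * segment_integral (fst e) (snd e) (\<lambda>x. b z x * cnj (v x)))"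
    unfolding boundary_integral_def case_prod_beta
    by (intro arg_cong2[of _ _ _ _ "(*)"] refl sum.cong seg) auto
  also have "\<dots> = (\<Sum>z\<in>N. c z * bdry (b z) v)"
    unfolding boundary_integral_def case_prod_beta
    by (subst sum.swap) (simp add: sum_distrib_left mult.left_commute)
  finally show ?thesis .
qed

abbreviation B where "B \<equiv> helmholtz_form \<Omega> K"

lemma form_sum_left:
  assumes "finite N" "\<And>z. z \<in> N \<Longrightarrow> b z \<in> S" "v \<in> S"
  shows "B k (\<lambda>x. \<Sum>z\<in>N. c z * b z x) v = (\<Sum>z\<in>N. c z * B k (b z) v)"
proof -
  let ?u = "\<lambda>x. \<Sum>z\<in>N. c z * b z x"
  have g: "grad_prod \<Omega> ?u v = (\<Sum>z\<in>N. c z * grad_prod \<Omega> (b z) v)"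
    using grad_prod_sum[of N b v c] assms by blast
  have l: "l2_prod \<Omega> ?u v = (\<Sum>z\<in>N. c z * l2_prod \<Omega> (b z) v)"
    using l2_prod_sum[of N b v c] assms by blast
  have b: "bdry ?u v = (\<Sum>z\<in>N. c z * bdry (b z) v)"
    using bdry_sum[of N b v c] assms by blast
  show ?thesis
    unfolding helmholtz_form_def g l b
    by (simp add: sum_distrib_left sum_subtractf sum.distrib algebra_simps)
qed

lemma form_sum_right:
  assumes "finite N" "\<And>z. z \<in> N \<Longrightarrow> b z \<in> S" "u \<in> S"
  shows "B k u (\<lambda>x. \<Sum>z\<in>N. c z * b z x) = (\<Sum>z\<in>N. cnj (c z) * B k u (b z))"
proof -
  let ?v = "\<lambda>x. \<Sum>z\<in>N. c z * b z x"
  have g: "grad_prod \<Omega> u ?v = (\<Sum>z\<in>N. cnj (c z) * grad_prod \<Omega> u (b z))"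
    using grad_prod_cnj[OF fe_sum[OF assms(1,2)] assms(3)] grad_prod_sum[of N b u c, OF assms] grad_prod_cnj[OF assms(2) assms(3)]
    by simp
  have l: "l2_prod \<Omega> u ?v = (\<Sum>z\<in>N. cnj (c z) * l2_prod \<Omega> u (b z))"
    unfolding l2_prod_cnj[of u] using l2_prod_sum[of N b u c, OF assms(2,3)] by simp
  have b: "bdry u ?v = (\<Sum>z\<in>N. cnj (c z) * bdry u (b z))"
    unfolding bdry_cnj[of u] using bdry_sum[of N b u c, OF assms(2,3)] by simp
  show ?thesis
    unfolding helmholtz_form_def g l b
    by (simp add: sum_distrib_left sum_subtractf sum.distrib algebra_simps)
qed

end

section \<open>Propagation of zeros along a transmission order\<close>

text \<open>The trace left by MOTZ: \<open>r\<close> is the time at which a node enters the test set, and \<open>par z\<close> is the node of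
transmission degree one through which \<open>z\<close> entered. At that time all other neighbours of \<open>par z\<close> are
already in the test set, i.e. have smaller rank.\<close>
definition transmission_order :: "point set set \<Rightarrow> point set \<Rightarrow> (point \<Rightarrow> nat) \<Rightarrow> (point \<Rightarrow> point) \<Rightarrow> bool" where
  "transmission_order K \<Gamma> r par \<longleftrightarrow> (\<forall>z\<in>nodes K - \<Gamma>.
     par z \<in> nodes K \<and> closed_segment z (par z) \<in> edges K \<and> r (par z) < r z \<and>
     (\<forall>y\<in>nodes K. closed_segment y (par z) \<in> edges K \<longrightarrow> y \<noteq> z \<longrightarrow> r y < r z))"

context meshed_domain
begin

lemma fe_vanishes_on_triangle:
  assumes "u \<in> S" "\<tau> \<in> K" "\<And>v. v \<in> verts \<tau> \<Longrightarrow> u v = 0" "x \<in> \<tau>"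
  shows "u x = 0"
  using fe_eq_on_triangle[OF assms(1) fe_zero assms(2) _ assms(4)] assms(3) by blast

lemma tri_grad_vanishes:
  assumes "u \<in> S" "\<tau> \<in> K" "\<And>v. v \<in> verts \<tau> \<Longrightarrow> u v = 0"
  shows "tri_grad \<tau> u i = 0"
proof -
  obtain a b c where t: "orient a b c \<noteq> 0" "\<tau> = convex hull {a, b, c}"
    using simplexK[OF assms(2)] by (auto simp: simplex_2_iff)
  then show ?thesis using tri_grad_eq[OF assms(1), of a b c i] assms(2,3) verts_triangle[OF t(1)] by simp
qed

lemma hat_off_triangle:
  assumes "\<tau> \<in> K" "z \<notin> verts \<tau>" "v \<in> verts \<tau>"
  shows "\<phi> z v = 0"
  using assms hat_node[of v z] by (cases "v = z") (auto simp: nodes_eq)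

lemma fe_vanishes_on_edge:
  assumes "u \<in> S" "closed_segment a b \<in> edges K" "u a = 0" "u b = 0" "x \<in> closed_segment a b"
  shows "u x = 0"
proof -
  obtain \<tau> where \<tau>: "\<tau> \<in> K" "a \<in> verts \<tau>" "b \<in> verts \<tau>"
    using edge_iff_verts[OF mesh] assms(2) by blast
  have sub: "convex hull {a, b} \<subseteq> \<tau>"
    using hull_mono[of "{a, b}" "verts \<tau>"] \<tau> simplex_hull_verts[OF simplexK[OF \<tau>(1)]] by blast
  have x: "x \<in> convex hull {a, b}" using assms(5) by (simp add: segment_convex_hull)
  obtain f where f: "affine_fun f" "\<And>x. x \<in> \<tau> \<Longrightarrow> u x = f x" using fe_affine[OF assms(1) \<tau>(1)] by blast
  have "a \<in> \<tau>" "b \<in> \<tau>" using \<tau> verts_subset by blast+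
  then have "f v = 0" if "v \<in> {a, b}" for v using that f(2) assms(3,4) by (metis insertE singletonD)
  then have "f x = 0" using affine_fun_eq_on_hull[OF f(1) affine_fun_zero _ x] by blast
  then show ?thesis using f(2) x sub by auto
qed

lemma bdry_vanishes:
  assumes "\<And>a b x. (a, b) \<in> bd_pairs \<Longrightarrow> x \<in> closed_segment a b \<Longrightarrow> u x * cnj (v x) = 0"
  shows "bdry u v = 0"
proof -
  have "segment_integral a b (\<lambda>x. u x * cnj (v x)) = 0" if "(a, b) \<in> bd_pairs" for a b
  proof -
    have "(LINT t:{0..1}|lebesgue. u (a + t *\<^sub>R (b - a)) * cnj (v (a + t *\<^sub>R (b - a)))) = (LINT t:{0..1::real}|lebesgue. 0)"
      by (rule set_lebesgue_integral_cong) (use assms[OF that] segment_point in \<open>auto\<close>)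
    then show ?thesis unfolding segment_integral_def by (simp add: set_lebesgue_integral_def)
  qed
  then show ?thesis unfolding boundary_integral_def by (simp add: case_prod_beta)
qed

text \<open>In every triangle at least one of the two hat functions vanishes identically.\<close>
lemma form_local:
  assumes "y \<noteq> z" "closed_segment y z \<notin> edges K"
  shows "B k (\<phi> y) (\<phi> z) = 0"
proof -
  have sep: "y \<notin> verts \<tau> \<or> z \<notin> verts \<tau>" if "\<tau> \<in> K" for \<tau>
    using edge_iff_verts[OF mesh] assms that by blast
  have "grad_prod \<Omega> (\<phi> y) (\<phi> z) = 0"
  proof -
    have "tri_grad \<tau> (\<phi> y) i * cnj (tri_grad \<tau> (\<phi> z) i) = 0" if \<tau>: "\<tau> \<in> K" for \<tau> i
    proof -
      have "tri_grad \<tau> (\<phi> w) i = 0" if "w \<notin> verts \<tau>" for w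
        by (rule tri_grad_vanishes[OF hat_fe \<tau>]) (rule hat_off_triangle[OF \<tau> that])
      then show ?thesis using sep[OF \<tau>] by auto
    qed
    then have "(\<Sum>i\<in>UNIV. tri_grad \<tau> (\<phi> y) i * cnj (tri_grad \<tau> (\<phi> z) i)) = 0" if "\<tau> \<in> K" for \<tau>
      using that by (intro sum.neutral ballI)
    then show ?thesis
      unfolding grad_prod_eq[OF hat_fe hat_fe] by (intro sum.neutral ballI) (simp only: mult_zero_right)
  qed
  moreover have prod0: "\<phi> y x * cnj (\<phi> z x) = 0" if x: "x \<in> closure \<Omega>" for x
  proof -
    obtain \<tau> where \<tau>: "\<tau> \<in> K" "x \<in> \<tau>" using x Union_mesh by blast
    have "\<phi> w x = 0" if "w \<notin> verts \<tau>" for w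
      by (rule fe_vanishes_on_triangle[OF hat_fe \<tau>(1) _ \<tau>(2)]) (rule hat_off_triangle[OF \<tau>(1) that])
    then show ?thesis using sep[OF \<tau>(1)] by auto
  qed
  moreover have "l2_prod \<Omega> (\<phi> y) (\<phi> z) = 0"
  proof -
    have "l2_prod \<Omega> (\<phi> y) (\<phi> z) = (LINT x:\<Omega>|lebesgue. 0)"
      unfolding l2_prod_def using prod0 closure_subset
      by (intro set_lebesgue_integral_cong) (auto simp: open_domain borel_open)
    then show ?thesis by (simp add: set_lebesgue_integral_def)
  qed
  moreover have "bdry (\<phi> y) (\<phi> z) = 0"
  proof (rule bdry_vanishes)
    fix a b x assume "(a, b) \<in> bd_pairs" "x \<in> closed_segment a b"
    then have "x \<in> closure \<Omega>" using bd_pairs_frontier by (auto simp: frontier_def)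
    then show "\<phi> y x * cnj (\<phi> z x) = 0" by (rule prod0)
  qed
  ultimately show ?thesis by (simp add: helmholtz_form_def)
qed

lemma hat_on_own_triangle:
  assumes "convex hull {a, b, c} \<in> K" "x \<in> convex hull {a, b, c}"
  shows "\<phi> a x = of_real (bary b c a x)"
proof -
  have o: "orient a b c \<noteq> 0" using triangle_hull_imp_orient simplexK assms by blast
  have "a \<in> nodes K" "b \<in> nodes K" "c \<in> nodes K" using assms(1) verts_triangle[OF o] by (auto simp: nodes_eq)
  then show ?thesis
    using fe_on_triangle[OF hat_fe assms] hat_node orient_distinct[OF o] by simp
qed

lemma hat_nonneg:
  assumes "x \<in> closure \<Omega>"
  obtains r where "0 \<le> r" "\<phi> z x = complex_of_real r"
proof -
  obtain \<tau> where \<tau>: "\<tau> \<in> K" "x \<in> \<tau>" using assms Union_mesh by blast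
  show ?thesis
  proof (cases "z \<in> verts \<tau>")
    case True
    then obtain b c where bc: "orient z b c \<noteq> 0" "\<tau> = convex hull {z, b, c}"
      using triangle_vertsE[OF simplexK[OF \<tau>(1)]] by metis
    then show ?thesis
      using that[of "bary b c z x"] hat_on_own_triangle \<tau> convex_hull_bary[OF bc(1)] by auto
  next
    case False
    then have "\<phi> z x = 0" using fe_vanishes_on_triangle[OF hat_fe \<tau>(1) _ \<tau>(2)] hat_off_triangle[OF \<tau>(1)] by blast
    then show ?thesis using that[of 0] by simp
  qed
qed

text \<open>Hat functions are nonnegative, and both are positive in the interior of a triangle at the common edge.\<close>
lemma l2_prod_hats_pos:
  assumes "closed_segment z y \<in> edges K"
  shows "Re (l2_prod \<Omega> (\<phi> z) (\<phi> y)) > 0"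
proof -
  obtain p where p: "p \<in> apexes K z y" using assms edge_iff_apexes[OF mesh] by blast
  let ?\<tau> = "convex hull {z, y, p}"
  have \<tau>: "?\<tau> \<in> K" using p by (simp add: apexes_def)
  have o: "orient z y p \<noteq> 0" using apex_orient[OF mesh p] .
  let ?h = "\<lambda>x. indicator \<Omega> x *\<^sub>R Re (\<phi> z x * cnj (\<phi> y x))"
  have int: "integrable lebesgue (\<lambda>x. indicator \<Omega> x *\<^sub>R (\<phi> z x * cnj (\<phi> y x)))"
    using l2_integrable[OF hat_fe hat_fe] by (simp add: set_integrable_def)
  have intR: "integrable lebesgue ?h" using integrable_Re[OF int] by (simp add: mult.commute)
  have nn: "0 \<le> ?h x" for x
  proof (cases "x \<in> \<Omega>")
    case True
    then have "x \<in> closure \<Omega>" using closure_subset by blast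
    then obtain r s where "0 \<le> r" "\<phi> z x = complex_of_real r" "0 \<le> s" "\<phi> y x = complex_of_real s"
      using hat_nonneg by metis
    then show ?thesis by simp
  qed simp
  have eq: "Re (l2_prod \<Omega> (\<phi> z) (\<phi> y)) = integral\<^sup>L lebesgue ?h"
    unfolding l2_prod_def set_lebesgue_integral_def using int
    by (subst integral_Re[symmetric]) auto
  have "integral\<^sup>L lebesgue ?h \<noteq> 0"
  proof
    assume "integral\<^sup>L lebesgue ?h = 0"
    then have "AE x in lebesgue. ?h x = 0"
      using integral_nonneg_eq_0_iff_AE[OF intR] nn by auto
    then obtain N where N: "{x \<in> space lebesgue. ?h x \<noteq> 0} \<subseteq> N" "emeasure lebesgue N = 0" "N \<in> sets lebesgue"
      by (rule AE_E) auto
    have "interior ?\<tau> \<subseteq> {x \<in> space lebesgue. ?h x \<noteq> 0}"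
    proof
      fix x assume x: "x \<in> interior ?\<tau>"
      then have "x \<in> \<Omega>" "x \<in> ?\<tau>" using interior_triangle_subset[OF \<tau>] interior_subset by blast+
      moreover have "\<phi> z x = of_real (bary y p z x)" using hat_on_own_triangle[OF \<tau> \<open>x \<in> ?\<tau>\<close>] .
      moreover have "\<phi> y x = of_real (bary p z y x)"
        using hat_on_own_triangle[of y p z x] \<tau> \<open>x \<in> ?\<tau>\<close> by (simp add: insert_commute)
      moreover have "0 < bary y p z x" "0 < bary p z y x" using x interior_triangle_bary[OF o] by auto
      ultimately show "x \<in> {x \<in> space lebesgue. ?h x \<noteq> 0}" by simp
    qed
    moreover have "negligible N"
      unfolding negligible_iff_null_sets using N(2,3) by (rule null_setsI)
    ultimately have "negligible (interior ?\<tau>)"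
      using N(1) negligible_subset by blast
    then show False
      using open_not_negligible[OF open_interior] triangle_interior_nonempty[OF simplexK[OF \<tau>]] by blast
  qed
  moreover have "integral\<^sup>L lebesgue ?h \<ge> 0" using nn by (intro Bochner_Integration.integral_nonneg) auto
  ultimately show ?thesis unfolding eq by linarith
qed

lemma tri_grad_own_triangle:
  assumes "convex hull {a, b, c} \<in> K"
  shows "tri_grad (convex hull {a, b, c}) (\<phi> a) i = of_real (bary_grad b c a $ i)"
proof -
  have o: "orient a b c \<noteq> 0" using triangle_hull_imp_orient simplexK assms by blast
  have "a \<in> nodes K" "b \<in> nodes K" "c \<in> nodes K" using assms(1) verts_triangle[OF o] by (auto simp: nodes_eq)
  then show ?thesis
    using tri_grad_eq[OF hat_fe assms] hat_node orient_distinct[OF o] by simp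
qed

lemma grad_prod_adjacent_hats:
  assumes "apexes K z y = {p, q}" "p \<noteq> q"
  shows "grad_prod \<Omega> (\<phi> z) (\<phi> y) = of_real (
    - (cos (angle_at p z y) / sin (angle_at p z y) + cos (angle_at q z y) / sin (angle_at q z y)) / 2)"
proof -
  let ?T = "\<lambda>\<tau>. complex_of_real (area \<tau>) * (\<Sum>i\<in>UNIV. tri_grad \<tau> (\<phi> z) i * cnj (tri_grad \<tau> (\<phi> y) i))"
  have p: "p \<in> apexes K z y" and q: "q \<in> apexes K z y" using assms by auto
  have T: "?T (convex hull {z, y, s}) = of_real (- (cos (angle_at s z y) / sin (angle_at s z y)) / 2)"
    if s: "s \<in> apexes K z y" for s
  proof -
    have K: "convex hull {z, y, s} \<in> K" "convex hull {y, s, z} \<in> K"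
      using s by (auto simp: apexes_def insert_commute)
    have "tri_grad (convex hull {z, y, s}) (\<phi> z) i = of_real (bary_grad y s z $ i)"
      "tri_grad (convex hull {z, y, s}) (\<phi> y) i = of_real (bary_grad s z y $ i)" for i
      using tri_grad_own_triangle[OF K(1)] tri_grad_own_triangle[OF K(2)] by (simp_all add: insert_commute)
    then have "?T (convex hull {z, y, s}) = of_real (area (convex hull {z, y, s}) * (bary_grad y s z \<bullet> bary_grad s z y))"
      by (simp add: inner_vec_def)
    then show ?thesis using local_stiffness_cot[OF apex_orient[OF mesh s]] by simp
  qed
  have "grad_prod \<Omega> (\<phi> z) (\<phi> y) = sum ?T K" by (rule grad_prod_eq[OF hat_fe hat_fe])
  also have "\<dots> = sum ?T {convex hull {z, y, p}, convex hull {z, y, q}}"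
  proof (rule sum.mono_neutral_right)
    show "finite K" by (rule mesh_finite[OF mesh])
    show "{convex hull {z, y, p}, convex hull {z, y, q}} \<subseteq> K" using p q by (auto simp: apexes_def)
    show "\<forall>\<tau>\<in>K - {convex hull {z, y, p}, convex hull {z, y, q}}. ?T \<tau> = 0"
    proof
      fix \<tau> assume \<tau>: "\<tau> \<in> K - {convex hull {z, y, p}, convex hull {z, y, q}}"
      have zy: "z \<noteq> y" using apex_neq[OF mesh p] by blast
      have "\<not> (z \<in> verts \<tau> \<and> y \<in> verts \<tau>)"
      proof
        assume "z \<in> verts \<tau> \<and> y \<in> verts \<tau>"
        then obtain s where "s \<in> apexes K z y" "\<tau> = convex hull {z, y, s}"
          using triangle_apex[OF mesh, of \<tau> z y] \<tau> zy by blast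
        then show False using \<tau> assms(1) by auto
      qed
      moreover have "tri_grad \<tau> (\<phi> w) i = 0" if "w \<notin> verts \<tau>" for w i
        by (rule tri_grad_vanishes[OF hat_fe]) (use \<tau> hat_off_triangle[OF _ that] in auto)
      ultimately have "tri_grad \<tau> (\<phi> z) i * cnj (tri_grad \<tau> (\<phi> y) i) = 0" for i by auto
      then have "(\<Sum>i\<in>UNIV. tri_grad \<tau> (\<phi> z) i * cnj (tri_grad \<tau> (\<phi> y) i)) = 0"
        by (intro sum.neutral ballI)
      then show "?T \<tau> = 0" by (simp only: mult_zero_right)
    qed
  qed
  also have "\<dots> = ?T (convex hull {z, y, p}) + ?T (convex hull {z, y, q})"
  proof -
    have "verts (convex hull {z, y, p}) \<noteq> verts (convex hull {z, y, q})"
      unfolding apex_verts[OF mesh p] apex_verts[OF mesh q] using assms(2) apex_neq[OF mesh p] by auto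
    then have "convex hull {z, y, p} \<noteq> convex hull {z, y, q}" by metis
    then show ?thesis by simp
  qed
  also have "\<dots> = of_real (- (cos (angle_at p z y) / sin (angle_at p z y)) / 2) + of_real (- (cos (angle_at q z y) / sin (angle_at q z y)) / 2)"
    by (simp only: T[OF p] T[OF q])
  finally show ?thesis by (simp add: add_divide_distrib)
qed

lemma angle_sum_apexes: "angle_sum K a b = (\<Sum>p\<in>apexes K a b. angle_at p a b)"
  by (simp add: angle_sum_def apexes_def)

lemma interior_node_edge:
  assumes "z \<notin> frontier \<Omega>" "closed_segment z y \<in> edges K"
  obtains p q where "apexes K z y = {p, q}" "p \<noteq> q" "orient z y p \<noteq> 0" "orient z y q \<noteq> 0"
    "open_segment z y \<subseteq> \<Omega>"
  using edge_dichotomy[OF mesh assms(2)]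
proof cases
  case 1
  then show ?thesis using assms(1) frontier_mesh by auto
next
  case (2 p q)
  then have "p \<noteq> q" by auto
  then show ?thesis using 2 that[of p q] Union_mesh domain_regular by auto
qed

text \<open>The real part is negative: the angle condition makes the gradient part nonpositive, and the mass
part is negative. The boundary part is zero as \<open>z\<close> is an inner node.\<close>
lemma transmission_entry_nonzero:
  assumes "z \<notin> frontier \<Omega>" "closed_segment z y \<in> edges K" "angle_sum K z y \<le> pi" "k \<noteq> 0"
  shows "B k (\<phi> z) (\<phi> y) \<noteq> 0"
proof -
  obtain p q where pq: "apexes K z y = {p, q}" "p \<noteq> q" "orient z y p \<noteq> 0" "orient z y q \<noteq> 0"
    using interior_node_edge[OF assms(1,2)] by metis
  have "angle_at p z y + angle_at q z y \<le> pi"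
    using assms(3) pq(1,2) by (simp add: angle_sum_apexes)
  then have "cos (angle_at p z y) / sin (angle_at p z y) + cos (angle_at q z y) / sin (angle_at q z y) \<ge> 0"
    using angle_at_facts(1,2)[OF pq(3)] angle_at_facts(1,2)[OF pq(4)] cot_sum_nonneg by blast
  then have g: "Re (grad_prod \<Omega> (\<phi> z) (\<phi> y)) \<le> 0"
    unfolding grad_prod_adjacent_hats[OF pq(1,2)] by simp
  have b: "bdry (\<phi> z) (\<phi> y) = 0"
  proof (rule bdry_vanishes)
    fix a b x assume ab: "(a, b) \<in> bd_pairs" and x: "x \<in> closed_segment a b"
    have "a \<in> frontier \<Omega>" "b \<in> frontier \<Omega>" using bd_pairs_frontier[OF ab] by auto
    then have "a \<noteq> z" "b \<noteq> z" using assms(1) by auto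
    then have "\<phi> z a = 0" "\<phi> z b = 0" using ab hat_node by auto
    moreover have "closed_segment a b \<in> edges K" using ab by (auto simp: boundary_edges_def)
    ultimately have "\<phi> z x = 0" using fe_vanishes_on_edge[OF hat_fe] x by blast
    then show "\<phi> z x * cnj (\<phi> y x) = 0" by simp
  qed
  have "Re (B k (\<phi> z) (\<phi> y)) = Re (grad_prod \<Omega> (\<phi> z) (\<phi> y)) - k\<^sup>2 * Re (l2_prod \<Omega> (\<phi> z) (\<phi> y))"
    by (simp add: helmholtz_form_def b flip: of_real_power)
  moreover have "k\<^sup>2 * Re (l2_prod \<Omega> (\<phi> z) (\<phi> y)) > 0" using l2_prod_hats_pos[OF assms(2)] assms(4) by simp
  ultimately have "Re (B k (\<phi> z) (\<phi> y)) < 0" using g by linarith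
  then show ?thesis by auto
qed

text \<open>The gradient and mass parts of \<open>a\<^sub>k(u, u)\<close> are real, so its imaginary part is \<open>-k\<close> times a sum of
nonnegative integrals of \<open>|u|\<^sup>2\<close> over the boundary edges.\<close>
lemma boundary_trace_zero:
  assumes "u \<in> S" "B k u u = 0" "k \<noteq> 0" "(a, b) \<in> bd_pairs"
  shows "u a = 0"
proof -
  define I where "I = (\<lambda>(a, b). dist a b * integral {0..1} (\<lambda>t. (norm (u (a + t *\<^sub>R (b - a))))\<^sup>2))"
  have real: "Im x = 0" if "x = cnj x" for x using that by (simp add: complex_eq_iff)
  have "Im (grad_prod \<Omega> u u) = 0" "Im (l2_prod \<Omega> u u) = 0"
    using real[OF grad_prod_cnj[OF assms(1,1)]] real[OF l2_prod_cnj] by auto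
  then have "Im (B k u u) = - k * Re (bdry u u)"
    by (simp add: helmholtz_form_def flip: of_real_power)
  then have Re0: "Re (bdry u u) = 0" using assms(2,3) by simp
  have cont: "continuous_on {0..1} (\<lambda>t. (norm (u (a + t *\<^sub>R (b - a))))\<^sup>2)" if "(a, b) \<in> bd_pairs" for a b
    using boundary_continuous[OF that assms(1)] by (intro continuous_intros)
  have seg: "segment_integral a b (\<lambda>x. u x * cnj (u x)) = of_real (I (a, b))" if "(a, b) \<in> bd_pairs" for a b
  proof -
    have "(LINT t:{0..1}|lebesgue. u (a + t *\<^sub>R (b - a)) * cnj (u (a + t *\<^sub>R (b - a)))) =
        of_real (LINT t:{0..1}|lebesgue. (norm (u (a + t *\<^sub>R (b - a))))\<^sup>2)"
      unfolding set_integral_complex_of_real[symmetric] by (simp only: complex_norm_square)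
    also have "(LINT t:{0..1}|lebesgue. (norm (u (a + t *\<^sub>R (b - a))))\<^sup>2) = integral {0..1} (\<lambda>t. (norm (u (a + t *\<^sub>R (b - a))))\<^sup>2)"
      using absolutely_integrable_continuous_real[OF cont[OF that]]
      by (rule set_lebesgue_integral_eq_integral(2))
    finally show ?thesis by (simp add: segment_integral_def I_def)
  qed
  have "bdry u u = (1/2) * (\<Sum>e\<in>bd_pairs. of_real (I e))"
    unfolding boundary_integral_def
    by (intro arg_cong2[of _ _ _ _ "(*)"] refl sum.cong) (auto simp: seg)
  then have "bdry u u = of_real ((1/2) * (\<Sum>e\<in>bd_pairs. I e))" by simp
  then have "(\<Sum>e\<in>bd_pairs. I e) = 0" using Re0 by (simp only: Re_complex_of_real)
  moreover have nn: "I e \<ge> 0" if "e \<in> bd_pairs" for e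
    using that by (auto simp: I_def intro!: mult_nonneg_nonneg integral_nonneg integrable_continuous_real cont)
  ultimately have "I (a, b) = 0"
    using sum_nonneg_eq_0_iff[OF finite_bd_pairs, of I] assms(4) by blast
  moreover have "a \<noteq> b" using assms(4) edge_iff_verts[OF mesh] by (auto simp: boundary_edges_def)
  ultimately have "integral {0..1} (\<lambda>t. (norm (u (a + t *\<^sub>R (b - a))))\<^sup>2) = 0" by (simp add: I_def)
  then have "\<forall>t\<in>{0..1}. (norm (u (a + t *\<^sub>R (b - a))))\<^sup>2 = 0"
    using integral_eq_0_iff[OF cont[OF assms(4)]] by auto
  then show ?thesis by (auto dest!: bspec[of _ _ 0])
qed

lemma frontier_node_trace_zero:
  assumes "u \<in> S" "B k u u = 0" "k \<noteq> 0" "z \<in> nodes K" "z \<in> frontier \<Omega>"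
  shows "u z = 0"
proof -
  obtain b where b: "closed_segment z b \<in> edges K" "closed_segment z b \<subseteq> frontier \<Omega>"
    using frontier_node_has_frontier_edge[OF mesh assms(4)] assms(5) frontier_mesh by auto
  have "b \<in> nodes K" using b(1) edge_iff_verts[OF mesh] by (auto simp: nodes_eq)
  then have "(z, b) \<in> bd_pairs" using b assms(4) by (simp add: boundary_edges_def)
  then show ?thesis using boundary_trace_zero[OF assms(1-3)] by blast
qed

lemma regular_if_trivial_kernel:
  assumes "\<And>u. u \<in> S \<Longrightarrow> (\<And>z. z \<in> nodes K \<Longrightarrow> B k u (\<phi> z) = 0) \<Longrightarrow> \<forall>z\<in>nodes K. u z = 0"
  shows "regular_system_matrix \<Omega> K k"
  unfolding regular_system_matrix_def
proof (intro allI impI)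
  fix zs assume zs: "distinct zs \<and> set zs = nodes K"
  let ?n = "length zs" and ?A = "system_matrix \<Omega> K k zs"
  have A: "?A \<in> carrier_mat ?n ?n" by (simp add: system_matrix_def)
  have "det ?A \<noteq> 0"
  proof
    assume "det ?A = 0"
    then obtain v where v: "v \<in> carrier_vec ?n" "v \<noteq> 0\<^sub>v ?n" "?A *\<^sub>v v = 0\<^sub>v ?n"
      using det_0_iff_vec_prod_zero_field[OF A] by blast
    define u where "u = (\<lambda>x. \<Sum>j<?n. vec_index v j * \<phi> (zs ! j) x)"
    have u: "u \<in> S" unfolding u_def by (intro fe_sum hat_fe) auto
    have "B k u (\<phi> z) = 0" if z: "z \<in> nodes K" for z
    proof -
      obtain i where i: "i < ?n" "z = zs ! i" using z zs by (metis in_set_conv_nth)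
      have "B k u (\<phi> z) = (\<Sum>j<?n. vec_index v j * B k (\<phi> (zs ! j)) (\<phi> z))"
        unfolding u_def by (intro form_sum_left hat_fe) auto
      also have "\<dots> = vec_index (?A *\<^sub>v v) i"
        using i v(1) by (simp add: system_matrix_def scalar_prod_def atLeast0LessThan mult.commute)
      also have "\<dots> = 0" using v(3) i by simp
      finally show ?thesis .
    qed
    then have u0: "\<forall>z\<in>nodes K. u z = 0" using assms[OF u] by blast
    have "vec_index v i = 0" if i: "i < ?n" for i
    proof -
      have zi: "zs ! i \<in> nodes K" using i zs nth_mem by blast
      have "u (zs ! i) = (\<Sum>j<?n. vec_index v j * (if i = j then 1 else 0))"
        unfolding u_def using zs i zi hat_node
        by (intro sum.cong) (auto simp: nth_eq_iff_index_eq)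
      also have "\<dots> = vec_index v i" using i by (simp add: if_distrib sum.delta cong: if_cong)
      finally show ?thesis using u0 zi by simp
    qed
    then have "v = 0\<^sub>v ?n" using v(1) by (intro eq_vecI) auto
    then show False using v(2) by simp
  qed
  then have "?A \<in> Units (ring_mat TYPE(complex) ?n ())" by (rule det_non_zero_imp_unit[OF A])
  then obtain C where C: "C \<in> carrier_mat ?n ?n" "?A * C = 1\<^sub>m ?n" "C * ?A = 1\<^sub>m ?n"
    by (auto simp: Units_def ring_mat_def)
  then show "invertible_mat ?A"
    using A unfolding invertible_mat_def inverts_mat_def by auto
qed

text \<open>In the expansion of \<open>a\<^sub>k(u, b\<^sub>y)\<close> for \<open>y = par z\<close> all terms except the one for \<open>z\<close> vanish: the nodes not
adjacent to \<open>y\<close> by locality, and \<open>y\<close> and its other neighbours by the induction hypothesis on the rank.\<close>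
theorem regular_if_transmission_order:
  assumes order: "transmission_order K (frontier \<Omega>) r par"
    and angle: "\<And>z. z \<in> nodes K \<Longrightarrow> z \<notin> frontier \<Omega> \<Longrightarrow> angle_sum K z (par z) \<le> pi"
    and "k \<noteq> 0"
  shows "regular_system_matrix \<Omega> K k"
proof (rule regular_if_trivial_kernel)
  fix u assume u: "u \<in> S" and ker: "\<And>z. z \<in> nodes K \<Longrightarrow> B k u (\<phi> z) = 0"
  note fin = finite_nodes[OF mesh]
  have exp: "u = (\<lambda>x. \<Sum>z\<in>nodes K. u z * \<phi> z x)" by (rule fe_expansion[OF u])
  have "B k u u = B k u (\<lambda>x. \<Sum>z\<in>nodes K. u z * \<phi> z x)" using exp by simp
  also have "\<dots> = (\<Sum>z\<in>nodes K. cnj (u z) * B k u (\<phi> z))"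
    by (rule form_sum_right[OF fin hat_fe u])
  also have "\<dots> = 0" using ker by simp
  finally have energy: "B k u u = 0" .
  have "u z = 0" if "z \<in> nodes K" for z
    using that
  proof (induction "r z" arbitrary: z rule: less_induct)
    case less
    show ?case
    proof (cases "z \<in> frontier \<Omega>")
      case True
      then show ?thesis using frontier_node_trace_zero[OF u energy assms(3) less.prems] by blast
    next
      case False
      let ?y = "par z"
      have y: "?y \<in> nodes K" "closed_segment z ?y \<in> edges K" "r ?y < r z"
        "\<And>x. x \<in> nodes K \<Longrightarrow> closed_segment x ?y \<in> edges K \<Longrightarrow> x \<noteq> z \<Longrightarrow> r x < r z"
        using order False less.prems unfolding transmission_order_def by blast+
      have zero: "u x * B k (\<phi> x) (\<phi> ?y) = 0" if x: "x \<in> nodes K" "x \<noteq> z" for x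
      proof (cases "x = ?y \<or> closed_segment x ?y \<in> edges K")
        case True
        then have "r x < r z" using y x by blast
        then show ?thesis using less.hyps x by simp
      next
        case False
        then show ?thesis using form_local by simp
      qed
      have "0 = B k u (\<phi> ?y)" using ker y by simp
      also have "\<dots> = B k (\<lambda>x. \<Sum>z\<in>nodes K. u z * \<phi> z x) (\<phi> ?y)" using exp by simp
      also have "\<dots> = (\<Sum>x\<in>nodes K. u x * B k (\<phi> x) (\<phi> ?y))"
        by (rule form_sum_left[OF fin hat_fe hat_fe])
      also have "\<dots> = u z * B k (\<phi> z) (\<phi> ?y)"
        using sum.remove[OF fin less.prems, of "\<lambda>x. u x * B k (\<phi> x) (\<phi> ?y)"] zero by simp
      finally show ?thesis
        using transmission_entry_nonzero[OF False y(2) angle[OF less.prems False] assms(3)] by simp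
    qed
  qed
  then show "\<forall>z\<in>nodes K. u z = 0" by blast
qed

end

section \<open>Transmission orders under bisection\<close>

lemma transmission_orderD:
  assumes "transmission_order K \<Gamma> r par" "z \<in> nodes K" "z \<notin> \<Gamma>"
  shows "par z \<in> nodes K" "closed_segment z (par z) \<in> edges K" "r (par z) < r z"
    "\<And>y. y \<in> nodes K \<Longrightarrow> closed_segment y (par z) \<in> edges K \<Longrightarrow> y \<noteq> z \<Longrightarrow> r y < r z"
  using assms unfolding transmission_order_def by blast+

lemma apex_edges:
  assumes "mesh K" "p \<in> apexes K a b"
  shows "closed_segment a p \<in> edges K" "closed_segment b p \<in> edges K" "closed_segment a b \<in> edges K"
  using apex_verts[OF assms] apex_neq[OF assms] assms(2)
  unfolding edge_iff_verts[OF assms(1)] by (auto simp: apexes_def)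

text \<open>If two parent edges \<open>[z, par z]\<close> and \<open>[w, par w]\<close> lay in one triangle, then \<open>w\<close> would be \<open>par z\<close> or another
neighbour of it, hence of smaller rank than \<open>z\<close>, and vice versa.\<close>
lemma parent_edges_separated:
  assumes "mesh K" "transmission_order K \<Gamma> r par"
    "z \<in> nodes K" "z \<notin> \<Gamma>" "w \<in> nodes K" "w \<notin> \<Gamma>" "w \<noteq> z" "\<tau> \<in> K"
  shows "\<not> {w, par w, z, par z} \<subseteq> verts \<tau>"
proof
  assume v: "{w, par w, z, par z} \<subseteq> verts \<tau>"
  have less: "r s < r t"
    if "t \<in> nodes K" "t \<notin> \<Gamma>" "s \<in> nodes K" "s \<noteq> t" "s \<in> verts \<tau>" "par t \<in> verts \<tau>" for s t
  proof (cases "s = par t")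
    case True
    then show ?thesis using transmission_orderD(3)[OF assms(2)] that by blast
  next
    case False
    then have "closed_segment s (par t) \<in> edges K"
      unfolding edge_iff_verts[OF assms(1)] using that assms(8) by blast
    then show ?thesis using transmission_orderD(4)[OF assms(2)] that by blast
  qed
  have "r w < r z" using less[of z w] assms v by blast
  moreover have "r z < r w" using less[of w z] assms v by blast
  ultimately show False by simp
qed

text \<open>Ranks are doubled to make room for the midpoint just below \<open>z\<close>. The neighbours of the midpoint
are \<open>z\<close>, \<open>par z\<close> and the opposite vertices; these are neighbours of \<open>par z\<close> and so have
smaller rank than \<open>z\<close>, as required for the midpoint to be the parent of \<open>z\<close>. Where another parent gains the
midpoint as a neighbour, it already had \<open>z\<close> as a neighbour or was \<open>z\<close> itself, so the rank of its child is at
least that of \<open>z\<close>.\<close>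
lemma transmission_order_bisect:
  assumes "mesh K" "transmission_order K \<Gamma> r par" "z \<in> nodes K" "z \<notin> \<Gamma>"
  defines "m \<equiv> midpoint z (par z)"
  shows "transmission_order (bisect K z (par z)) \<Gamma>
    (\<lambda>x. if x = m then 2 * r z - 1 else 2 * r x) (par(m := par z, z := m))"
proof -
  note D = transmission_orderD[OF assms(2)]
  let ?y = "par z" and ?K = "bisect K z (par z)"
  let ?r = "\<lambda>x. if x = m then 2 * r z - 1 else 2 * r x" and ?par = "par(m := par z, z := m)"
  have y: "?y \<in> nodes K" "closed_segment z ?y \<in> edges K" "r ?y < r z" using D assms(3,4) by blast+
  have ap: "apexes K z ?y \<noteq> {}" using y(2) edge_iff_apexes[OF assms(1)] by blast
  then obtain p0 where p0: "p0 \<in> apexes K z ?y" by blast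
  have zy: "z \<noteq> ?y" using apex_neq[OF assms(1) p0] by blast
  have mn: "m \<notin> nodes K" using midpoint_not_node[OF assms(1) p0] by (simp add: m_def)
  then have mz: "m \<noteq> z" "m \<noteq> ?y" using assms(3) y(1) by auto
  have N: "nodes ?K = insert m (nodes K)" using nodes_bisect[OF assms(1) zy ap] by (simp add: m_def)
  have old: "closed_segment x w \<in> edges ?K \<longleftrightarrow> closed_segment x w \<in> edges K \<and> {x, w} \<noteq> {z, ?y}"
    if "x \<in> nodes K" "w \<in> nodes K" for x w
    using edges_bisect_old[OF assms(1) zy ap that] .
  have new: "closed_segment x m \<in> edges ?K \<longleftrightarrow> x \<in> {z, ?y} \<union> apexes K z ?y" for x
    using edges_bisect_midpoint[OF assms(1) zy ap] by (simp add: m_def)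
  have ry: "?r x < ?r z" if "x \<in> {z, ?y} \<union> apexes K z ?y" "x \<noteq> z" for x
  proof -
    have x: "x \<in> nodes K" using that(1) assms(3) y(1) apex_nodes[OF assms(1)] by blast
    have "r x < r z"
    proof (cases "x = ?y")
      case False
      then have "x \<in> apexes K z ?y" using that by blast
      then have "closed_segment ?y x \<in> edges K" using apex_edges(2)[OF assms(1)] by blast
      then show ?thesis using D(4)[OF assms(3,4) x] that(2) by (simp add: closed_segment_commute)
    qed (use y in simp)
    then show ?thesis using x mn by auto
  qed
  show ?thesis
    unfolding transmission_order_def N
  proof (intro ballI)
    fix w assume w: "w \<in> insert m (nodes K) - \<Gamma>"
    let ?P = "\<lambda>v. v \<in> insert m (nodes K) \<and> closed_segment w v \<in> edges ?K \<and> ?r v < ?r w \<and>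
      (\<forall>x\<in>insert m (nodes K). closed_segment x v \<in> edges ?K \<longrightarrow> x \<noteq> w \<longrightarrow> ?r x < ?r w)"
    consider "w = m" | "w = z" | "w \<in> nodes K" "w \<noteq> z" "w \<noteq> m" using w by blast
    then show "?P (?par w)"
    proof cases
      case 1
      have "closed_segment m ?y \<in> edges ?K" using new[of ?y] by (simp add: closed_segment_commute)
      moreover have "?r x < ?r m" if "x \<in> insert m (nodes K)" "closed_segment x ?y \<in> edges ?K" "x \<noteq> m" for x
      proof -
        have x: "x \<in> nodes K" using that by blast
        then have "closed_segment x ?y \<in> edges K" "x \<noteq> z" using old[OF x y(1)] that(2) by auto
        then have "r x < r z" using D(4)[OF assms(3,4) x] by blast
        then show ?thesis using x mn by auto
      qed
      ultimately show ?thesis using 1 mz y by auto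
    next
      case 2
      have "closed_segment z m \<in> edges ?K" using new by blast
      moreover have "?r m < ?r z" using y(3) mz by auto
      moreover have "?r x < ?r z" if "closed_segment x m \<in> edges ?K" "x \<noteq> z" for x
        using ry that new by blast
      ultimately show ?thesis using 2 mz by auto
    next
      case 3
      let ?v = "par w"
      have wG: "w \<notin> \<Gamma>" using w by blast
      note Dw = D[OF 3(1) wG]
      have vm: "?v \<noteq> m" using Dw(1) mn by auto
      have ne: "{w, ?v} \<noteq> {z, ?y}" using Dw(3) y(3) 3(2) by (auto simp: doubleton_eq_iff)
      have "closed_segment w ?v \<in> edges ?K" using old[OF 3(1) Dw(1)] Dw(2) ne by blast
      moreover have "?r x < ?r w" if x: "x \<in> insert m (nodes K)" "closed_segment x ?v \<in> edges ?K" "x \<noteq> w" for x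
      proof (cases "x = m")
        case False
        then have xn: "x \<in> nodes K" using x by blast
        then have "r x < r w" using Dw(4) x old[OF xn Dw(1)] by blast
        then show ?thesis using False 3 by simp
      next
        case True
        then have "?v \<in> {z, ?y} \<union> apexes K z ?y" using x(2) new[of ?v] closed_segment_commute[of m ?v] by simp
        then have "?v = z \<or> closed_segment z ?v \<in> edges K"
          using y(2) apex_edges(1)[OF assms(1), of ?v z ?y] by auto
        then have "r z \<le> r w" using Dw(3) Dw(4)[OF assms(3)] by (metis le_less_linear less_imp_le_nat less_irrefl_nat)
        then show ?thesis using True 3 y(3) by auto
      qed
      ultimately show ?thesis using 3 Dw vm by auto
    qed
  qed
qed

definition parent_edges :: "point set \<Rightarrow> point set set \<Rightarrow> (point \<Rightarrow> point) \<Rightarrow> point set set" where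
  "parent_edges \<Omega> K par = {closed_segment z (par z) | z. z \<in> nodes K - frontier \<Omega>}"

text \<open>The invariant of the correction: \<open>U\<close> consists of the parent edges that may still violate the angle
condition.\<close>
definition certified_except ::
    "point set \<Rightarrow> point set set \<Rightarrow> (point \<Rightarrow> nat) \<Rightarrow> (point \<Rightarrow> point) \<Rightarrow> point set set \<Rightarrow> bool" where
  "certified_except \<Omega> K r par U \<longleftrightarrow> meshed_domain \<Omega> K \<and> transmission_order K (frontier \<Omega>) r par \<and>
     U \<subseteq> parent_edges \<Omega> K par \<and>
     (\<forall>z\<in>nodes K - frontier \<Omega>. closed_segment z (par z) \<notin> U \<longrightarrow> angle_sum K z (par z) \<le> pi)"

text \<open>The angle sums of the other parent edges are unchanged since these lie in other triangles. The equations for the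
opposite vertices are what makes the termination argument possible: all pieces of an edge see the
same two vertices.\<close>
lemma certified_except_bisect:
  assumes cert: "certified_except \<Omega> K r par U" and E: "closed_segment a b \<in> U"
  defines "m \<equiv> midpoint a b"
  shows "\<exists>r' par'. certified_except \<Omega> (bisect K a b) r' par'
      (U - {closed_segment a b} \<union> {closed_segment a m, closed_segment m b})"
    and "closed_segment a m \<notin> U" "closed_segment m b \<notin> U"
    and "\<And>x y. closed_segment x y \<in> U - {closed_segment a b} \<Longrightarrow> apexes (bisect K a b) x y = apexes K x y"
    and "apexes (bisect K a b) a m = apexes K a b" "apexes (bisect K a b) m b = apexes K a b"
proof -
  interpret meshed_domain \<Omega> K using cert by (simp add: certified_except_def)
  have order: "transmission_order K (frontier \<Omega>) r par" and U: "U \<subseteq> parent_edges \<Omega> K par"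
    and ang: "\<And>z. z \<in> nodes K - frontier \<Omega> \<Longrightarrow> closed_segment z (par z) \<notin> U \<Longrightarrow> angle_sum K z (par z) \<le> pi"
    using cert by (auto simp: certified_except_def)
  obtain z where z: "z \<in> nodes K" "z \<notin> frontier \<Omega>" "closed_segment a b = closed_segment z (par z)"
    using E U by (auto simp: parent_edges_def)
  note D = transmission_orderD[OF order]
  let ?y = "par z"
  have ab: "{a, b} = {z, ?y}" using z(3) by simp
  then have abc: "a = z \<and> b = ?y \<or> a = ?y \<and> b = z" by (auto simp: doubleton_eq_iff)
  have m: "m = midpoint z ?y" using abc by (auto simp: m_def midpoint_sym)
  have bis: "bisect K a b = bisect K z ?y" using abc bisect_commute by auto
  have apab: "apexes K a b = apexes K z ?y" using abc apexes_swap by auto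
  have y: "?y \<in> nodes K" "closed_segment z ?y \<in> edges K" using D z by blast+
  have ap: "apexes K z ?y \<noteq> {}" using y(2) edge_iff_apexes[OF mesh] by blast
  then obtain p0 where p0: "p0 \<in> apexes K z ?y" by blast
  have zy: "z \<noteq> ?y" using apex_neq[OF mesh p0] by blast
  have mn: "m \<notin> nodes K" using midpoint_not_node[OF mesh p0] by (simp add: m)
  have mz: "m \<noteq> z" "m \<noteq> ?y" using mn z(1) y(1) by auto
  let ?K = "bisect K z ?y" and ?par = "par(m := ?y, z := m)"
  have N: "nodes ?K = insert m (nodes K)" using nodes_bisect[OF mesh zy ap] by (simp add: m)
  have Unodes: "v \<in> nodes K \<and> w \<in> nodes K" if "closed_segment v w \<in> U" for v w
  proof -
    have "closed_segment v w \<in> parent_edges \<Omega> K par" using U that by blast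
    then obtain x where "x \<in> nodes K" "x \<notin> frontier \<Omega>" "{v, w} = {x, par x}"
      by (auto simp: parent_edges_def)
    then show ?thesis using D(1) by (auto simp: doubleton_eq_iff)
  qed
  show half: "closed_segment a m \<notin> U" "closed_segment m b \<notin> U" using Unodes mn by blast+
  have half': "closed_segment z m \<notin> U" "closed_segment m ?y \<notin> U" using Unodes mn by blast+
  have "m \<in> open_segment z ?y" using zy by (simp add: m)
  then have mO: "m \<in> \<Omega>" using interior_node_edge[OF z(2) y(2)] by blast
  then have mf: "m \<notin> frontier \<Omega>" using open_domain by (auto simp: frontier_def interior_open)
  have other: "apexes ?K w (par w) = apexes K w (par w)"
    if w: "w \<in> nodes K" "w \<notin> frontier \<Omega>" "w \<noteq> z" for w
    using apexes_bisect_other[OF mesh zy ap w(1) D(1)[OF w(1,2)]]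
      parent_edges_separated[OF mesh order z(1,2) w] by blast
  have halfap: "apexes ?K c m = apexes K z ?y" if "c \<in> {z, ?y}" for c
    using apexes_bisect_half[OF mesh zy that ap] by (simp add: m)
  show "apexes (bisect K a b) a m = apexes K a b" "apexes (bisect K a b) m b = apexes K a b"
    unfolding bis apab using halfap[of a] halfap[of b] abc apexes_swap[of ?K m b] by auto
  show "apexes (bisect K a b) x y = apexes K x y" if xy: "closed_segment x y \<in> U - {closed_segment a b}" for x y
  proof -
    have "closed_segment x y \<in> parent_edges \<Omega> K par" using U xy by blast
    then obtain w where w: "w \<in> nodes K" "w \<notin> frontier \<Omega>" "closed_segment x y = closed_segment w (par w)"
      by (auto simp: parent_edges_def)
    then have "w \<noteq> z" using xy z(3) by auto
    then have "apexes ?K w (par w) = apexes K w (par w)" using other w by blast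
    moreover have "{x, y} = {w, par w}" using w(3) by simp
    ultimately show ?thesis
      unfolding bis using apexes_swap by (auto simp: doubleton_eq_iff)
  qed
  let ?U = "U - {closed_segment a b} \<union> {closed_segment a m, closed_segment m b}"
  have Ueq: "?U = U - {closed_segment z ?y} \<union> {closed_segment z m, closed_segment m ?y}"
  proof -
    have "{closed_segment a m, closed_segment m b} = {closed_segment z m, closed_segment m ?y}"
      using abc
    proof
      assume "a = ?y \<and> b = z"
      then have "closed_segment a m = closed_segment m ?y" "closed_segment m b = closed_segment z m"
        by (simp_all only: closed_segment_commute[of ?y m] closed_segment_commute[of m z])
      then show ?thesis by (simp only: insert_commute)
    qed blast
    then show ?thesis by (simp only: z(3))
  qed
  have dom: "meshed_domain \<Omega> ?K"
    using open_domain frontier_closure mesh_bisect[OF mesh zy] Union_bisect[OF mesh zy] Union_mesh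
    by unfold_locales simp_all
  have ord: "transmission_order ?K (frontier \<Omega>) (\<lambda>x. if x = m then 2 * r z - 1 else 2 * r x) ?par"
    using transmission_order_bisect[OF mesh order z(1,2)] by (simp add: m)
  have sub: "?U \<subseteq> parent_edges \<Omega> ?K ?par"
  proof
    fix e assume "e \<in> ?U"
    then consider "e \<in> U" "e \<noteq> closed_segment z ?y" | "e = closed_segment z m" | "e = closed_segment m ?y"
      unfolding Ueq by blast
    then show "e \<in> parent_edges \<Omega> ?K ?par"
    proof cases
      case 1
      then obtain w where w: "w \<in> nodes K" "w \<notin> frontier \<Omega>" "e = closed_segment w (par w)"
        using U by (auto simp: parent_edges_def)
      then have "w \<noteq> z" "w \<noteq> m" using 1 mn by auto
      then show ?thesis unfolding parent_edges_def N using w by (auto intro!: exI[of _ w])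
    next
      case 2
      then show ?thesis unfolding parent_edges_def N using z mz by (auto intro!: exI[of _ z])
    next
      case 3
      then show ?thesis unfolding parent_edges_def N using mf mz by (auto intro!: exI[of _ m])
    qed
  qed
  have angles: "angle_sum ?K w (?par w) \<le> pi"
    if w: "w \<in> nodes ?K - frontier \<Omega>" "closed_segment w (?par w) \<notin> ?U" for w
  proof -
    have "closed_segment m (?par m) \<in> ?U" "closed_segment z (?par z) \<in> ?U"
      unfolding Ueq using mz by simp_all
    then have "w \<noteq> m" "w \<noteq> z" using w(2) by blast+
    then have w': "w \<in> nodes K" "w \<notin> frontier \<Omega>" "w \<noteq> z" "w \<noteq> m" using w(1) N by auto
    have "closed_segment w (par w) \<noteq> closed_segment z ?y"
    proof
      assume "closed_segment w (par w) = closed_segment z ?y"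
      then have "{w, par w} = {z, ?y}" by simp
      then have "w = ?y" "par w = z" using w'(3) by (auto simp: doubleton_eq_iff)
      then show False using D(3)[OF w'(1,2)] D(3)[OF z(1,2)] by simp
    qed
    moreover have "?par w = par w" using w'(3,4) by simp
    ultimately have "closed_segment w (par w) \<notin> U" using w(2) unfolding Ueq by (metis Diff_iff UnI1 singletonD)
    then have "angle_sum K w (par w) \<le> pi" using ang w' by blast
    moreover have "angle_sum ?K w (par w) = angle_sum K w (par w)"
      unfolding angle_sum_def using other[OF w'(1-3)] by (simp add: apexes_def)
    ultimately show ?thesis using w' by simp
  qed
  show "\<exists>r' par'. certified_except \<Omega> (bisect K a b) r' par' ?U"
    unfolding bis certified_except_def using dom ord sub angles by blast
qed

text \<open>The parent edges that may violate the angle condition are split into the pieces \<open>W\<close> of the edge being processed and the edges \<open>T\<close> that are still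
waiting.\<close>
lemma bisect_until_ok_certified:
  assumes "bisect_until_ok W K K'" "certified_except \<Omega> K r par (W \<union> T)" "W \<inter> T = {}"
  shows "\<exists>r' par'. certified_except \<Omega> K' r' par' T"
  using assms
proof (induction arbitrary: r par rule: bisect_until_ok.induct)
  case (ok W K)
  then show ?case
    unfolding certified_except_def by (intro exI[of _ r] exI[of _ par]) blast
next
  case (bisect a b W K K')
  let ?m = "midpoint a b" and ?E = "closed_segment a b"
  let ?H = "{closed_segment a ?m, closed_segment ?m b}"
  have E: "?E \<in> W \<union> T" "?E \<notin> T" using bisect.hyps(1) bisect.prems(2) by blast+
  note c = certified_except_bisect[OF bisect.prems(1) E(1)]
  have "(W \<union> T) - {?E} \<union> ?H = (W - {?E} \<union> ?H) \<union> T" using E(2) by blast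
  then obtain r' par' where "certified_except \<Omega> (Defs.bisect K a b) r' par' ((W - {?E} \<union> ?H) \<union> T)"
    using c(1) by metis
  moreover have "(W - {?E} \<union> ?H) \<inter> T = {}" using c(2,3) bisect.prems(2) by blast
  ultimately show ?case using bisect.IH by blast
qed

lemma correct_angle_condition_certified:
  assumes "correct_angle_condition T K K'" "certified_except \<Omega> K r par T"
  shows "\<exists>r' par'. certified_except \<Omega> K' r' par' {}"
  using assms
proof (induction arbitrary: r par rule: correct_angle_condition.induct)
  case (finished K)
  then show ?case by blast
next
  case (edge E T K K1 K')
  have "insert E (T - {E}) = T" using edge.hyps(1) by blast
  then obtain r' par' where "certified_except \<Omega> K1 r' par' (T - {E})"
    using bisect_until_ok_certified[OF edge.hyps(2), of \<Omega> r par "T - {E}"] edge.prems by auto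
  then show ?case using edge.IH by blast
qed

section \<open>Termination of the correction\<close>

lemma angle_le_half_pi:
  assumes "(a - p) \<bullet> (b - p) \<ge> 0"
  shows "angle_at p a b \<le> pi / 2"
proof -
  let ?t = "((a - p) \<bullet> (b - p)) / (norm (a - p) * norm (b - p))"
  have "0 \<le> ?t" using assms by simp
  moreover have "?t \<le> 1"
    using norm_cauchy_schwarz[of "a - p" "b - p"]
    by (cases "norm (a - p) * norm (b - p) = 0") (auto simp: divide_le_eq_1 less_le)
  ultimately show ?thesis unfolding angle_at_def by (rule arccos_le_pi2)
qed

text \<open>If \<open>x\<close> and \<open>y\<close> are closer to each other than to \<open>p\<close>, then the angle at \<open>p\<close> is not obtuse; the bound
\<open>\<delta>\<close> is the distance of \<open>p\<close> from the edge.\<close>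
lemma short_edges_small_angles:
  assumes "closed E0" "p \<notin> E0"
  obtains \<delta> where "\<delta> > 0" "\<And>x y. x \<in> E0 \<Longrightarrow> y \<in> E0 \<Longrightarrow> dist x y < \<delta> \<Longrightarrow> angle_at p x y \<le> pi / 2"
proof -
  obtain \<delta> where \<delta>: "\<delta> > 0" "\<And>x. x \<in> E0 \<Longrightarrow> \<delta> \<le> dist p x"
    using separate_point_closed[OF assms] by blast
  have "angle_at p x y \<le> pi / 2" if "x \<in> E0" "y \<in> E0" "dist x y < \<delta>" for x y
  proof (rule angle_le_half_pi)
    have n: "norm (y - x) \<le> norm (x - p)"
      using \<delta>(2)[OF that(1)] that(3) by (simp add: dist_norm norm_minus_commute)
    have "(x - p) \<bullet> (y - p) = (norm (x - p))\<^sup>2 + (x - p) \<bullet> (y - x)"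
      by (simp add: power2_norm_eq_inner inner_diff_right inner_diff_left algebra_simps)
    moreover have "\<bar>(x - p) \<bullet> (y - x)\<bar> \<le> norm (x - p) * norm (y - x)" by (rule Cauchy_Schwarz_ineq2)
    moreover have "norm (x - p) * norm (y - x) \<le> norm (x - p) * norm (x - p)"
      using n by (intro mult_left_mono) auto
    ultimately show "(x - p) \<bullet> (y - p) \<ge> 0" by (simp add: power2_eq_square)
  qed
  then show ?thesis using that \<delta>(1) by blast
qed

lemma diameter_closed_segment: "diameter (closed_segment a b) = dist a b" for a b :: point
proof (rule antisym)
  show "diameter (closed_segment a b) \<le> dist a b"
  proof (rule diameter_le)
    fix x y assume "x \<in> closed_segment a b" "y \<in> closed_segment a b"
    then obtain s t where st: "0 \<le> s" "s \<le> 1" "x = (1 - s) *\<^sub>R a + s *\<^sub>R b"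
      "0 \<le> t" "t \<le> 1" "y = (1 - t) *\<^sub>R a + t *\<^sub>R b"
      unfolding in_segment by blast
    have "x - y = (t - s) *\<^sub>R (a - b)" by (simp add: st algebra_simps)
    then have "norm (x - y) = \<bar>t - s\<bar> * dist a b" by (simp add: dist_norm)
    also have "\<dots> \<le> 1 * dist a b" using st by (intro mult_right_mono) auto
    finally show "norm (x - y) \<le> dist a b" by simp
  qed simp
  show "dist a b \<le> diameter (closed_segment a b)"
    by (rule diameter_bounded_bound[OF compact_imp_bounded[OF compact_segment(1)]]) simp_all
qed

text \<open>A piece that violates the angle condition has length at least \<open>\<delta>\<close>, and halving it lowers the sum of
the squared lengths by half of its square, hence by at least \<open>\<delta>\<^sup>2 / 2\<close>. So the number of steps is at
most \<open>n\<close>.\<close>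
lemma bisect_until_ok_terminates:
  assumes \<delta>: "\<delta> > 0" "\<And>x y. x \<in> E0 \<Longrightarrow> y \<in> E0 \<Longrightarrow> dist x y < \<delta> \<Longrightarrow> (\<Sum>p\<in>P. angle_at p x y) \<le> pi"
    and "convex E0" "finite W" "certified_except \<Omega> K r par (W \<union> T)" "W \<inter> T = {}"
    and W: "\<And>x y. closed_segment x y \<in> W \<Longrightarrow> x \<in> E0 \<and> y \<in> E0 \<and> apexes K x y = P"
    and "(\<Sum>w\<in>W. (diameter w)\<^sup>2) \<le> real n * (\<delta>\<^sup>2 / 2)"
  shows "\<exists>K'. bisect_until_ok W K K'"
  using assms(4-)
proof (induction n arbitrary: W K r par rule: less_induct)
  case (less n)
  show ?case
  proof (cases "\<forall>a b. closed_segment a b \<in> W \<longrightarrow> angle_sum K a b \<le> pi")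
    case True
    then show ?thesis using bisect_until_ok.ok by blast
  next
    case False
    then obtain a b where ab: "closed_segment a b \<in> W" "angle_sum K a b > pi" by fastforce
    let ?m = "midpoint a b" and ?E = "closed_segment a b"
    let ?H = "{closed_segment a ?m, closed_segment ?m b}"
    let ?W = "W - {?E} \<union> ?H"
    have abE: "a \<in> E0" "b \<in> E0" and P: "apexes K a b = P" using less.prems(4)[OF ab(1)] by auto
    have "angle_sum K a b = (\<Sum>p\<in>P. angle_at p a b)" using P by (simp add: angle_sum_def apexes_def)
    then have "\<not> dist a b < \<delta>" using \<delta>(2)[OF abE] ab(2) by force
    then have long: "\<delta>\<^sup>2 \<le> (dist a b)\<^sup>2" using \<delta>(1) by (intro power_mono) auto
    have E: "?E \<in> W \<union> T" "?E \<notin> T" using ab(1) less.prems(3) by blast+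
    note c = certified_except_bisect[OF less.prems(2) E(1)]
    have "(W \<union> T) - {?E} \<union> ?H = ?W \<union> T" using E(2) by blast
    then obtain r' par' where cert: "certified_except \<Omega> (bisect K a b) r' par' (?W \<union> T)"
      using c(1) by metis
    have "(\<Sum>w\<in>?W. (diameter w)\<^sup>2) \<le> (\<Sum>w\<in>W - {?E}. (diameter w)\<^sup>2) + (\<Sum>w\<in>?H. (diameter w)\<^sup>2)"
      using less.prems(1) sum_nonneg[of "(W - {?E}) \<inter> ?H" "\<lambda>w. (diameter w)\<^sup>2"]
      by (subst sum_Un) auto
    also have "(\<Sum>w\<in>?H. (diameter w)\<^sup>2) \<le> (dist a b)\<^sup>2 / 4 + (dist a b)\<^sup>2 / 4"
    proof -
      have "(diameter (closed_segment a ?m))\<^sup>2 = (dist a b)\<^sup>2 / 4" "(diameter (closed_segment ?m b))\<^sup>2 = (dist a b)\<^sup>2 / 4"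
        by (simp_all add: diameter_closed_segment dist_midpoint power_divide)
      moreover have "(\<Sum>w\<in>{v, v'}. f w) \<le> f v + f v'" if "\<And>w. 0 \<le> f w"
        for v v' and f :: "point set \<Rightarrow> real"
        using that by (cases "v = v'") simp_all
      ultimately show ?thesis by (metis zero_le_power2)
    qed
    finally have drop: "(\<Sum>w\<in>?W. (diameter w)\<^sup>2) \<le> (\<Sum>w\<in>W - {?E}. (diameter w)\<^sup>2) + (dist a b)\<^sup>2 / 2"
      by simp
    have split: "(\<Sum>w\<in>W. (diameter w)\<^sup>2) = (dist a b)\<^sup>2 + (\<Sum>w\<in>W - {?E}. (diameter w)\<^sup>2)"
      using sum.remove[OF less.prems(1) ab(1), of "\<lambda>w. (diameter w)\<^sup>2"] by (simp add: diameter_closed_segment)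
    have nn: "(\<Sum>w\<in>W - {?E}. (diameter w)\<^sup>2) \<ge> 0" by (intro sum_nonneg) simp
    have "n \<noteq> 0"
    proof
      assume "n = 0"
      then have "(\<Sum>w\<in>W. (diameter w)\<^sup>2) \<le> 0" using less.prems(5) by simp
      then have "\<delta>\<^sup>2 \<le> 0" using split nn long by linarith
      then show False using \<delta>(1) by simp
    qed
    then obtain n' where n': "n = Suc n'" by (cases n) auto
    have "(\<Sum>w\<in>?W. (diameter w)\<^sup>2) \<le> real n' * (\<delta>\<^sup>2 / 2)"
      using drop split less.prems(5) long by (simp add: n' algebra_simps)
    moreover have "x \<in> E0 \<and> y \<in> E0 \<and> apexes (bisect K a b) x y = P" if xy: "closed_segment x y \<in> ?W" for x y
    proof -
      have mE: "?m \<in> E0"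
        using closed_segment_subset[OF abE \<open>convex E0\<close>] midpoint_in_closed_segment[of a b] by blast
      from xy consider "closed_segment x y \<in> W - {?E}" | "{x, y} = {a, ?m}" | "{x, y} = {?m, b}" by auto
      then show ?thesis
      proof cases
        case 1
        then have "apexes (bisect K a b) x y = apexes K x y" using c(4) by blast
        then show ?thesis using less.prems(4)[of x y] 1 by simp
      next
        case 2
        then show ?thesis using c(5) P abE mE apexes_swap by (auto simp: doubleton_eq_iff)
      next
        case 3
        then show ?thesis using c(6) P abE mE apexes_swap by (auto simp: doubleton_eq_iff)
      qed
    qed
    ultimately have "\<exists>K'. bisect_until_ok ?W (bisect K a b) K'"
      using less.IH[of n' ?W "bisect K a b" r' par'] n' less.prems(1,3) cert c(2,3) by blast
    then show ?thesis using bisect_until_ok.bisect[OF ab] by blast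
  qed
qed

lemma bisect_until_ok_exists:
  assumes "certified_except \<Omega> K r par T" "E \<in> T"
  shows "\<exists>K'. bisect_until_ok {E} K K'"
proof -
  interpret meshed_domain \<Omega> K using assms by (simp add: certified_except_def)
  obtain z where z: "z \<in> nodes K" "z \<notin> frontier \<Omega>" "E = closed_segment z (par z)"
    using assms by (auto simp: certified_except_def parent_edges_def)
  have e: "closed_segment z (par z) \<in> edges K"
    using transmission_orderD(2)[OF _ z(1,2)] assms by (auto simp: certified_except_def)
  obtain p q where pq: "apexes K z (par z) = {p, q}" "p \<noteq> q" "orient z (par z) p \<noteq> 0" "orient z (par z) q \<noteq> 0"
    using interior_node_edge[OF z(2) e] by metis
  have notin: "s \<notin> E" if "orient z (par z) s \<noteq> 0" for s
    using closed_segment_bary[OF that] bary_apex[OF that] z(3) by auto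
  have cl: "closed E" by (simp add: z(3))
  obtain \<delta> where \<delta>: "\<delta> > 0" "\<And>x y. x \<in> E \<Longrightarrow> y \<in> E \<Longrightarrow> dist x y < \<delta> \<Longrightarrow> angle_at p x y \<le> pi / 2"
    using short_edges_small_angles[OF cl notin[OF pq(3)]] by metis
  obtain \<epsilon> where \<epsilon>: "\<epsilon> > 0" "\<And>x y. x \<in> E \<Longrightarrow> y \<in> E \<Longrightarrow> dist x y < \<epsilon> \<Longrightarrow> angle_at q x y \<le> pi / 2"
    using short_edges_small_angles[OF cl notin[OF pq(4)]] by metis
  define \<rho> where "\<rho> = min \<delta> \<epsilon>"
  have \<rho>: "\<rho> > 0" using \<delta>(1) \<epsilon>(1) by (simp add: \<rho>_def)
  have small: "(\<Sum>s\<in>{p, q}. angle_at s x y) \<le> pi" if "x \<in> E" "y \<in> E" "dist x y < \<rho>" for x y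
    using \<delta>(2)[OF that(1,2)] \<epsilon>(2)[OF that(1,2)] that(3) pq(2) by (simp add: \<rho>_def)
  obtain n where n: "(\<Sum>w\<in>{E}. (diameter w)\<^sup>2) / (\<rho>\<^sup>2 / 2) \<le> real n" using real_arch_simple by blast
  then have n': "(\<Sum>w\<in>{E}. (diameter w)\<^sup>2) \<le> real n * (\<rho>\<^sup>2 / 2)" using \<rho> by (simp add: field_simps)
  have U: "{E} \<union> (T - {E}) = T" using assms(2) by blast
  have ends: "x \<in> E \<and> y \<in> E \<and> apexes K x y = {p, q}" if xy: "closed_segment x y \<in> {E}" for x y
  proof -
    have "{x, y} = {z, par z}" using xy z(3) by simp
    then show ?thesis using pq(1) apexes_swap z(3) by (auto simp: doubleton_eq_iff)
  qed
  show ?thesis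
    by (rule bisect_until_ok_terminates[OF \<rho> small, of E "{E}" \<Omega> K r par "T - {E}" n])
      (use assms(1) U n' ends z(3) in auto)
qed

lemma correct_angle_condition_exists:
  assumes "finite T" "certified_except \<Omega> K r par T"
  shows "\<exists>K'. correct_angle_condition T K K'"
  using assms
proof (induction "card T" arbitrary: T K r par)
  case 0
  then have "T = {}" by simp
  then show ?case using correct_angle_condition.finished by blast
next
  case (Suc n)
  then obtain E where E: "E \<in> T" by fastforce
  obtain K1 where K1: "bisect_until_ok {E} K K1" using bisect_until_ok_exists[OF Suc.prems(2) E] by blast
  have "insert E (T - {E}) = T" using E by blast
  then obtain r' par' where "certified_except \<Omega> K1 r' par' (T - {E})"
    using bisect_until_ok_certified[OF K1, of \<Omega> r par "T - {E}"] Suc.prems(2) by auto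
  moreover have "n = card (T - {E})" using Suc.hyps(2) Suc.prems(1) E by simp
  ultimately obtain K' where "correct_angle_condition (T - {E}) K1 K'"
    using Suc.hyps(1) Suc.prems(1) by blast
  then show ?case using correct_angle_condition.edge[OF E K1] by blast
qed

lemma certified_regular:
  assumes "certified_except \<Omega> K r par {}" "k \<noteq> 0"
  shows "regular_system_matrix \<Omega> K k"
proof -
  interpret meshed_domain \<Omega> K using assms by (simp add: certified_except_def)
  show ?thesis
    using assms by (intro regular_if_transmission_order[of r par]) (auto simp: certified_except_def)
qed

section \<open>The transmission order found by MOTZ\<close>

text \<open>A transmission order on the current test set, closed under the neighbours of the parents used so far.\<close>
definition motz_invariant ::
    "point set \<Rightarrow> point set set \<Rightarrow> (point \<Rightarrow> nat) \<Rightarrow> (point \<Rightarrow> point) \<Rightarrow> motz_state \<Rightarrow> bool" where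
  "motz_invariant \<Omega> K r par s \<longleftrightarrow>
     nodes K \<inter> frontier \<Omega> \<subseteq> motz_test s \<and> motz_test s \<subseteq> nodes K \<and> motz_dof s = nodes K - motz_test s \<and>
     (\<forall>z\<in>motz_test s - frontier \<Omega>.
        par z \<in> motz_test s \<and> closed_segment z (par z) \<in> edges K \<and> r (par z) < r z \<and>
        (\<forall>y\<in>nodes K. closed_segment y (par z) \<in> edges K \<longrightarrow> y \<noteq> z \<longrightarrow> y \<in> motz_test s \<and> r y < r z)) \<and>
     trans_edges s = {closed_segment z (par z) | z. z \<in> motz_test s - frontier \<Omega>} \<and>
     (motz_angle s \<longrightarrow> (\<forall>z\<in>motz_test s - frontier \<Omega>. angle_sum K z (par z) \<le> pi))"

text \<open>Transmission degree one means that \<open>z\<close> is the only neighbour of \<open>z'\<close> outside the test set, since an edge with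
an end point off the boundary is an inner edge. So \<open>z\<close> with parent \<open>z'\<close> and a rank above all
earlier ones extends the order.\<close>
lemma motz_invariant_move:
  assumes inv: "motz_invariant \<Omega> K r par s" and fin: "finite (nodes K)"
    and pair: "motz_pair (nodes K) (inner_edges \<Omega> K) s z z'"
  shows "\<exists>r' par'. motz_invariant \<Omega> K r' par' (motz_move K z z' s)"
proof -
  let ?T = "motz_test s"
  have I: "nodes K \<inter> frontier \<Omega> \<subseteq> ?T" "?T \<subseteq> nodes K" "motz_dof s = nodes K - ?T"
    "trans_edges s = {closed_segment z (par z) | z. z \<in> ?T - frontier \<Omega>}"
    "motz_angle s \<longrightarrow> (\<forall>z\<in>?T - frontier \<Omega>. angle_sum K z (par z) \<le> pi)"
    and parents: "\<forall>z\<in>?T - frontier \<Omega>.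
        par z \<in> ?T \<and> closed_segment z (par z) \<in> edges K \<and> r (par z) < r z \<and>
        (\<forall>y\<in>nodes K. closed_segment y (par z) \<in> edges K \<longrightarrow> y \<noteq> z \<longrightarrow> y \<in> ?T \<and> r y < r z)"
    using inv unfolding motz_invariant_def by - (elim conjE, assumption)+
  have P: "par w \<in> ?T" "closed_segment w (par w) \<in> edges K" "r (par w) < r w"
    "\<And>y. y \<in> nodes K \<Longrightarrow> closed_segment y (par w) \<in> edges K \<Longrightarrow> y \<noteq> w \<Longrightarrow> y \<in> ?T \<and> r y < r w"
    if "w \<in> ?T" "w \<notin> frontier \<Omega>" for w
    using bspec[OF parents, of w] that by simp_all
  have z: "z \<in> nodes K" "z \<notin> ?T" "z' \<in> ?T" "closed_segment z z' \<in> inner_edges \<Omega> K"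
    and deg: "trans_degree (nodes K) (inner_edges \<Omega> K) z' ?T = 1"
    using pair I(3) unfolding motz_pair_def by auto
  have zf: "z \<notin> frontier \<Omega>" using z I(1) by blast
  have ze: "closed_segment z z' \<in> edges K" using z(4) by (simp add: inner_edges_def)
  have nbr: "y \<in> ?T" if y: "y \<in> nodes K" "closed_segment y z' \<in> edges K" "y \<noteq> z" for y
  proof (rule ccontr)
    assume yT: "y \<notin> ?T"
    then have "y \<notin> frontier \<Omega>" using I(1) y(1) by blast
    then have "closed_segment y z' \<in> inner_edges \<Omega> K" using y(2) by (auto simp: inner_edges_def)
    define A where "A = {x \<in> nodes K - ?T. closed_segment x z' \<in> inner_edges \<Omega> K}"
    have "y \<in> A" "z \<in> A" using y(1) yT z \<open>closed_segment y z' \<in> inner_edges \<Omega> K\<close> by (auto simp: A_def)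
    moreover have "card A = 1" using deg by (simp add: trans_degree_def A_def)
    then obtain x where "A = {x}" by (auto simp: card_1_singleton_iff)
    ultimately show False using y(3) by blast
  qed
  define n where "n = Suc (Max (r ` ?T))"
  have finT: "finite ?T" using finite_subset[OF I(2) fin] .
  have n: "r y < n" if "y \<in> ?T" for y
    unfolding n_def using that finT by (simp add: less_Suc_eq_le)
  let ?r = "r(z := n)" and ?par = "par(z := z')"
  have old: "w \<noteq> z" if "w \<in> ?T" for w using that z(2) by blast
  let ?s = "motz_move K z z' s"
  have test: "motz_test ?s = insert z ?T" by (simp add: motz_move_def)
  have body: "?par w \<in> insert z ?T \<and> closed_segment w (?par w) \<in> edges K \<and> ?r (?par w) < ?r w \<and>
      (\<forall>y\<in>nodes K. closed_segment y (?par w) \<in> edges K \<longrightarrow> y \<noteq> w \<longrightarrow> y \<in> insert z ?T \<and> ?r y < ?r w)"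
    if w: "w \<in> insert z ?T - frontier \<Omega>" for w
  proof (cases "w = z")
    case True
    have "?r y < n" if "y \<in> nodes K" "closed_segment y z' \<in> edges K" "y \<noteq> z" for y
      using n[OF nbr[OF that]] that(3) by simp
    then show ?thesis using True z(3) ze n[OF z(3)] old[OF z(3)] nbr by auto
  next
    case False
    then have wT: "w \<in> ?T" "w \<notin> frontier \<Omega>" using w by auto
    have "?r y = r y" if "y \<in> ?T" for y using old[OF that] by simp
    then show ?thesis using False P[OF wT] wT(1) by simp
  qed
  have edges: "trans_edges ?s = {closed_segment w (?par w) | w. w \<in> insert z ?T - frontier \<Omega>}"
  proof -
    have "{closed_segment w (?par w) | w. w \<in> insert z ?T - frontier \<Omega>} =
        insert (closed_segment z z') {closed_segment w (par w) | w. w \<in> ?T - frontier \<Omega>}"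
    proof (intro subset_antisym subsetI)
      fix e assume "e \<in> {closed_segment w (?par w) | w. w \<in> insert z ?T - frontier \<Omega>}"
      then obtain w where "e = closed_segment w (?par w)" "w \<in> insert z ?T - frontier \<Omega>" by blast
      then show "e \<in> insert (closed_segment z z') {closed_segment w (par w) | w. w \<in> ?T - frontier \<Omega>}"
        by (cases "w = z") auto
    next
      fix e assume "e \<in> insert (closed_segment z z') {closed_segment w (par w) | w. w \<in> ?T - frontier \<Omega>}"
      then consider "e = closed_segment z z'" | w where "e = closed_segment w (par w)" "w \<in> ?T - frontier \<Omega>" by blast
      then show "e \<in> {closed_segment w (?par w) | w. w \<in> insert z ?T - frontier \<Omega>}"
      proof cases
        case 1 then show ?thesis using zf by (auto intro!: exI[of _ z])
      next
        case (2 w) then show ?thesis using old by (auto intro!: exI[of _ w])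
      qed
    qed
    then show ?thesis using I(4) by (simp add: motz_move_def)
  qed
  have angle: "motz_angle ?s \<longrightarrow> (\<forall>w\<in>insert z ?T - frontier \<Omega>. angle_sum K w (?par w) \<le> pi)"
    using I(5) old by (auto simp: motz_move_def split: if_splits)
  have "motz_invariant \<Omega> K ?r ?par ?s"
    unfolding motz_invariant_def test using I(1,2,3) z(1) body edges angle
    by (auto simp: motz_move_def)
  then show ?thesis by blast
qed

lemma motz_loop_invariant:
  assumes "motz_loop K (nodes K) (inner_edges \<Omega> K) s s'" "motz_trans s'" "finite (nodes K)"
    "motz_invariant \<Omega> K r par s"
  shows "\<exists>r' par'. motz_invariant \<Omega> K r' par' s' \<and> motz_dof s' = {}"
  using assms
proof (induction arbitrary: r par rule: motz_loop.induct)
  case (finished s)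
  then show ?case by blast
next
  case (stuck s)
  then show ?case by simp
next
  case (move s z z' s')
  obtain r' par' where "motz_invariant \<Omega> K r' par' (motz_move K z z' s)"
    using motz_invariant_move[OF move.prems(3,2) move.hyps(2)] by blast
  then show ?case using move.IH move.prems(1,2) by blast
qed

lemma motz_certificate:
  assumes "meshed_domain \<Omega> K" "motz K (nodes K \<inter> frontier \<Omega>) (nodes K) (inner_edges \<Omega> K) s" "motz_trans s"
  obtains r par where "certified_except \<Omega> K r par (trans_edges s)"
    "motz_angle s \<Longrightarrow> certified_except \<Omega> K r par {}" "finite (trans_edges s)"
proof -
  interpret meshed_domain \<Omega> K by fact
  let ?N = "nodes K \<inter> frontier \<Omega>"
  have fin: "finite (nodes K)" by (rule finite_nodes[OF mesh])
  have "motz_invariant \<Omega> K (\<lambda>_. 0) id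
      \<lparr>motz_dof = nodes K - ?N, motz_test = ?N, motz_trans = True, motz_angle = True, trans_edges = {}\<rparr>"
    by (auto simp: motz_invariant_def)
  then obtain r par where inv: "motz_invariant \<Omega> K r par s" "motz_dof s = {}"
    using motz_loop_invariant[OF assms(2)[unfolded motz_def] assms(3) fin] by blast
  then have test: "motz_test s = nodes K" by (auto simp: motz_invariant_def)
  have order: "transmission_order K (frontier \<Omega>) r par"
    using inv(1) unfolding motz_invariant_def transmission_order_def test by blast
  have T: "trans_edges s = parent_edges \<Omega> K par"
    using inv(1) unfolding motz_invariant_def parent_edges_def test by blast
  have "certified_except \<Omega> K r par (trans_edges s)"
    unfolding certified_except_def T using assms(1) order by (auto simp: parent_edges_def)
  moreover have "certified_except \<Omega> K r par {}" if "motz_angle s"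
    using inv(1) that assms(1) order unfolding certified_except_def motz_invariant_def test by blast
  moreover have "finite (trans_edges s)"
  proof -
    have "trans_edges s \<subseteq> (\<lambda>z. closed_segment z (par z)) ` nodes K" unfolding T parent_edges_def by blast
    then show ?thesis using fin finite_subset by blast
  qed
  ultimately show ?thesis using that by blast
qed

theorem theorem4p8:
  fixes \<Omega> :: "point set" and K :: "point set set"
  assumes "polygonal_lipschitz_domain \<Omega>"
    and "conforming_triangulation \<Omega> K"
  shows
    "(\<forall>s. motz K (nodes K \<inter> frontier \<Omega>) (nodes K) (inner_edges \<Omega> K) s
        \<and> motz_result s = Certified \<longrightarrow>
        (\<forall>k::real. k \<noteq> 0 \<longrightarrow> regular_system_matrix \<Omega> K k)) \<and>
     (\<forall>s. motz K (nodes K \<inter> frontier \<Omega>) (nodes K) (inner_edges \<Omega> K) s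
        \<and> motz_trans s \<and> \<not> motz_angle s \<longrightarrow>
        (\<exists>K'. correct_angle_condition (trans_edges s) K K') \<and>
        (\<forall>K'. correct_angle_condition (trans_edges s) K K' \<longrightarrow>
          (\<forall>k::real. k \<noteq> 0 \<longrightarrow> regular_system_matrix \<Omega> K' k)))"
proof -
  have dom: "meshed_domain \<Omega> K"
  proof
    show "open \<Omega>" using assms(1) by (simp add: polygonal_lipschitz_domain_def)
    show "frontier (closure \<Omega>) = frontier \<Omega>"
      using assms(1) lipschitz_frontier_closure by (simp add: polygonal_lipschitz_domain_def)
    show "mesh K" "\<Union>K = closure \<Omega>"
      using assms(2) triangulation_imp_mesh by (auto simp: conforming_triangulation_def)
  qed
  show ?thesis
  proof (intro conjI allI impI)
    fix s and k :: real
    assume s: "motz K (nodes K \<inter> frontier \<Omega>) (nodes K) (inner_edges \<Omega> K) s \<and> motz_result s = Certified"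
      and k: "k \<noteq> 0"
    then have "motz_trans s" "motz_angle s" by (auto simp: motz_result_def split: if_splits)
    then obtain r par where "certified_except \<Omega> K r par {}"
      using motz_certificate[OF dom] s by metis
    then show "regular_system_matrix \<Omega> K k" using certified_regular k by blast
  next
    fix s
    assume s: "motz K (nodes K \<inter> frontier \<Omega>) (nodes K) (inner_edges \<Omega> K) s \<and> motz_trans s \<and> \<not> motz_angle s"
    then obtain r par where c: "certified_except \<Omega> K r par (trans_edges s)" "finite (trans_edges s)"
      using motz_certificate[OF dom] by metis
    show "\<exists>K'. correct_angle_condition (trans_edges s) K K'"
      using correct_angle_condition_exists[OF c(2,1)] .
    fix K' and k :: real
    assume "correct_angle_condition (trans_edges s) K K'" and k: "k \<noteq> 0"
    then obtain r' par' where "certified_except \<Omega> K' r' par' {}"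
      using correct_angle_condition_certified c(1) by blast
    then show "regular_system_matrix \<Omega> K' k" using certified_regular k by blast
  qed
qed

end
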